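(* Let $\omega(k)=k^3$, $\alpha=e^{2\pi i/3}$, and let $q$ be the solution of the initial-boundary value problem $q_t-q_{xxx}=0$ for $x>0$, $t\in(0,T]$, with $q(\cdot,0)=q_o$, $q(0,\cdot)=g_0$, $q_x(0,\cdot)=g_1$, where $q_o,g_0,g_1$ satisfy the regularity assumptions listed in the context (no compatibility at the corner $(x,t)=(0,0)$ is required). Then, as $(x,t)\to(0,0)$ with $x>0$, $t>0$, $$q(x,t)=q_{\rm loc}(x,t)+\mathcal O\big(|x|^{3/2}+|t|^{1/2}\big),$$ where $$\begin{aligned}q_{\rm loc}(x,t)={}&q_o(0)\big(1+(1-\alpha^2)I_{\omega,0,2}(x,t)+(1-\alpha)I_{\omega,0,1}(x,t)\big)\\&+q_o'(0)\big(x+(1-\alpha)I_{\omega,1,2}(x,t)+(1-\alpha^2)I_{\omega,1,1}(x,t)\big)\\&-g_0(0)\big((1-\alpha^2)I_{\omega,0,2}(x,t)+(1-\alpha)I_{\omega,0,1}(x,t)\big)\\&-g_1(0)\big((1-\alpha)I_{\omega,1,2}(x,t)+(1-\alpha^2)I_{\omega,1,1}(x,t)\big),\end{aligned}$$ and $q_o(0),q_o'(0),g_0(0),g_1(0)$ denote one-sided limits at $0^+$.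
   Context: Assumptions on the data: (i) $q_o\in L^2(\mathbb R^+)\cap L^1(\mathbb R^+,(1+|x|)^\ell)$ for some $\ell\ge 0$; (ii) there are $0=x_0<x_1<\dots<x_M<x_{M+1}=\infty$ such that $q_o\in H^2((x_i,x_{i+1}))$ for each $i=0,\dots,M$ and $q_o(x_i^+)\ne q_o(x_i^-)$ for $i=1,\dots,M$; (iii) there are $0=t_0<t_1<\dots<t_K<t_{K+1}=T$ such that $g_0\in H^2((t_i,t_{i+1}))$ and $g_1\in H^1((t_i,t_{i+1}))$ for each $i=0,\dots,K$ ($g_0,g_1$ may or may not be discontinuous at each $t_i$, $i\ge1$). For a fixed $R>0$ let $D_1^+=\{k:\ 0\le\arg k\le\pi/3,\ |k|\ge R\}$ and $D_2^+=\{k:\ 2\pi/3\le\arg k\le\pi,\ |k|\ge R\}$ (the two components of $\{\mathrm{Im}(k^3)\ge0\}$ in the upper half-plane with a disc removed). Boundaries are oriented with the region on the left, so $\partial D_1^+$ runs from $e^{i\pi/3}\infty$ to $+\infty$ and $\partial D_2^+$ runs from $-\infty$ to $e^{2\pi i/3}\infty$. Integrals over unbounded contours are limits, as $r\to\infty$, of the integrals over the part of the contour in $\{|k|<r\}$. The solution $q$ is the $L^2$ solution (weak solution in $\mathbb R^+\times(0,T)$, $q\in C^0([0,T];L^2(\mathbb R^+))$ with $q(\cdot,0)=q_o$ a.e., $\partial_x^jq\in C^0([0,\infty);H^{1/3-j/3}(0,T))$ with $\partial_x^jq(0,\cdot)=g_j$ a.e., $j=0,1$), which for $x>0$, $t>0$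 is given by $$q(x,t)=\frac1{2\pi}\int_{\mathbb R}e^{ikx-i\omega(k)t}\hat q_o(k)\,dk-\frac1{2\pi}\int_{\partial D_1^+}e^{ikx-i\omega(k)t}\tilde g(k,t)\,dk-\frac1{2\pi}\int_{\partial D_2^+}e^{ikx-i\omega(k)t}\tilde g(k,t)\,dk,$$ $$\tilde g(k,t)=\hat q_o(\alpha k)+(\alpha^2-1)k^2\tilde g_0(-\omega(k),t)-i(\alpha-1)k\,\tilde g_1(-\omega(k),t),\quad k\in\partial D_2^+,$$ $$\tilde g(k,t)=\hat q_o(\alpha^2 k)+(\alpha-1)k^2\tilde g_0(-\omega(k),t)-i(\alpha^2-1)k\,\tilde g_1(-\omega(k),t),\quad k\in\partial D_1^+,$$ with $\hat q_o(k)=\int_0^\infty e^{-ikx}q_o(x)\,dx$ and $\tilde g_j(\kappa,t)=\int_0^te^{-i\kappa s}g_j(s)\,ds$. The special functions are $$I_{\omega,m,j}(x,t)=\frac1{2\pi}\int_{\partial D_j^+}e^{ikx-i\omega(k)t}\frac{dk}{(ik)^{m+1}},\qquad m=0,1,\ j=1,2.$$ *)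

theory Defs
  imports "HOL-Complex_Analysis.Complex_Analysis" "HOL-Library.Landau_Symbols"
begin

section \<open>Lebesgue and Sobolev spaces\<close>

definition square_integrable_on :: "('a::euclidean_space \<Rightarrow> complex) \<Rightarrow> 'a set \<Rightarrow> bool"
  where "square_integrable_on f S \<longleftrightarrow>
    set_borel_measurable lebesgue S f \<and> set_integrable lebesgue S (\<lambda>x. (norm (f x))\<^sup>2)"

definition locally_integrable_on :: "('a::euclidean_space \<Rightarrow> complex) \<Rightarrow> 'a set \<Rightarrow> bool"
  where "locally_integrable_on f S \<longleftrightarrow>
    (\<forall>C. compact C \<and> C \<subseteq> S \<longrightarrow> set_integrable lebesgue C f)"

definition test_function :: "real set \<Rightarrow> (real \<Rightarrow> real) \<Rightarrow> bool"
  where "test_function S \<phi> \<longleftrightarrow>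
    (\<forall>n. ((deriv ^^ n) \<phi>) differentiable_on UNIV) \<and>
    (\<exists>C. compact C \<and> C \<subseteq> S \<and> (\<forall>x. x \<notin> C \<longrightarrow> \<phi> x = 0))"

definition has_weak_deriv :: "real set \<Rightarrow> (real \<Rightarrow> complex) \<Rightarrow> (real \<Rightarrow> complex) \<Rightarrow> bool"
  where "has_weak_deriv S f g \<longleftrightarrow>
    locally_integrable_on f S \<and> locally_integrable_on g S \<and>
    (\<forall>\<phi>. test_function S \<phi> \<longrightarrow>
      (LINT x:S|lebesgue. f x * of_real (deriv \<phi> x)) = - (LINT x:S|lebesgue. g x * of_real (\<phi> x)))"

text \<open>A weak derivative is determined only up to a null set, and only on \<open>S\<close>.\<close>

definition weak_deriv :: "real set \<Rightarrow> (real \<Rightarrow> complex) \<Rightarrow> real \<Rightarrow> complex"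
  where "weak_deriv S f = (SOME g. has_weak_deriv S f g)"

text \<open>The integer-order space \<open>H\<^sup>m(S)\<close>; \<open>D i\<close> is the \<open>i\<close>-th weak derivative.\<close>

definition sobolev_H :: "nat \<Rightarrow> real set \<Rightarrow> (real \<Rightarrow> complex) \<Rightarrow> bool"
  where "sobolev_H m S f \<longleftrightarrow> (\<exists>D :: nat \<Rightarrow> real \<Rightarrow> complex. D 0 = f \<and>
    (\<forall>i\<le>m. square_integrable_on (D i) S) \<and> (\<forall>i<m. has_weak_deriv S (D i) (D (Suc i))))"

text \<open>
  Elements of \<open>H\<^sup>m\<close> are classes modulo null sets, so a one-sided limit is the limit of a
  suitable representative.  It does not depend on the representative when \<open>S\<close> is \<open>{a<..}\<close>
  or \<open>{..<a}\<close>, the only cases used.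
\<close>

definition ess_lim :: "real set \<Rightarrow> real \<Rightarrow> (real \<Rightarrow> complex) \<Rightarrow> complex"
  where "ess_lim S a f =
    (THE L. \<exists>h. (AE x in lebesgue. x \<in> S \<longrightarrow> f x = h x) \<and> (h \<longlongrightarrow> L) (at a within S))"

abbreviation right_lim :: "(real \<Rightarrow> complex) \<Rightarrow> real \<Rightarrow> complex"
  where "right_lim f a \<equiv> ess_lim {a<..} a f"

abbreviation left_lim :: "(real \<Rightarrow> complex) \<Rightarrow> real \<Rightarrow> complex"
  where "left_lim f a \<equiv> ess_lim {..<a} a f"

text \<open>
  The fractional space \<open>H\<^sup>s(S)\<close> for \<open>0 \<le> s < 1\<close>, with the Sobolev--Slobodeckij norm
  (\<open>H\<^sup>0 = L\<^sup>2\<close>).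
\<close>

definition slobodeckij_quotient :: "real \<Rightarrow> (real \<Rightarrow> complex) \<Rightarrow> real \<times> real \<Rightarrow> real"
  where "slobodeckij_quotient s f =
    (\<lambda>(a, b). (norm (f a - f b))\<^sup>2 / \<bar>a - b\<bar> powr (1 + 2 * s))"

definition frac_sobolev :: "real \<Rightarrow> real set \<Rightarrow> (real \<Rightarrow> complex) \<Rightarrow> bool"
  where "frac_sobolev s S f \<longleftrightarrow> square_integrable_on f S \<and>
    (s \<noteq> 0 \<longrightarrow> set_integrable lebesgue (S \<times> S) (slobodeckij_quotient s f))"

definition frac_sobolev_norm_sq :: "real \<Rightarrow> real set \<Rightarrow> (real \<Rightarrow> complex) \<Rightarrow> real"
  where "frac_sobolev_norm_sq s S f =
    (LINT x:S|lebesgue. (norm (f x))\<^sup>2) +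
    (if s = 0 then 0 else LINT p:S \<times> S|lebesgue. slobodeckij_quotient s f p)"

definition continuous_into_H :: "real set \<Rightarrow> real \<Rightarrow> real set \<Rightarrow> (real \<Rightarrow> real \<Rightarrow> complex) \<Rightarrow> bool"
  where "continuous_into_H X s S u \<longleftrightarrow>
    (\<forall>y\<in>X. frac_sobolev s S (u y)) \<and>
    (\<forall>y0\<in>X. ((\<lambda>y. frac_sobolev_norm_sq s S (\<lambda>\<tau>. u y \<tau> - u y0 \<tau>)) \<longlongrightarrow> 0) (at y0 within X))"

section \<open>\<open>L\<^sup>2\<close> solutions\<close>

text \<open>
  A test function on an open subset of the \<open>(x,t)\<close> plane, given with all its partial
  derivatives: \<open>\<Phi> i j\<close> is \<open>\<partial>\<^sub>x\<^sup>i \<partial>\<^sub>t\<^sup>j\<close> of \<open>\<Phi> 0 0\<close>.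
\<close>

definition test_function2 :: "(real \<times> real) set \<Rightarrow> (nat \<Rightarrow> nat \<Rightarrow> real \<Rightarrow> real \<Rightarrow> real) \<Rightarrow> bool"
  where "test_function2 S \<Phi> \<longleftrightarrow>
    (\<forall>i j. continuous_on UNIV (\<lambda>(x, t). \<Phi> i j x t)) \<and>
    (\<forall>i j x t. ((\<lambda>y. \<Phi> i j y t) has_real_derivative \<Phi> (Suc i) j x t) (at x)) \<and>
    (\<forall>i j x t. ((\<lambda>\<tau>. \<Phi> i j x \<tau>) has_real_derivative \<Phi> i (Suc j) x t) (at t)) \<and>
    (\<exists>C. compact C \<and> C \<subseteq> S \<and> (\<forall>x t. (x, t) \<notin> C \<longrightarrow> \<Phi> 0 0 x t = 0))"

abbreviation spacetime :: "real \<Rightarrow> (real \<times> real) set"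
  where "spacetime T \<equiv> {0<..} \<times> {0<..<T}"

text \<open>Weak form of \<open>q\<^sub>t - q\<^sub>x\<^sub>x\<^sub>x = 0\<close>: both derivatives are odd, so both change sign.\<close>

definition weak_solution :: "real \<Rightarrow> (real \<Rightarrow> real \<Rightarrow> complex) \<Rightarrow> bool"
  where "weak_solution T q \<longleftrightarrow>
    locally_integrable_on (\<lambda>(x, t). q x t) (spacetime T) \<and>
    (\<forall>\<Phi>. test_function2 (spacetime T) \<Phi> \<longrightarrow>
      (LINT z:spacetime T|lebesgue.
        (case z of (x, t) \<Rightarrow> q x t * of_real (\<Phi> 3 0 x t - \<Phi> 0 1 x t))) = 0)"

definition has_weak_dx ::
  "real \<Rightarrow> (real \<Rightarrow> real \<Rightarrow> complex) \<Rightarrow> (real \<Rightarrow> real \<Rightarrow> complex) \<Rightarrow> bool"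
  where "has_weak_dx T q p \<longleftrightarrow>
    locally_integrable_on (\<lambda>(x, t). q x t) (spacetime T) \<and>
    locally_integrable_on (\<lambda>(x, t). p x t) (spacetime T) \<and>
    (\<forall>\<Phi>. test_function2 (spacetime T) \<Phi> \<longrightarrow>
      (LINT z:spacetime T|lebesgue. (case z of (x, t) \<Rightarrow> q x t * of_real (\<Phi> 1 0 x t))) =
      - (LINT z:spacetime T|lebesgue. (case z of (x, t) \<Rightarrow> p x t * of_real (\<Phi> 0 0 x t))))"

text \<open>The spaces \<open>H\<^bsup>1/3 - j/3\<^esup>(0,T)\<close> for \<open>j = 0, 1\<close> are \<open>H\<^bsup>1/3\<^esup>\<close> and \<open>H\<^sup>0\<close>.\<close>

definition L2_solution ::
  "real \<Rightarrow> (real \<Rightarrow> complex) \<Rightarrow> (real \<Rightarrow> complex) \<Rightarrow> (real \<Rightarrow> complex) \<Rightarrow>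
    (real \<Rightarrow> real \<Rightarrow> complex) \<Rightarrow> bool"
  where "L2_solution T qo g0 g1 q \<longleftrightarrow>
    weak_solution T q \<and>
    continuous_into_H {0..T} 0 {0<..} (\<lambda>t x. q x t) \<and>
    (AE x in lebesgue. x \<in> {0<..} \<longrightarrow> q x 0 = qo x) \<and>
    continuous_into_H {0..} (1/3) {0<..<T} q \<and>
    (AE t in lebesgue. t \<in> {0<..<T} \<longrightarrow> q 0 t = g0 t) \<and>
    (\<exists>qx. has_weak_dx T q qx \<and>
      continuous_into_H {0..} 0 {0<..<T} qx \<and>
      (AE t in lebesgue. t \<in> {0<..<T} \<longrightarrow> qx 0 t = g1 t))"

section \<open>The integral representation\<close>

definition omega :: "complex \<Rightarrow> complex"
  where "omega k = k ^ 3"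

definition alpha :: complex
  where "alpha = exp (2 * of_real pi * \<i> / 3)"

text \<open>
  The parts in the disc of radius \<open>r > R\<close> of the real line and of the boundaries of
  \<open>D\<^sub>1\<^sup>+ = {k. 0 \<le> arg k \<le> \<pi>/3, |k| \<ge> R}\<close> and \<open>D\<^sub>2\<^sup>+ = {k. 2\<pi>/3 \<le> arg k \<le> \<pi>, |k| \<ge> R}\<close>, the
  latter oriented with the region on the left.
\<close>

definition real_line :: "real \<Rightarrow> real \<Rightarrow> complex"
  where "real_line r = linepath (- of_real r) (of_real r)"

definition bdry_D1 :: "real \<Rightarrow> real \<Rightarrow> real \<Rightarrow> complex"
  where "bdry_D1 R r =
    linepath (of_real r * cis (pi/3)) (of_real R * cis (pi/3)) +++
    part_circlepath 0 R (pi/3) 0 +++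
    linepath (of_real R) (of_real r)"

definition bdry_D2 :: "real \<Rightarrow> real \<Rightarrow> real \<Rightarrow> complex"
  where "bdry_D2 R r =
    linepath (- of_real r) (- of_real R) +++
    part_circlepath 0 R pi (2*pi/3) +++
    linepath (of_real R * cis (2*pi/3)) (of_real r * cis (2*pi/3))"

definition improper_contour_integral :: "(real \<Rightarrow> real \<Rightarrow> complex) \<Rightarrow> (complex \<Rightarrow> complex) \<Rightarrow> complex"
  where "improper_contour_integral \<gamma> f = Lim at_top (\<lambda>r. contour_integral (\<gamma> r) f)"

definition half_line_fourier :: "(real \<Rightarrow> complex) \<Rightarrow> complex \<Rightarrow> complex"
  where "half_line_fourier f k = (LINT x:{0<..}|lebesgue. exp (- \<i> * k * of_real x) * f x)"

definition time_transform :: "(real \<Rightarrow> complex) \<Rightarrow> complex \<Rightarrow> real \<Rightarrow> complex"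
  where "time_transform g \<kappa> t = (LINT s:{0<..<t}|lebesgue. exp (- \<i> * \<kappa> * of_real s) * g s)"

definition g_tilde_D2 ::
  "(real \<Rightarrow> complex) \<Rightarrow> (real \<Rightarrow> complex) \<Rightarrow> (real \<Rightarrow> complex) \<Rightarrow> complex \<Rightarrow> real \<Rightarrow> complex"
  where "g_tilde_D2 qo g0 g1 k t =
    half_line_fourier qo (alpha * k)
    + (alpha\<^sup>2 - 1) * k\<^sup>2 * time_transform g0 (- omega k) t
    - \<i> * (alpha - 1) * k * time_transform g1 (- omega k) t"

definition g_tilde_D1 ::
  "(real \<Rightarrow> complex) \<Rightarrow> (real \<Rightarrow> complex) \<Rightarrow> (real \<Rightarrow> complex) \<Rightarrow> complex \<Rightarrow> real \<Rightarrow> complex"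
  where "g_tilde_D1 qo g0 g1 k t =
    half_line_fourier qo (alpha\<^sup>2 * k)
    + (alpha - 1) * k\<^sup>2 * time_transform g0 (- omega k) t
    - \<i> * (alpha\<^sup>2 - 1) * k * time_transform g1 (- omega k) t"

definition osc :: "real \<Rightarrow> real \<Rightarrow> complex \<Rightarrow> complex"
  where "osc x t k = exp (\<i> * k * of_real x - \<i> * omega k * of_real t)"

definition solution_formula ::
  "real \<Rightarrow> (real \<Rightarrow> complex) \<Rightarrow> (real \<Rightarrow> complex) \<Rightarrow> (real \<Rightarrow> complex) \<Rightarrow> real \<Rightarrow> real \<Rightarrow> complex"
  where "solution_formula R qo g0 g1 x t =
    1 / (2 * of_real pi) *
      improper_contour_integral real_line (\<lambda>k. osc x t k * half_line_fourier qo k)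
    - 1 / (2 * of_real pi) *
      improper_contour_integral (bdry_D1 R) (\<lambda>k. osc x t k * g_tilde_D1 qo g0 g1 k t)
    - 1 / (2 * of_real pi) *
      improper_contour_integral (bdry_D2 R) (\<lambda>k. osc x t k * g_tilde_D2 qo g0 g1 k t)"

section \<open>The local solution\<close>

definition bdry_D :: "real \<Rightarrow> nat \<Rightarrow> real \<Rightarrow> real \<Rightarrow> complex"
  where "bdry_D R j = (if j = 1 then bdry_D1 R else bdry_D2 R)"

definition I_omega :: "real \<Rightarrow> nat \<Rightarrow> nat \<Rightarrow> real \<Rightarrow> real \<Rightarrow> complex"
  where "I_omega R m j x t =
    1 / (2 * of_real pi) *
      improper_contour_integral (bdry_D R j) (\<lambda>k. osc x t k * (1 / (\<i> * k) ^ (m + 1)))"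

definition q_loc ::
  "real \<Rightarrow> complex \<Rightarrow> complex \<Rightarrow> complex \<Rightarrow> complex \<Rightarrow> real \<Rightarrow> real \<Rightarrow> complex"
  where "q_loc R qo_0 qo'_0 g0_0 g1_0 x t =
    qo_0 * (1 + (1 - alpha\<^sup>2) * I_omega R 0 2 x t + (1 - alpha) * I_omega R 0 1 x t)
    + qo'_0 * (of_real x + (1 - alpha) * I_omega R 1 2 x t + (1 - alpha\<^sup>2) * I_omega R 1 1 x t)
    - g0_0 * ((1 - alpha\<^sup>2) * I_omega R 0 2 x t + (1 - alpha) * I_omega R 0 1 x t)
    - g1_0 * ((1 - alpha) * I_omega R 1 2 x t + (1 - alpha\<^sup>2) * I_omega R 1 1 x t)"

end

theory Submission
  imports Defs
begin

text \<open>
  Near the corner only the germs of the data matter, and the natural length at time \<open>t\<close> is \<open>t^(1/3)\<close>.  Errors are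
  therefore measured by \<open>\<rho> = x + t^(1/3)\<close>; the claim is that the error is of order \<open>\<rho>^(3/2)\<close>, which is comparable to
  \<open>x^(3/2) + t^(1/2)\<close>.

  By the lemma of du Bois-Reymond the data are, near 0, iterated integrals of \<open>L\<^sup>2\<close> functions
  (\<open>sobolev_H2_right_expansion\<close>, \<open>sobolev_H1_right_expansion\<close>).  Integration by parts turns this into expansions of
  their transforms (\<open>half_line_fourier_expansion\<close>, \<open>osc_time_transform_H2\<close>, \<open>osc_time_transform_H1\<close>).  The explicit
  terms, values at 0 divided by powers of \<open>k\<close>, integrate to the special functions of the local solution.  On the
  boundaries of the sectors this holds by definition; the real line is first moved below the origin and then
  compared with the two sector boundaries, and the residue at 0 yields the summands \<open>1\<close> and \<open>x\<close>
  (\<open>line_integral_osc\<close>).  Boundary terms of the time transforms at \<open>s = t\<close> carry no time factor and integrate to zero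
  by Jordan's lemma (\<open>sector_integral_exp_vanishes\<close>).

  For the remainders the contours are moved to the scale of \<open>\<rho>\<close>: the arcs to radius \<open>1 / \<rho>\<close>, the real line to
  \<open>Im k = - 1 / \<rho>\<close>.  There \<open>exp (i k x - i k\<^sup>3 t)\<close> is bounded, the remainders are bounded by a multiple of \<open>\<rho>^(1/2) / |k|\<^sup>2\<close>, and
  integration gives \<open>\<rho>^(3/2)\<close> (\<open>sector_solution_integral\<close>, \<open>line_solution_integral\<close>).  The part of the initial datum away
  from 0, jumps included, has an exponentially small transform below the real axis.

  No oscillatory integral is estimated.  Conditionally convergent integrals are expressed through primitives, whose
  limits along rays and lines exist by comparison with explicit real functions (\<open>tendsto_of_dominated_derivative\<close>).
\<close>

section \<open>Smooth bumps on an interval\<close>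

text \<open>
  The functions \<open>p / l^m * exp (- c / l)\<close> with \<open>l = (x - u) * (v - x)\<close>, continued by zero, form a class that is
  closed under differentiation, so all of them are smooth.  As \<open>c\<close> decreases to 0, the member \<open>bump c u v\<close>, with
  \<open>p = 1\<close> and \<open>m = 0\<close>, increases to the indicator of \<open>(u, v)\<close>; this replaces mollification.
\<close>

definition smooth_bump :: "real \<Rightarrow> real \<Rightarrow> real \<Rightarrow> real poly \<Rightarrow> nat \<Rightarrow> real \<Rightarrow> real"
  where "smooth_bump c u v p m x =
    (if u < x \<and> x < v then poly p x / ((x - u) * (v - x)) ^ m * exp (- c / ((x - u) * (v - x))) else 0)"

abbreviation bump :: "real \<Rightarrow> real \<Rightarrow> real \<Rightarrow> real \<Rightarrow> real"
  where "bump c u v \<equiv> smooth_bump c u v 1 0"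

lemma exp_neg_inverse_le:
  fixes c l :: real
  assumes "c > 0" "l > 0" "n > 0"
  shows "exp (- c / l) \<le> (real n / c) ^ n * l ^ n"
proof -
  have "(c / l / real n) ^ n \<le> (1 + (c / l) / real n) ^ n"
    using assms by (intro power_mono) auto
  also have "\<dots> \<le> exp (c / l)"
    using assms by (intro exp_ge_one_plus_x_over_n_power_n) (auto intro: order_trans[of _ 0])
  finally have "exp (- (c / l)) \<le> inverse ((c / l / real n) ^ n)"
    using assms by (simp add: exp_minus le_imp_inverse_le)
  also have "\<dots> = (real n / c) ^ n * l ^ n"
    using assms by (simp add: power_mult_distrib power_divide field_simps)
  finally show ?thesis by simp
qed

text \<open>
  The factor \<open>exp (- c / l)\<close> beats every power of \<open>1 / l\<close>.  Vanishing to second order at \<open>u\<close> and \<open>v\<close> is all that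
  is needed to differentiate there.
\<close>

lemma smooth_bump_quadratic_bound:
  assumes "c > 0"
  obtains C where "C \<ge> 0" "\<And>x. u < x \<Longrightarrow> x < v \<Longrightarrow> \<bar>smooth_bump c u v p m x\<bar> \<le> C * ((x - u) * (v - x))\<^sup>2"
proof -
  have "compact (poly p ` {u..v})"
    by (intro compact_continuous_image continuous_intros) auto
  then obtain B where B: "\<And>x. x \<in> {u..v} \<Longrightarrow> \<bar>poly p x\<bar> \<le> B"
    by (meson bounded_real compact_imp_bounded image_eqI)
  define C where "C = \<bar>B\<bar> * (real (m + 2) / c) ^ (m + 2)"
  have "\<bar>smooth_bump c u v p m x\<bar> \<le> C * ((x - u) * (v - x))\<^sup>2" if x: "u < x" "x < v" for x
  proof -
    define l where "l = (x - u) * (v - x)"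
    have l: "l > 0" using x by (simp add: l_def)
    have "\<bar>smooth_bump c u v p m x\<bar> = \<bar>poly p x\<bar> / l ^ m * exp (- c / l)"
      using x l by (simp add: smooth_bump_def l_def[symmetric] abs_mult)
    also have "\<dots> \<le> \<bar>B\<bar> / l ^ m * ((real (m + 2) / c) ^ (m + 2) * l ^ (m + 2))"
      using B[of x] x l assms by (intro mult_mono divide_right_mono exp_neg_inverse_le) auto
    also have "\<dots> = C * l\<^sup>2"
      using l by (simp add: C_def power_add power2_eq_square)
    finally show ?thesis by (simp add: l_def)
  qed
  then show ?thesis using that[of C] assms by (auto simp: C_def)
qed

lemma integral_cong_0: "(\<And>x. x \<in> S \<Longrightarrow> f x = 0) \<Longrightarrow> integral S f = 0"
  using integral_cong[of S f "\<lambda>_. 0"] by simp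

lemma DERIV_zero_of_quadratic_bound:
  fixes f :: "real \<Rightarrow> real"
  assumes "f x = 0" "\<And>y. \<bar>f y\<bar> \<le> C * (y - x)\<^sup>2"
  shows "(f has_real_derivative 0) (at x)"
proof -
  have "((\<lambda>h. (f (x + h) - f x) / h) \<longlongrightarrow> 0) (at 0)"
  proof (rule Lim_null_comparison)
    show "\<forall>\<^sub>F h in at 0. norm ((f (x + h) - f x) / h) \<le> C * \<bar>h\<bar>"
    proof (rule eventually_at_filter[THEN iffD2], rule always_eventually, safe)
      fix h :: real assume "h \<noteq> 0"
      then show "norm ((f (x + h) - f x) / h) \<le> C * \<bar>h\<bar>"
        using assms(2)[of "x + h"] assms(1) by (simp add: abs_divide divide_le_eq power2_eq_square mult.assoc)
    qed
    show "((\<lambda>h. C * \<bar>h\<bar>) \<longlongrightarrow> 0) (at 0)"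
      by (rule tendsto_eq_intros | simp)+
  qed
  then show ?thesis by (simp add: DERIV_def)
qed

lemma smooth_bump_quotient_rule:
  fixes l z :: real
  assumes "l \<noteq> 0" "z \<noteq> 0"
  shows "(A * l\<^sup>2 - M * p * d * l + c * (p * d)) / (l * z * l\<^sup>2) * e =
    (A * (l * z) - p * (M * (d * z))) / ((l * z) * (l * z)) * e + (e * (c * d / (l * l))) * (p / (l * z))"
proof -
  have "(A * (l * z) - p * (M * (d * z))) / ((l * z) * (l * z)) = (A * l - p * M * d) / (l * l * z)"
    using assms by (simp add: divide_simps) (simp add: algebra_simps)
  moreover have "(A * l\<^sup>2 - M * p * d * l + c * (p * d)) / (l * z * l\<^sup>2) = (A * l - p * M * d) / (l * l * z) + c * d * p / (l * l * (l * z))"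
    using assms by (simp add: divide_simps power2_eq_square) (simp add: algebra_simps)
  ultimately show ?thesis by (simp add: algebra_simps)
qed

lemma smooth_bump_DERIV:
  assumes "c > 0"
  obtains p' where "\<And>x. (smooth_bump c u v p m has_real_derivative smooth_bump c u v p' (m + 2) x) (at x)"
proof -
  define L where "L = [:-u, 1:] * [:v, -1::real:]"
  define p' where "p' = pderiv p * L\<^sup>2 - of_nat m * p * pderiv L * L + smult c (p * pderiv L)"
  have polyL: "poly L x = (x - u) * (v - x)" for x by (simp add: L_def algebra_simps)
  have "(smooth_bump c u v p m has_real_derivative smooth_bump c u v p' (m + 2) x) (at x)" for x
  proof (cases "u < x \<and> x < v")
    case True
    define l where "l = poly L x"
    have l: "l > 0" using True by (simp add: l_def polyL)
    have 1: "((\<lambda>x. poly p x / poly L x ^ m * exp (- c / poly L x)) has_real_derivative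
        ((poly (pderiv p) x * l ^ m - poly p x * (of_nat m * (poly (pderiv L) x * l ^ (m - 1)))) / (l ^ m * l ^ m) * exp (- c / l)
         + (exp (- c / l) * (c * poly (pderiv L) x / (l * l))) * (poly p x / l ^ m))) (at x)"
    proof -
      have L0: "poly L x \<noteq> 0" "poly L x ^ m \<noteq> 0" using l by (auto simp: l_def)
      have a: "((\<lambda>x. poly L x ^ m) has_real_derivative of_nat m * (poly (pderiv L) x * l ^ (m - 1))) (at x)"
        using DERIV_power[OF poly_DERIV[of L x], of m] by (simp add: l_def)
      have b: "((\<lambda>x. exp (- c / poly L x)) has_real_derivative exp (- c / l) * (c * poly (pderiv L) x / (l * l))) (at x)"
        using DERIV_chain2[OF DERIV_exp DERIV_divide[OF DERIV_const[of "- c"] poly_DERIV[of L x] L0(1)]]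
        by (simp add: l_def)
      show ?thesis
        using DERIV_mult'[OF DERIV_divide[OF poly_DERIV[of p x] a L0(2)] b]
        by (simp add: l_def add.commute mult.commute)
    qed
    have 2: "poly p' x / l ^ (m + 2) * exp (- c / l) = ((poly (pderiv p) x * l ^ m - poly p x * (of_nat m * (poly (pderiv L) x * l ^ (m - 1)))) / (l ^ m * l ^ m) * exp (- c / l)
         + (exp (- c / l) * (c * poly (pderiv L) x / (l * l))) * (poly p x / l ^ m))"
    proof (cases m)
      case 0
      then show ?thesis using l
        by (simp add: p'_def l_def[symmetric] add_divide_distrib power2_eq_square distrib_left distrib_right)
    next
      case (Suc n)
      then show ?thesis
        using smooth_bump_quotient_rule[of l "l ^ n" "poly (pderiv p) x" "of_nat m" "poly p x" "poly (pderiv L) x" c "exp (- c / l)"] l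
        by (simp add: p'_def l_def[symmetric] power_add power2_eq_square mult_ac)
    qed
    have "((\<lambda>x. poly p x / poly L x ^ m * exp (- c / poly L x)) has_real_derivative
        smooth_bump c u v p' (m + 2) x) (at x)"
      using 1 True l unfolding 2[symmetric] by (simp add: smooth_bump_def l_def polyL)
    then show ?thesis
      by (rule has_field_derivative_transform_within_open[of _ _ _ "{u<..<v}"])
        (use True in \<open>auto simp: smooth_bump_def polyL\<close>)
  next
    case False
    obtain C where C: "C \<ge> 0" "\<And>x. u < x \<Longrightarrow> x < v \<Longrightarrow> \<bar>smooth_bump c u v p m x\<bar> \<le> C * ((x - u) * (v - x))\<^sup>2"
      using smooth_bump_quadratic_bound[OF assms] by blast
    have "(smooth_bump c u v p m has_real_derivative 0) (at x)"
    proof (rule DERIV_zero_of_quadratic_bound[where C="C * (v - u)\<^sup>2"])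
      show "smooth_bump c u v p m x = 0" using False by (auto simp: smooth_bump_def)
    next
      fix y
      show "\<bar>smooth_bump c u v p m y\<bar> \<le> C * (v - u)\<^sup>2 * (y - x)\<^sup>2"
      proof (cases "u < y \<and> y < v")
        case True
        have *: "(y - u) * (v - y) \<le> (v - u) * \<bar>y - x\<bar>"
        proof (cases "x \<le> u")
          case True
          then show ?thesis using \<open>u < y \<and> y < v\<close>
            by (subst mult.commute, intro mult_mono) auto
        next
          case F: False
          then have "v \<le> x" using False by auto
          then show ?thesis using \<open>u < y \<and> y < v\<close> by (intro mult_mono) auto
        qed
        have "((y - u) * (v - y))\<^sup>2 \<le> ((v - u) * \<bar>y - x\<bar>)\<^sup>2"
          using True by (intro power_mono *) auto
        then have "C * ((y - u) * (v - y))\<^sup>2 \<le> C * ((v - u)\<^sup>2 * (y - x)\<^sup>2)"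
          using C(1) by (intro mult_left_mono) (auto simp: power_mult_distrib)
        then show ?thesis using C(2)[of y] True by (simp add: mult.assoc)
      qed (use C in \<open>auto simp: smooth_bump_def\<close>)
    qed
    moreover have "smooth_bump c u v p' (m + 2) x = 0" using False by (auto simp: smooth_bump_def)
    ultimately show ?thesis by simp
  qed
  then show ?thesis using that by blast
qed

text \<open>
  Smoothness by coinduction: iterated derivatives never leave \<open>A\<close>, and no formula for them is needed.
\<close>

lemma iterated_deriv_differentiable:
  fixes A :: "(real \<Rightarrow> real) set"
  assumes "\<And>f. f \<in> A \<Longrightarrow> \<exists>g\<in>A. \<forall>x. (f has_real_derivative g x) (at x)" and "f \<in> A"
  shows "((deriv ^^ n) f) differentiable_on UNIV"
proof -
  have "(deriv ^^ n) f \<in> A"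
    using assms(2)
  proof (induction n arbitrary: f)
    case (Suc n)
    obtain g where "g \<in> A" "\<forall>x. (f has_real_derivative g x) (at x)"
      using assms(1)[OF Suc.prems] by blast
    then have "deriv f \<in> A" by (metis DERIV_imp_deriv ext)
    from Suc.IH[OF this] show ?case by (simp add: funpow_swap1)
  qed simp
  from assms(1)[OF this] show ?thesis
    by (auto simp: differentiable_on_def real_differentiable_def intro: differentiable_at_withinI)
qed

lemma smooth_bump_continuous: "c > 0 \<Longrightarrow> continuous_on UNIV (smooth_bump c u v p m)"
  using smooth_bump_DERIV[of c u v p m] by (metis DERIV_isCont continuous_at_imp_continuous_on)

lemma bump_props:
  assumes "c > 0"
  shows "0 \<le> bump c u v x" "bump c u v x \<le> 1" "x \<notin> {u<..<v} \<Longrightarrow> bump c u v x = 0"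
    "x \<in> {u<..<v} \<Longrightarrow> bump c u v x > 0"
  using assms by (auto simp: smooth_bump_def divide_nonpos_nonneg)

lemma bump_tendsto: "(\<lambda>n. bump (1 / real (Suc n)) u v x) \<longlonglongrightarrow> indicat_real {u<..<v} x"
proof (cases "u < x \<and> x < v")
  case True
  have "(\<lambda>n. exp (- (1 / real (Suc n)) / ((x - u) * (v - x)))) \<longlonglongrightarrow> exp (- 0 / ((x - u) * (v - x)))"
    by (intro tendsto_intros LIMSEQ_Suc[OF lim_1_over_n]) (use True in auto)
  then show ?thesis using True by (simp add: smooth_bump_def)
qed (auto simp: smooth_bump_def)

lemma test_function_bump:
  assumes "c > 0" "{u..v} \<subseteq> S"
  shows "test_function S (bump c u v)"
  unfolding test_function_def
proof (intro conjI allI exI[of _ "{u..v}"])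
  fix n
  define A where "A = {smooth_bump c u v p m | p m. True}"
  show "(deriv ^^ n) (bump c u v) differentiable_on UNIV"
  proof (rule iterated_deriv_differentiable[where A=A])
    show "\<exists>g\<in>A. \<forall>x. (f has_real_derivative g x) (at x)" if fA: "f \<in> A" for f
    proof -
      obtain p m where f: "f = smooth_bump c u v p m" using fA unfolding A_def by blast
      obtain q where "\<And>x. (smooth_bump c u v p m has_real_derivative smooth_bump c u v q (m + 2) x) (at x)"
        using smooth_bump_DERIV[OF assms(1)] by blast
      moreover have "smooth_bump c u v q (m + 2) \<in> A" by (auto simp: A_def)
      ultimately show ?thesis unfolding f by blast
    qed
  qed (auto simp: A_def)
next
  fix x show "x \<notin> {u..v} \<longrightarrow> bump c u v x = 0" using bump_props(3)[OF assms(1)] by auto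
qed (use assms in auto)

text \<open>
  A bump is the derivative of a test function up to a multiple of one fixed bump: subtracting the multiple
  that makes the total mass vanish gives a primitive with compact support.  This is how a vanishing weak
  derivative is tested against an arbitrary bump.
\<close>

lemma test_function_bump_primitive:
  assumes c: "c > 0" "c' > 0" and uv: "u < v" "u' < v'" and S: "{min u u'..max v v'} \<subseteq> S"
  obtains \<phi> where "test_function S \<phi>" "\<And>x. x \<notin> {min u u'..max v v'} \<Longrightarrow> \<phi> x = 0" "\<And>x. (\<phi> has_real_derivative (bump c u v x
      - integral UNIV (bump c u v) / integral UNIV (bump c' u' v') * bump c' u' v' x)) (at x)"
proof -
  define a b where "a = min u u'" and "b = max v v'"
  define \<kappa> where "\<kappa> = integral UNIV (bump c u v) / integral UNIV (bump c' u' v')"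
  define h where "h = (\<lambda>x. bump c u v x - \<kappa> * bump c' u' v' x)"
  have ab: "a < b" "a \<le> u" "a \<le> u'" "v \<le> b" "v' \<le> b" using uv by (auto simp: a_def b_def)
  have int: "integral UNIV (bump c u v) = integral {a..b} (bump c u v)" if "c > 0" "a \<le> u" "v \<le> b" for c u v
  proof -
    have "integral {a..b} (bump c u v) = integral UNIV (\<lambda>x. if x \<in> {a..b} then bump c u v x else 0)"
      by (rule integral_restrict_UNIV[symmetric])
    also have "(\<lambda>x. if x \<in> {a..b} then bump c u v x else 0) = bump c u v"
      using that by (auto simp: fun_eq_iff smooth_bump_def)
    finally show ?thesis by simp
  qed
  have pos: "integral {a..b} (bump c' u' v') > 0"
  proof -
    have "integral {a..b} (bump c' u' v') \<ge> 0"
      by (intro integral_nonneg integrable_continuous_real continuous_on_subset[OF smooth_bump_continuous])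
         (use c bump_props(1) in auto)
    moreover have "integral {a..b} (bump c' u' v') \<noteq> 0"
    proof
      assume "integral {a..b} (bump c' u' v') = 0"
      then have "bump c' u' v' ((u' + v') / 2) = 0"
        by (subst (asm) integral_eq_0_iff)
          (use c ab uv bump_props(1)[of c'] continuous_on_subset[OF smooth_bump_continuous[OF c(2)]] in \<open>auto simp: divide_simps\<close>)
      moreover have "bump c' u' v' ((u' + v') / 2) > 0"
        by (rule bump_props(4)[OF c(2)]) (use uv in \<open>auto simp: field_simps\<close>)
      ultimately show False by simp
    qed
    ultimately show ?thesis by simp
  qed
  have conth: "continuous_on UNIV h" unfolding h_def
    by (intro continuous_intros smooth_bump_continuous c)
  have inth: "h integrable_on {p..q}" for p q
    by (intro integrable_continuous_real continuous_on_subset[OF conth]) auto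
  have h0: "integral {a..b} h = 0"
  proof -
    have "integral {a..b} h = integral {a..b} (bump c u v) - \<kappa> * integral {a..b} (bump c' u' v')"
      unfolding h_def by (subst integral_diff)
        (auto intro!: integrable_continuous_real continuous_intros continuous_on_subset[OF smooth_bump_continuous] c)
    also have "\<dots> = 0" using pos by (simp add: \<kappa>_def int c ab)
    finally show ?thesis .
  qed
  have hout: "h x = 0" if "x \<notin> {a<..<b}" for x
    using that ab by (auto simp: h_def smooth_bump_def)
  define \<phi> where "\<phi> x = (if x < a then 0 else integral {a..x} h)" for x
  have \<phi>0: "\<phi> x = 0" if "x \<notin> {a..b}" for x
  proof (cases "x < a")
    case False
    then have "b < x" using that by auto
    then have "integral {a..x} h = integral {a..b} h + integral {b..x} h"
      using ab inth by (intro Henstock_Kurzweil_Integration.integral_combine[symmetric]) auto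
    moreover have "integral {b..x} h = 0"
      by (rule integral_cong_0) (use hout in auto)
    ultimately show ?thesis using h0 by (simp add: \<phi>_def)
  qed (auto simp: \<phi>_def)
  have alt: "\<phi> x = integral {a - w..x} h" if "x \<ge> a - w" "w > 0" for x w
  proof (cases "x < a")
    case True
    have "integral {a - w..x} h = 0"
      by (rule integral_cong_0) (use hout True in auto)
    then show ?thesis using True by (simp add: \<phi>_def)
  next
    case False
    then have "integral {a - w..x} h = integral {a - w..a} h + integral {a..x} h"
      using that inth by (intro Henstock_Kurzweil_Integration.integral_combine[symmetric]) auto
    moreover have "integral {a - w..a} h = 0"
      by (rule integral_cong_0) (use hout in auto)
    ultimately show ?thesis using False by (simp add: \<phi>_def)
  qed
  have der: "(\<phi> has_real_derivative h x) (at x)" for x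
  proof -
    define w where "w = \<bar>a - x\<bar> + 1"
    have "((\<lambda>y. integral {a - w..y} h) has_real_derivative h x) (at x within {a - w..x + 1})"
      by (rule integral_has_real_derivative[OF continuous_on_subset[OF conth]]) (auto simp: w_def)
    then have "((\<lambda>y. integral {a - w..y} h) has_real_derivative h x) (at x)"
      by (subst (asm) at_within_interior) (auto simp: w_def)
    then show ?thesis
      by (rule has_field_derivative_transform_within_open[of _ _ _ "{a - w<..}"])
        (use alt[where w=w] in \<open>auto simp: w_def\<close>)
  qed
  have "test_function S \<phi>"
    unfolding test_function_def
  proof (intro conjI allI exI[of _ "{a..b}"])
    fix n
    define D where "D = {\<lambda>x. smooth_bump c u v p m x - \<kappa> * smooth_bump c' u' v' p' m' x | p m p' m'. True}"
    show "(deriv ^^ n) \<phi> differentiable_on UNIV"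
    proof (rule iterated_deriv_differentiable[where A="insert \<phi> D"])
      have hD: "h \<in> D" unfolding h_def D_def by blast
      show "\<exists>g\<in>insert \<phi> D. \<forall>x. (f has_real_derivative g x) (at x)" if f: "f \<in> insert \<phi> D" for f
      proof (cases "f = \<phi>")
        case True then show ?thesis using der hD by blast
      next
        case False
        then obtain p m p' m' where f: "f = (\<lambda>x. smooth_bump c u v p m x - \<kappa> * smooth_bump c' u' v' p' m' x)"
          using f unfolding D_def by blast
        obtain q where q: "\<And>x. (smooth_bump c u v p m has_real_derivative smooth_bump c u v q (m + 2) x) (at x)"
          using smooth_bump_DERIV[OF c(1)] by blast
        obtain q' where q': "\<And>x. (smooth_bump c' u' v' p' m' has_real_derivative smooth_bump c' u' v' q' (m' + 2) x) (at x)"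
          using smooth_bump_DERIV[OF c(2)] by blast
        show ?thesis
        proof (rule bexI[of _ "\<lambda>x. smooth_bump c u v q (m+2) x - \<kappa> * smooth_bump c' u' v' q' (m'+2) x"], rule allI)
          fix x
          show "(f has_real_derivative smooth_bump c u v q (m+2) x - \<kappa> * smooth_bump c' u' v' q' (m'+2) x) (at x)"
            unfolding f by (intro DERIV_diff DERIV_cmult q q')
        qed (unfold D_def, blast)
      qed
    qed simp
  next
    fix x show "x \<notin> {a..b} \<longrightarrow> \<phi> x = 0" using \<phi>0 by auto
  qed (use S in \<open>auto simp: a_def b_def\<close>)
  then show ?thesis using that[of \<phi>] der \<phi>0 unfolding h_def \<kappa>_def a_def b_def by blast
qed

section \<open>Weak derivatives and absolute continuity\<close>

lemma integrable_lebesgue_borel_version: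
  fixes f :: "real \<Rightarrow> complex"
  assumes "integrable lebesgue f"
  obtains g where "g \<in> borel_measurable borel" "integrable lborel g" "AE x in lebesgue. f x = g x"
proof -
  have "(\<lambda>x. Re (f x)) \<in> borel_measurable (completion lborel)" "(\<lambda>x. Im (f x)) \<in> borel_measurable (completion lborel)"
    using assms by measurable
  then obtain a b where ab: "a \<in> borel_measurable lborel" "AE x in lborel. Re (f x) = a x"
     "b \<in> borel_measurable lborel" "AE x in lborel. Im (f x) = b x"
    using completion_ex_borel_measurable_real by metis
  define g where "g x = Complex (a x) (b x)" for x
  have "g = (\<lambda>x. of_real (a x) + \<i> * of_real (b x))"
    by (auto simp: g_def complex_eq_iff fun_eq_iff)
  then have g: "g \<in> borel_measurable lborel" using ab(1,3) by simp
  have ae: "AE x in lebesgue. f x = g x"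
    using ab(2,4) by (intro AE_completion) (auto simp: g_def complex_eq_iff)
  have "integrable lebesgue g"
    using assms ae g by (subst integrable_cong_AE[of _ _ f]) (auto intro: measurable_completion)
  then have "integrable lborel g" using g by (simp add: integrable_completion)
  then show ?thesis using that g ae by auto
qed

lemma borel_measurable_lebesgue_indicator_scaleR:
  fixes f :: "real \<Rightarrow> complex"
  assumes "A \<in> sets borel" "f \<in> borel_measurable lebesgue"
  shows "(\<lambda>x. indicat_real A x *\<^sub>R f x) \<in> borel_measurable lebesgue"
  using assms by (intro borel_measurable_scaleR borel_measurable_indicator) auto

text \<open>
  Half-open intervals are stable under intersection and generate the Borel sets, so the integral vanishes
  over every Borel set.
\<close>

lemma AE_zero_if_interval_integrals_zero:
  fixes h :: "real \<Rightarrow> complex"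
  assumes h: "integrable lebesgue h" and 0: "\<And>u v. (LINT x:{u<..v}|lebesgue. h x) = 0"
  shows "AE x in lebesgue. h x = 0"
proof -
  obtain g where g: "g \<in> borel_measurable borel" "integrable lborel g" "AE x in lebesgue. h x = g x"
    using integrable_lebesgue_borel_version[OF h] by blast
  have g0: "(LINT x:{u<..v}|lborel. g x) = 0" for u v
  proof -
    have "(LINT x:{u<..v}|lborel. g x) = (LINT x:{u<..v}|lebesgue. g x)"
      unfolding set_lebesgue_integral_def using g(1) by (intro integral_completion[symmetric]) auto
    also have "\<dots> = (LINT x:{u<..v}|lebesgue. h x)"
      unfolding set_lebesgue_integral_def using g h
      by (intro integral_cong_AE borel_measurable_lebesgue_indicator_scaleR) (auto intro: measurable_completion)
    finally show ?thesis using 0 by simp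
  qed
  have SS: "sets borel = sigma_sets UNIV (range (\<lambda>(a, b). {a<..b::real}))"
    by (subst borel_sigma_sets_Ioc) (simp add: sets_measure_of)
  have "set_lebesgue_integral lborel A g = 0" if "A \<in> sets lborel" for A
  proof -
    have A: "A \<in> sigma_sets UNIV (range (\<lambda>(a, b). {a<..b::real}))"
      using that SS by simp
    have "Int_stable (range (\<lambda>(a, b). {a<..b::real}))"
    proof (rule Int_stableI)
      fix A B :: "real set"
      assume "A \<in> range (\<lambda>(a, b). {a<..b})" "B \<in> range (\<lambda>(a, b). {a<..b})"
      then obtain a b c d where "A = {a<..b}" "B = {c<..d}" by auto
      then have "A \<inter> B = (\<lambda>(a, b). {a<..b}) (max a c, min b d)" by auto
      then show "A \<inter> B \<in> range (\<lambda>(a, b). {a<..b})" by blast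
    qed
    moreover have "range (\<lambda>(a, b). {a<..b::real}) \<subseteq> Pow UNIV" by simp
    ultimately show ?thesis using A
    proof (induction rule: sigma_sets_induct_disjoint)
      case (basic A) then show ?case using g0 by auto
    next
      case (compl A)
      have A: "A \<in> sets borel" using compl(1) SS by simp
      have "(\<lambda>n. LINT x:{- real n<..real n}|lborel. g x) \<longlonglongrightarrow> (LINT x|lborel. g x)"
        unfolding set_lebesgue_integral_def
      proof (rule integral_dominated_convergence[where w="\<lambda>x. norm (g x)"])
        show "AE x in lborel. (\<lambda>n. indicat_real {- real n<..real n} x *\<^sub>R g x) \<longlonglongrightarrow> g x"
        proof (rule AE_I2)
          fix x :: real
          obtain N where "\<bar>x\<bar> < real N" using reals_Archimedean2 by blast
          then have "\<forall>n\<ge>N. x \<in> {- real n<..real n}" by (auto simp: abs_less_iff)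
          then show "(\<lambda>n. indicat_real {- real n<..real n} x *\<^sub>R g x) \<longlonglongrightarrow> g x"
            by (intro tendsto_eventually) (auto simp: eventually_sequentially indicator_def intro!: exI[of _ N])
        qed
      qed (use g in \<open>auto intro!: AE_I2 split: split_indicator\<close>)
      then have U: "(LINT x|lborel. g x) = 0" using g0 by (simp add: LIMSEQ_const_iff)
      have "(LINT x:A \<union> (UNIV - A)|lborel. g x) = (LINT x:A|lborel. g x) + (LINT x:UNIV - A|lborel. g x)"
        using A g by (intro set_integral_Un) (auto simp: set_integrable_def intro!: integrable_mult_indicator)
      then show ?case using U compl(2) by (simp add: set_lebesgue_integral_def)
    next
      case (union A)
      have A: "A i \<in> sets lborel" for i
        using union(2) SS by auto
      have "(LINT x:(\<Union>i. A i)|lborel. g x) = (\<Sum>i. LINT x:A i|lborel. g x)"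
        by (rule lebesgue_integral_countable_add)
          (use union(1) A g in \<open>auto simp: disjoint_family_on_def set_integrable_def intro!: integrable_mult_indicator sets.countable_UN\<close>)
      then show ?case using union(3) by simp
    qed (auto simp: set_lebesgue_integral_def)
  qed
  then have "AE x in lborel. g x = 0" by (intro sigma_finite_measure.density_zero[OF sigma_finite_lborel] g)
  then have "AE x in lebesgue. g x = 0" by (rule AE_completion)
  with g(3) show ?thesis by eventually_elim simp
qed

lemma set_integrable_lebesgue_bounded_mult:
  fixes g :: "real \<Rightarrow> complex"
  assumes "set_integrable lebesgue S g" "continuous_on UNIV f" "\<And>x. x \<in> S \<Longrightarrow> norm (f x) \<le> B"
  shows "set_integrable lebesgue S (\<lambda>x. f x * g x)" 
proof (rule set_integrable_bound[of _ _ "\<lambda>x. of_real B * g x"])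
  show "set_integrable lebesgue S (\<lambda>x. of_real B * g x)" using assms(1) by simp
  have "f \<in> borel_measurable lebesgue" 
    using borel_measurable_continuous_onI[OF assms(2)] by (auto intro: measurable_completion)
  then have "(\<lambda>x. f x * (indicat_real S x *\<^sub>R g x)) \<in> borel_measurable lebesgue"
    using assms(1) by (intro borel_measurable_times) (auto simp: set_integrable_def)
  then show "set_borel_measurable lebesgue S (\<lambda>x. f x * g x)" 
    by (simp add: set_borel_measurable_def)
  show "AE x in lebesgue. x \<in> S \<longrightarrow> norm (f x * g x) \<le> norm (of_real B * g x)"
    using assms(3) by (intro AE_I2) (auto simp: norm_mult intro!: mult_right_mono order_trans[OF _ abs_ge_self])
qed

text \<open>
  The fundamental lemma of the calculus of variations: as \<open>c \<rightarrow> 0\<close>, dominated convergence turns the tests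
  against bumps into integrals over intervals.
\<close>

lemma AE_zero_if_bump_integrals_zero:
  fixes h :: "real \<Rightarrow> complex"
  assumes h: "\<And>u v. a < u \<Longrightarrow> u < v \<Longrightarrow> v < b \<Longrightarrow> set_integrable lebesgue {u..v} h"
    and 0: "\<And>c u v. c > 0 \<Longrightarrow> a < u \<Longrightarrow> u < v \<Longrightarrow> v < b \<Longrightarrow> (LINT x:{u..v}|lebesgue. h x * of_real (bump c u v x)) = 0"
  shows "AE x in lebesgue. x \<in> {a<..<b} \<longrightarrow> h x = 0"
proof -
  have I: "(LINT x:{u<..v}|lebesgue. h x) = 0" if uv: "a < u" "u < v" "v < b" for u v
  proof -
    have hi: "integrable lebesgue (\<lambda>x. indicat_real {u..v} x *\<^sub>R h x)"
      using h[OF uv] by (simp add: set_integrable_def)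
    have mb: "bump c u v \<in> borel_measurable lebesgue" if "c > 0" for c
      using borel_measurable_continuous_onI[OF smooth_bump_continuous[OF that]] by (auto intro: measurable_completion)
    have "(\<lambda>n. LINT x:{u..v}|lebesgue. h x * of_real (bump (1 / real (Suc n)) u v x)) \<longlonglongrightarrow>
       (LINT x|lebesgue. indicat_real {u<..<v} x *\<^sub>R h x)"
      unfolding set_lebesgue_integral_def
    proof (rule integral_dominated_convergence[where w="\<lambda>x. norm (indicat_real {u..v} x *\<^sub>R h x)"])
      have "(\<lambda>x. indicat_real {u<..<v} x *\<^sub>R (indicat_real {u..v} x *\<^sub>R h x)) \<in> borel_measurable lebesgue"
        using hi by (intro borel_measurable_lebesgue_indicator_scaleR[of _ "\<lambda>x. indicat_real {u..v} x *\<^sub>R h x"]) auto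
      also have "(\<lambda>x. indicat_real {u<..<v} x *\<^sub>R (indicat_real {u..v} x *\<^sub>R h x)) = (\<lambda>x. indicat_real {u<..<v} x *\<^sub>R h x)"
        by (auto simp: fun_eq_iff split: split_indicator)
      finally show "(\<lambda>x. indicat_real {u<..<v} x *\<^sub>R h x) \<in> borel_measurable lebesgue" .
      show "(\<lambda>x. indicat_real {u..v} x *\<^sub>R (h x * complex_of_real (bump (1 / real (Suc n)) u v x)))
         \<in> borel_measurable lebesgue" for n
      proof -
        have "(\<lambda>x. (indicat_real {u..v} x *\<^sub>R h x) * complex_of_real (bump (1 / real (Suc n)) u v x)) \<in> borel_measurable lebesgue"
          using hi mb[of "1 / real (Suc n)"] by (intro borel_measurable_times) auto
        then show ?thesis by simp
      qed
      show "AE x in lebesgue. (\<lambda>n. indicat_real {u..v} x *\<^sub>R (h x * complex_of_real (bump (1 / real (Suc n)) u v x)))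
         \<longlonglongrightarrow> indicat_real {u<..<v} x *\<^sub>R h x"
      proof (rule AE_I2)
        fix x
        have "(\<lambda>n. indicat_real {u..v} x *\<^sub>R (h x * complex_of_real (bump (1 / real (Suc n)) u v x)))
         \<longlonglongrightarrow> indicat_real {u..v} x *\<^sub>R (h x * complex_of_real (indicat_real {u<..<v} x))"
          by (intro tendsto_intros bump_tendsto)
        then show "(\<lambda>n. indicat_real {u..v} x *\<^sub>R (h x * complex_of_real (bump (1 / real (Suc n)) u v x)))
         \<longlonglongrightarrow> indicat_real {u<..<v} x *\<^sub>R h x"
          by (auto split: split_indicator_asm)
      qed
      show "AE x in lebesgue. norm (indicat_real {u..v} x *\<^sub>R (h x * complex_of_real (bump (1 / real (Suc n)) u v x)))
          \<le> norm (indicat_real {u..v} x *\<^sub>R h x)" for n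
        using bump_props(1,2)[of "1 / real (Suc n)" u v]
        by (intro AE_I2) (auto simp: norm_mult intro!: mult_left_le mult_mono simp del: of_nat_Suc)
      show "integrable lebesgue (\<lambda>x. norm (indicat_real {u..v} x *\<^sub>R h x))"
        using hi by (rule integrable_norm)
    qed
    then have "(LINT x|lebesgue. indicat_real {u<..<v} x *\<^sub>R h x) = 0"
      using 0[OF _ uv] by (simp add: LIMSEQ_const_iff del: of_nat_Suc)
    also have "(LINT x|lebesgue. indicat_real {u<..<v} x *\<^sub>R h x) = (LINT x:{u<..v}|lebesgue. h x)"
      unfolding set_lebesgue_integral_def
    proof (rule integral_cong_AE)
      have "(\<lambda>x. indicat_real A x *\<^sub>R (indicat_real {u..v} x *\<^sub>R h x)) \<in> borel_measurable lebesgue" if "A \<in> sets borel" for A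
        using hi that by (intro borel_measurable_lebesgue_indicator_scaleR[of _ "\<lambda>x. indicat_real {u..v} x *\<^sub>R h x"]) auto
      moreover have "(\<lambda>x. indicat_real A x *\<^sub>R (indicat_real {u..v} x *\<^sub>R h x)) = (\<lambda>x. indicat_real A x *\<^sub>R h x)" if "A \<subseteq> {u..v}" for A
        using that by (auto simp: fun_eq_iff split: split_indicator)
      ultimately have *: "(\<lambda>x. indicat_real A x *\<^sub>R h x) \<in> borel_measurable lebesgue" if "A \<in> sets borel" "A \<subseteq> {u..v}" for A
        using that by metis
      show "(\<lambda>x. indicat_real {u<..<v} x *\<^sub>R h x) \<in> borel_measurable lebesgue"
        "(\<lambda>x. indicat_real {u<..v} x *\<^sub>R h x) \<in> borel_measurable lebesgue"
        by (rule *; auto)+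
      have "AE x in lebesgue. x \<noteq> v" by (rule AE_completion) (rule AE_lborel_singleton)
      then show "AE x in lebesgue. indicat_real {u<..<v} x *\<^sub>R h x = indicat_real {u<..v} x *\<^sub>R h x"
        by eventually_elim (auto split: split_indicator)
    qed
    finally show ?thesis .
  qed
  have loc: "AE x in lebesgue. x \<in> {p<..q} \<longrightarrow> h x = 0" if pq: "a < p" "p < q" "q < b" for p q
  proof -
    have "AE x in lebesgue. indicat_real {p<..q} x *\<^sub>R h x = 0"
    proof (rule AE_zero_if_interval_integrals_zero)
      have "set_integrable lebesgue {p<..q} h"
        by (rule set_integrable_subset[OF h[OF pq]]) auto
      then show "integrable lebesgue (\<lambda>x. indicat_real {p<..q} x *\<^sub>R h x)" by (simp add: set_integrable_def)
      fix u v :: real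
      have "(LINT x:{u<..v}|lebesgue. indicat_real {p<..q} x *\<^sub>R h x) = (LINT x:{max u p<..min v q}|lebesgue. h x)"
        unfolding set_lebesgue_integral_def by (rule Bochner_Integration.integral_cong) (auto split: split_indicator)
      also have "\<dots> = 0"
      proof (cases "max u p < min v q")
        case True then show ?thesis using pq by (intro I) auto
      qed (auto simp: set_lebesgue_integral_def)
      finally show "(LINT x:{u<..v}|lebesgue. indicat_real {p<..q} x *\<^sub>R h x) = 0" .
    qed
    then show ?thesis by eventually_elim (auto split: split_indicator_asm)
  qed
  show ?thesis
  proof (cases "a < b")
    case True
    define m where "m = (a + b) / 2"
    define p q where "p n = a + (m - a) / real (n + 2)" and "q n = b - (b - m) / real (n + 2)" for n :: nat
    have m: "a < m" "m < b" using True by (auto simp: m_def)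
    have pq: "a < p n" "p n < q n" "q n < b" for n
    proof -
      show "a < p n" "q n < b" using m by (auto simp: p_def q_def)
      have *: "x / real (n + 2) < x" if "x > 0" for x
        using that by (simp add: divide_less_eq)
      have "(m - a) / real (n + 2) < m - a" "(b - m) / real (n + 2) < b - m"
        using m *[of "m - a"] *[of "b - m"] by auto
      then show "p n < q n" by (simp add: p_def q_def)
    qed
    have "AE x in lebesgue. \<forall>n. x \<in> {p n<..q n} \<longrightarrow> h x = 0"
      using loc[OF pq] by (intro AE_all_countable[THEN iffD2] allI)
    then show ?thesis
    proof (eventually_elim, safe)
      fix x assume x: "\<forall>n. x \<in> {p n<..q n} \<longrightarrow> h x = 0" "x \<in> {a<..<b}"
      have z: "(\<lambda>n. y / real (n + 2)) \<longlonglongrightarrow> 0" for y :: real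
        using LIMSEQ_ignore_initial_segment[OF lim_const_over_n[of y], of 2] .
      have pl: "p \<longlonglongrightarrow> a"
        using tendsto_add[OF tendsto_const z, of a "m - a"] unfolding p_def[abs_def] add_0_right .
      have ql: "q \<longlonglongrightarrow> b"
        using tendsto_diff[OF tendsto_const z, of b "b - m"] unfolding q_def[abs_def] diff_0_right .
      have "\<forall>\<^sub>F n in sequentially. p n < x \<and> x < q n"
        using x(2) order_tendstoD(2)[OF pl, of x] order_tendstoD(1)[OF ql, of x]
        by (auto intro: eventually_conj)
      from eventually_happens'[OF sequentially_bot this] obtain n where "p n < x" "x < q n" by blast
      then have "x \<in> {p n<..q n}" by simp
      then show "h x = 0" using x(1) by blast
    qed
  qed auto
qed

lemma lebesgue_integral_lborel_version:
  fixes f g :: "real \<Rightarrow> complex"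
  assumes "f \<in> borel_measurable lebesgue" "g \<in> borel_measurable borel" "AE x in lebesgue. f x = g x"
  shows "(LINT x|lebesgue. f x) = (LINT x|lborel. g x)"
proof -
  have "(LINT x|lebesgue. f x) = (LINT x|lebesgue. g x)"
    using assms by (intro integral_cong_AE) (auto intro: measurable_completion)
  then show ?thesis using assms(2) by (simp add: integral_completion)
qed

text \<open>
  The primitive of \<open>g\<close> is only absolutely continuous, so the fundamental theorem of calculus does not apply
  to the product.  Instead both sides are the integral of \<open>v x * g y\<close> over the triangle \<open>a \<le> y \<le> x \<le> b\<close>, in
  the two orders of integration.
\<close>

lemma integral_by_parts_indefinite:
  fixes g v V :: "real \<Rightarrow> complex"
  assumes ab: "a \<le> b" and g: "set_integrable lebesgue {a..b} g" and v: "continuous_on {a..b} v"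
    and V: "\<And>x. x \<in> {a..b} \<Longrightarrow> (V has_vector_derivative v x) (at x within {a..b})"
  shows "integral {a..b} (\<lambda>x. v x * integral {a..x} g) =
    V b * integral {a..b} g - integral {a..b} (\<lambda>x. V x * g x)"
proof -
  obtain g' where g': "g' \<in> borel_measurable borel" "integrable lborel g'"
      "AE x in lebesgue. indicat_real {a..b} x *\<^sub>R g x = g' x"
    using integrable_lebesgue_borel_version g unfolding set_integrable_def by blast
  define v' where "v' x = indicat_real {a..b} x *\<^sub>R v x" for x
  have v'm: "v' \<in> borel_measurable borel"
    using borel_measurable_continuous_on_indicator[of "{a..b}" v] v by (simp add: v'_def[abs_def])
  have v'i: "integrable lborel v'"
    using borel_integrable_atLeastAtMost'[OF v] by (simp add: v'_def[abs_def] set_integrable_def)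
  note [measurable] = g'(1) v'm
  define h where "h x y = v' x * (indicat_real {..x} y *\<^sub>R g' y)" for x y
  have hm [measurable]: "case_prod h \<in> borel_measurable (lborel \<Otimes>\<^sub>M lborel)"
  proof -
    have "case_prod h = (\<lambda>p. v' (fst p) * (indicat_real {p. snd p \<le> fst p} p *\<^sub>R g' (snd p)))"
      by (auto simp: h_def fun_eq_iff split: split_indicator)
    then show ?thesis by simp
  qed
  have gi: "integrable lborel (\<lambda>y. indicat_real {..x} y *\<^sub>R g' y)" for x
    by (intro integrable_mult_indicator g') auto
  have "integrable (lborel \<Otimes>\<^sub>M lborel) (case_prod h)"
  proof (rule lborel_pair.Fubini_integrable[OF hm])
    show "integrable lborel (\<lambda>x. LINT y|lborel. norm (case_prod h (x, y)))"
    proof (rule Bochner_Integration.integrable_bound)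
      show "integrable lborel (\<lambda>x. norm (v' x) * (LINT y|lborel. norm (g' y)))"
        using v'i by auto
      show "(\<lambda>x. LINT y|lborel. norm (case_prod h (x, y))) \<in> borel_measurable lborel" by measurable
      show "AE x in lborel. norm (LINT y|lborel. norm (case_prod h (x, y))) \<le>
         norm (norm (v' x) * (LINT y|lborel. norm (g' y)))"
      proof (rule AE_I2)
        fix x
        have "(LINT y|lborel. norm (case_prod h (x, y))) = norm (v' x) * (LINT y|lborel. norm (indicat_real {..x} y *\<^sub>R g' y))"
          by (simp add: h_def norm_mult mult.left_commute)
        also have "\<dots> \<le> norm (v' x) * (LINT y|lborel. norm (g' y))"
          using gi g'(2) by (intro mult_left_mono integral_mono integrable_norm) (auto split: split_indicator)
        finally show "norm (LINT y|lborel. norm (case_prod h (x, y))) \<le> norm (norm (v' x) * (LINT y|lborel. norm (g' y)))"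
          by (simp add: integral_nonneg_AE)
      qed
    qed
    show "AE x in lborel. integrable lborel (\<lambda>y. case_prod h (x, y))"
      unfolding h_def prod.case by (intro AE_I2 integrable_mult_right gi)
  qed
  then have Fub: "(LINT y|lborel. LINT x|lborel. h x y) = (LINT x|lborel. LINT y|lborel. h x y)"
    by (rule lborel_pair.Fubini_integral)
  have contV: "continuous_on {a..b} V" using V by (meson continuous_on_vector_derivative)
  have Vm [measurable]: "(\<lambda>y. if y \<in> {a..b} then V y else 0) \<in> borel_measurable borel"
    using borel_measurable_continuous_on_indicator[OF _ contV] by (simp add: indicator_scaleR_eq_if)
  have Vint: "integrable lborel (\<lambda>y. (if y \<in> {a..b} then V y else 0) * g' y)"
  proof -
    obtain B where B: "\<And>y. y \<in> {a..b} \<Longrightarrow> norm (V y) \<le> B"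
      using compact_continuous_image[OF contV compact_Icc] by (meson bounded_iff compact_imp_bounded imageI)
    show ?thesis
    proof (rule Bochner_Integration.integrable_bound)
      show "integrable lborel (\<lambda>y. of_real \<bar>B\<bar> * g' y)" using g'(2) by auto
      show "AE y in lborel. norm ((if y \<in> {a..b} then V y else 0) * g' y) \<le> norm (of_real \<bar>B\<bar> * g' y)"
        using B by (intro AE_I2) (auto simp: norm_mult intro!: mult_right_mono order_trans[OF _ abs_ge_self])
    qed measurable
  qed
  have gsub: "set_integrable lebesgue {a..x} g" if "x \<in> {a..b}" for x
    by (rule set_integrable_subset[OF g]) (use that in auto)
  have inner1: "integral {a..x} g = (LINT y|lborel. indicat_real {..x} y *\<^sub>R g' y)" if x: "x \<in> {a..b}" for x
  proof -
    have "integral {a..x} g = (LINT y|lebesgue. indicat_real {a..x} y *\<^sub>R g y)"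
      using set_lebesgue_integral_eq_integral(2)[OF gsub[OF x]] by (simp add: set_lebesgue_integral_def)
    also have "\<dots> = (LINT y|lborel. indicat_real {..x} y *\<^sub>R g' y)"
    proof (rule lebesgue_integral_lborel_version)
      show "(\<lambda>y. indicat_real {a..x} y *\<^sub>R g y) \<in> borel_measurable lebesgue"
        using gsub[OF x] by (auto simp: set_integrable_def)
      show "AE y in lebesgue. indicat_real {a..x} y *\<^sub>R g y = indicat_real {..x} y *\<^sub>R g' y"
        using g'(3) by eventually_elim (use x in \<open>auto split: split_indicator split_indicator_asm\<close>)
    qed simp
    finally show ?thesis .
  qed
  have cont: "continuous_on {a..b} (\<lambda>x. v x * integral {a..x} g)"
    by (intro continuous_intros v indefinite_integral_continuous_1 set_lebesgue_integral_eq_integral(1)[OF g])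
  have "integral {a..b} (\<lambda>x. v x * integral {a..x} g) = (LINT x:{a..b}|lborel. v x * integral {a..x} g)"
    by (rule set_borel_integral_eq_integral(2)[symmetric], rule borel_integrable_atLeastAtMost'[OF cont])
  also have "\<dots> = (LINT x|lborel. LINT y|lborel. h x y)"
    unfolding set_lebesgue_integral_def
  proof (rule Bochner_Integration.integral_cong)
    fix x
    have "(LINT y|lborel. h x y) = v' x * (LINT y|lborel. indicat_real {..x} y *\<^sub>R g' y)"
      by (simp only: h_def integral_mult_right_zero)
    then show "indicat_real {a..b} x *\<^sub>R (v x * integral {a..x} g) = (LINT y|lborel. h x y)"
      by (auto simp: v'_def inner1 split: split_indicator)
  qed simp
  also have "\<dots> = (LINT y|lborel. (V b * g' y - (if y \<in> {a..b} then V y else 0) * g' y))"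
    unfolding Fub[symmetric]
  proof (rule integral_cong_AE)
    have "AE y in lebesgue. y \<notin> {a..b} \<longrightarrow> g' y = 0"
      using g'(3) by eventually_elim auto
    then have "AE y in lborel. y \<notin> {a..b} \<longrightarrow> g' y = 0" by (simp add: AE_completion_iff)
    then show "AE y in lborel. (LINT x|lborel. h x y) = V b * g' y - (if y \<in> {a..b} then V y else 0) * g' y"
    proof eventually_elim
      fix y assume y0: "y \<notin> {a..b} \<longrightarrow> g' y = 0"
      show "(LINT x|lborel. h x y) = V b * g' y - (if y \<in> {a..b} then V y else 0) * g' y"
      proof (cases "y \<in> {a..b}")
        case True
        have "(LINT x|lborel. h x y) = (LINT x|lborel. g' y * (indicat_real {y..b} x *\<^sub>R v x))"
          by (rule Bochner_Integration.integral_cong) (use True in \<open>auto simp: h_def v'_def split: split_indicator\<close>)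
        also have "\<dots> = g' y * (LINT x:{y..b}|lborel. v x)"
          by (simp only: set_lebesgue_integral_def integral_mult_right_zero)
        also have "(LINT x:{y..b}|lborel. v x) = integral {y..b} v"
          using True by (intro set_borel_integral_eq_integral(2) borel_integrable_atLeastAtMost' continuous_on_subset[OF v]) auto
        also have "integral {y..b} v = V b - V y"
          using True by (intro integral_unique fundamental_theorem_of_calculus has_vector_derivative_within_subset[OF V]) auto
        finally show ?thesis using True by (simp add: algebra_simps)
      next
        case False
        then show ?thesis using y0 by (simp add: h_def)
      qed
    qed
    show "(\<lambda>y. V b * g' y - (if y \<in> {a..b} then V y else 0) * g' y) \<in> borel_measurable lborel" by measurable
    have "(\<lambda>(y, x). h x y) \<in> borel_measurable (lborel \<Otimes>\<^sub>M lborel)"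
      using measurable_pair_swap[OF hm] by simp
    then show "(\<lambda>y. LINT x|lborel. h x y) \<in> borel_measurable lborel" by measurable
  qed
  also have "\<dots> = (LINT y|lborel. V b * g' y) - (LINT y|lborel. (if y \<in> {a..b} then V y else 0) * g' y)"
  by (rule Bochner_Integration.integral_diff) (use g'(2) Vint in auto)
  also have "(LINT y|lborel. V b * g' y) = V b * integral {a..b} g"
    proof -
    have "AE y in lebesgue. indicat_real {..b} y *\<^sub>R g' y = g' y"
      using g'(3) by eventually_elim (auto split: split_indicator split_indicator_asm)
    then have "(LINT y|lborel. indicat_real {..b} y *\<^sub>R g' y) = (LINT y|lborel. g' y)"
      by (intro integral_cong_AE) (auto simp: AE_completion_iff)
    then show ?thesis using inner1[of b] ab by simp
  qed
  also have "(LINT y|lborel. (if y \<in> {a..b} then V y else 0) * g' y) = integral {a..b} (\<lambda>x. V x * g x)"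
  proof -
    have gm: "(\<lambda>x. indicat_real {a..b} x *\<^sub>R g x) \<in> borel_measurable lebesgue"
      using g by (auto simp: set_integrable_def)
    have "(\<lambda>x. (if x \<in> {a..b} then V x else 0) * (indicat_real {a..b} x *\<^sub>R g x)) \<in> borel_measurable lebesgue"
      using Vm by (intro borel_measurable_times gm measurable_completion) simp
    also have "(\<lambda>x. (if x \<in> {a..b} then V x else 0) * (indicat_real {a..b} x *\<^sub>R g x)) = (\<lambda>x. indicat_real {a..b} x *\<^sub>R (V x * g x))"
      by (auto simp: fun_eq_iff split: split_indicator)
    finally have m: "(\<lambda>x. indicat_real {a..b} x *\<^sub>R (V x * g x)) \<in> borel_measurable lebesgue" .
    have ae: "AE x in lebesgue. indicat_real {a..b} x *\<^sub>R (V x * g x) = (if x \<in> {a..b} then V x else 0) * g' x"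
      using g'(3) by eventually_elim (auto split: split_indicator split_indicator_asm)
    have "integrable lebesgue (\<lambda>y. (if y \<in> {a..b} then V y else 0) * g' y)"
      using Vint by (simp add: integrable_completion)
    then have i: "set_integrable lebesgue {a..b} (\<lambda>x. V x * g x)"
      unfolding set_integrable_def by (rule integrable_cong_AE_imp) (use m ae in \<open>auto elim: AE_mp\<close>)
    have m': "(\<lambda>x. (if x \<in> {a..b} then V x else 0) * g' x) \<in> borel_measurable borel"
      using Vm g'(1) by measurable
    show ?thesis
      using lebesgue_integral_lborel_version[OF m m' ae] set_lebesgue_integral_eq_integral(2)[OF i]
      by (simp only: set_lebesgue_integral_def)
  qed
  finally show ?thesis .
qed

lemma integrable_mult_bump:
  fixes f :: "real \<Rightarrow> complex"
  assumes "c > 0" "set_integrable lebesgue {u..v} f"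
  shows "integrable lebesgue (\<lambda>x. f x * of_real (bump c u v x))"
proof -
  have m: "(\<lambda>x. of_real (bump c u v x) :: complex) \<in> borel_measurable lebesgue"
    using borel_measurable_continuous_onI[OF smooth_bump_continuous[OF assms(1)], of u v 1 0]
    by (auto intro: measurable_completion)
  have "(\<lambda>x. f x * of_real (bump c u v x)) = (\<lambda>x. (indicat_real {u..v} x *\<^sub>R f x) * of_real (bump c u v x))"
    using bump_props(3)[OF assms(1), of _ u v] by (auto simp: fun_eq_iff split: split_indicator)
  moreover have "integrable lebesgue (\<lambda>x. (indicat_real {u..v} x *\<^sub>R f x) * of_real (bump c u v x))"
  proof (rule Bochner_Integration.integrable_bound)
    show "integrable lebesgue (\<lambda>x. indicat_real {u..v} x *\<^sub>R f x)"
      using assms(2) by (simp add: set_integrable_def)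
    show "(\<lambda>x. (indicat_real {u..v} x *\<^sub>R f x) * of_real (bump c u v x)) \<in> borel_measurable lebesgue"
      using assms(2) m by (intro borel_measurable_times) (auto simp: set_integrable_def)
    show "AE x in lebesgue. norm ((indicat_real {u..v} x *\<^sub>R f x) * of_real (bump c u v x))
        \<le> norm (indicat_real {u..v} x *\<^sub>R f x)"
      unfolding norm_mult using bump_props(1,2)[OF assms(1), of u v] by (intro AE_I2 mult_left_le) auto
  qed
  ultimately show ?thesis by simp
qed

lemma set_integral_mult_vanishing:
  fixes f \<psi> :: "real \<Rightarrow> complex"
  assumes "\<And>x. x \<notin> S \<Longrightarrow> \<psi> x = 0"
  shows "(LINT x:S|lebesgue. f x * \<psi> x) = (LINT x|lebesgue. f x * \<psi> x)"
  unfolding set_lebesgue_integral_def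
  by (rule Bochner_Integration.integral_cong) (use assms in \<open>auto split: split_indicator\<close>)

lemma LINT_eq_integral_UNIV_bump:
  assumes "c > 0"
  shows "(LINT x|lebesgue. of_real (bump c u v x)) = (of_real (integral UNIV (bump c u v)) :: complex)"
proof -
  have b: "bump c u v x = indicat_real {u..v} x *\<^sub>R bump c u v x" for x
    using bump_props(3)[OF assms, of x u v] by (auto split: split_indicator)
  have i: "set_integrable lebesgue {u..v} (bump c u v)"
    by (intro absolutely_integrable_continuous_real continuous_on_subset[OF smooth_bump_continuous[OF assms]]) auto
  have "(LINT x|lebesgue. of_real (bump c u v x) :: complex) = of_real (LINT x|lebesgue. bump c u v x)" by simp
  also have "(LINT x|lebesgue. bump c u v x) = (LINT x:{u..v}|lebesgue. bump c u v x)"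
    unfolding set_lebesgue_integral_def by (rule Bochner_Integration.integral_cong[OF refl b])
  also have "\<dots> = integral {u..v} (bump c u v)"
    by (rule set_lebesgue_integral_eq_integral(2)[OF i])
  also have "\<dots> = integral UNIV (\<lambda>x. if x \<in> {u..v} then bump c u v x else 0)"
    by (rule integral_restrict_UNIV[symmetric])
  also have "(\<lambda>x. if x \<in> {u..v} then bump c u v x else 0) = bump c u v"
    using bump_props(3)[OF assms, of _ u v] by (auto simp: fun_eq_iff)
  finally show ?thesis .
qed

lemma set_integrable_open_imp_closed:
  fixes f :: "real \<Rightarrow> 'a::euclidean_space"
  assumes "set_integrable lebesgue {a<..<b} f"
  shows "set_integrable lebesgue {a..b} f"
proof (rule absolutely_integrable_spike_set[OF assms])
  have "negligible {a, b}" by simp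
  then show "negligible {x \<in> {a..b} - {a<..<b}. f x \<noteq> 0}"
    by (rule negligible_subset) auto
  show "negligible {x \<in> {a<..<b} - {a..b}. f x \<noteq> 0}"
    by (rule negligible_subset[of "{}"]) auto
qed

text \<open>
  The lemma of du Bois-Reymond.  With \<open>G\<close> the indefinite integral of \<open>g\<close>, the difference \<open>h = f - G\<close> has weak
  derivative zero, hence \<open>\<integral> h * bump c u v\<close> is proportional to the mass of the bump, and \<open>h\<close> minus the factor
  of proportionality is annihilated by all bumps.
\<close>

lemma weak_deriv_indefinite_integral:
  assumes w: "has_weak_deriv S f g" and S: "{0<..<b} \<subseteq> S" and b: "b > 0"
    and g: "set_integrable lebesgue {0<..<b} g"
  obtains c where "AE x in lebesgue. x \<in> {0<..<b} \<longrightarrow> f x = c + integral {0..x} g"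
proof -
  have g2: "set_integrable lebesgue {0..b} g"
    using g by (rule set_integrable_open_imp_closed)
  define G where "G x = integral {0..x} g" for x
  have contG: "continuous_on {0..b} G" unfolding G_def
    by (intro indefinite_integral_continuous_1 set_lebesgue_integral_eq_integral(1)[OF g2])
  have fint: "set_integrable lebesgue {u..v} f" if "0 < u" "v < b" for u v
  proof -
    have "{u..v} \<subseteq> S" using S that by auto
    then show ?thesis using w by (auto simp: has_weak_deriv_def locally_integrable_on_def)
  qed
  have Gint: "set_integrable lebesgue {u..v} G" if "0 < u" "v < b" for u v
    by (rule absolutely_integrable_continuous_real, rule continuous_on_subset[OF contG]) (use that in auto)
  define h where "h x = f x - G x" for x
  have hint: "set_integrable lebesgue {u..v} h" if "0 < u" "v < b" for u v
    unfolding h_def using fint[OF that] Gint[OF that] by (rule set_integral_diff(1))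
  define u0 v0 where "u0 = b / 3" and "v0 = 2 * b / 3"
  have uv0: "0 < u0" "u0 < v0" "v0 < b" using b by (auto simp: u0_def v0_def)
  define J where "J \<psi> = (LINT x|lebesgue. h x * of_real (\<psi> x))" for \<psi> :: "real \<Rightarrow> real"
  define K where "K = J (bump 1 u0 v0) / of_real (integral UNIV (bump 1 u0 v0))"
  have main: "J (bump c u v) = of_real (integral UNIV (bump c u v)) * K"
    if c: "c > 0" and uv: "0 < u" "u < v" "v < b" for c u v
  proof -
    define p q where "p = min u u0" and "q = max v v0"
    have pq: "0 < p" "q < b" using uv uv0 by (auto simp: p_def q_def)
    have pqS: "{p..q} \<subseteq> S" using pq S by auto
    define \<kappa> where "\<kappa> = integral UNIV (bump c u v) / integral UNIV (bump 1 u0 v0)"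
    define D where "D x = bump c u v x - \<kappa> * bump 1 u0 v0 x" for x
    obtain \<phi> where \<phi>: "test_function S \<phi>" "\<And>x. x \<notin> {p..q} \<Longrightarrow> \<phi> x = 0"
      "\<And>x. (\<phi> has_real_derivative D x) (at x)"
      using test_function_bump_primitive[OF c zero_less_one uv(2) uv0(2), of S] pqS
      unfolding p_def q_def D_def \<kappa>_def by blast
    have D0: "D x = 0" if "x \<notin> {p..q}" for x
    proof -
      have "x \<notin> {u<..<v}" "x \<notin> {u0<..<v0}" using that by (auto simp: p_def q_def)
      then show ?thesis using bump_props(3)[OF c, of x u v] bump_props(3)[of 1 x u0 v0] by (simp add: D_def)
    qed
    have dphi: "deriv \<phi> = D" using \<phi>(3) by (auto intro: DERIV_imp_deriv)
    have contD: "continuous_on UNIV D" unfolding D_def by (intro continuous_intros smooth_bump_continuous c) auto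
    have Di: "integrable lebesgue (\<lambda>x. F x * of_real (D x))" 
      "(LINT x|lebesgue. F x * of_real (D x)) = (LINT x|lebesgue. F x * of_real (bump c u v x)) - \<kappa> * (LINT x|lebesgue. F x * of_real (bump 1 u0 v0 x))"
      if "set_integrable lebesgue {u..v} F" "set_integrable lebesgue {u0..v0} F" for F :: "real \<Rightarrow> complex"
    proof -
      have eq: "(\<lambda>x. F x * of_real (D x)) = (\<lambda>x. F x * of_real (bump c u v x) - \<kappa> * (F x * of_real (bump 1 u0 v0 x)))"
        by (auto simp: D_def fun_eq_iff algebra_simps)
      have i: "integrable lebesgue (\<lambda>x. F x * of_real (bump c u v x))" "integrable lebesgue (\<lambda>x. F x * of_real (bump 1 u0 v0 x))"
        using that c by (auto intro: integrable_mult_bump)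
      show "integrable lebesgue (\<lambda>x. F x * of_real (D x))" unfolding eq
        by (intro Bochner_Integration.integrable_diff integrable_mult_right i)
      show "(LINT x|lebesgue. F x * of_real (D x)) = (LINT x|lebesgue. F x * of_real (bump c u v x)) - \<kappa> * (LINT x|lebesgue. F x * of_real (bump 1 u0 v0 x))"
        unfolding eq using i by (subst Bochner_Integration.integral_diff) auto
    qed
    have "(LINT x|lebesgue. f x * of_real (D x)) = - (LINT x|lebesgue. g x * of_real (\<phi> x))"
    proof -
      have "(LINT x:S|lebesgue. f x * of_real (deriv \<phi> x)) = - (LINT x:S|lebesgue. g x * of_real (\<phi> x))"
        using w \<phi>(1) by (auto simp: has_weak_deriv_def)
      moreover have "complex_of_real (D x) = 0" "complex_of_real (\<phi> x) = 0" if "x \<notin> S" for x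
      proof -
        have "x \<notin> {p..q}" using pqS that by blast
        then show "complex_of_real (D x) = 0" "complex_of_real (\<phi> x) = 0" using D0 \<phi>(2) by auto
      qed
      ultimately show ?thesis unfolding dphi
        by (simp add: set_integral_mult_vanishing)
    qed
    also have "(LINT x|lebesgue. g x * of_real (\<phi> x)) = - (LINT x|lebesgue. G x * of_real (D x))"
    proof -
      have "integral {0..b} (\<lambda>x. of_real (D x) * G x) = of_real (\<phi> b) * integral {0..b} g - integral {0..b} (\<lambda>x. of_real (\<phi> x) * g x)"
        unfolding G_def
      proof (rule integral_by_parts_indefinite)
        show "continuous_on {0..b} (\<lambda>x. complex_of_real (D x))"
          by (intro continuous_intros continuous_on_subset[OF contD]) auto
        show "((\<lambda>x. complex_of_real (\<phi> x)) has_vector_derivative complex_of_real (D x)) (at x within {0..b})" for x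
          by (rule has_vector_derivative_of_real[OF has_field_derivative_at_within[OF \<phi>(3)]])
      qed (use b g2 in auto)
      moreover have "\<phi> b = 0" using pq by (intro \<phi>(2)) auto
      moreover have "integral {0..b} (\<lambda>x. of_real (D x) * G x) = (LINT x|lebesgue. G x * of_real (D x))"
      proof -
        have "set_integrable lebesgue {0..b} (\<lambda>x. G x * of_real (D x))"
          by (intro absolutely_integrable_continuous_real continuous_intros contG continuous_on_subset[OF contD]) auto
        moreover have "(LINT x:{0..b}|lebesgue. G x * of_real (D x)) = (LINT x|lebesgue. G x * of_real (D x))"
        proof (rule set_integral_mult_vanishing)
          fix x assume "x \<notin> {0..b}"
          then have "x \<notin> {p..q}" using pq by auto
          then show "complex_of_real (D x) = 0" using D0 by simp
        qed
        ultimately show ?thesis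
          by (simp only: set_lebesgue_integral_eq_integral(2) mult.commute[of "G _"])
      qed
      moreover have "integral {0..b} (\<lambda>x. of_real (\<phi> x) * g x) = (LINT x|lebesgue. g x * of_real (\<phi> x))"
      proof -
        have contphi: "continuous_on UNIV \<phi>" using \<phi>(3) by (meson DERIV_isCont continuous_at_imp_continuous_on)
        then have cont': "continuous_on UNIV (\<lambda>x. complex_of_real (\<phi> x))" by (intro continuous_intros)
        have "compact ((\<lambda>x. complex_of_real (\<phi> x)) ` {0..b})"
          by (intro compact_continuous_image continuous_on_subset[OF cont']) auto
        then obtain B where B: "\<And>x. x \<in> {0..b} \<Longrightarrow> norm (complex_of_real (\<phi> x)) \<le> B"
          by (meson bounded_iff compact_imp_bounded imageI)
        have "(LINT x:{0..b}|lebesgue. g x * of_real (\<phi> x)) = (LINT x|lebesgue. g x * of_real (\<phi> x))"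
        proof (rule set_integral_mult_vanishing)
          fix x assume "x \<notin> {0..b}"
          then have "x \<notin> {p..q}" using pq by auto
          then show "complex_of_real (\<phi> x) = 0" using \<phi>(2) by simp
        qed
        then show ?thesis
          using set_lebesgue_integral_eq_integral(2)[OF set_integrable_lebesgue_bounded_mult[OF g2 cont' B]]
          by (simp only: mult.commute[of "g _"])
      qed
      ultimately show ?thesis by simp
    qed
    finally have "(LINT x|lebesgue. f x * of_real (D x)) = (LINT x|lebesgue. G x * of_real (D x))" by simp
    moreover have "(LINT x|lebesgue. h x * of_real (D x)) = (LINT x|lebesgue. f x * of_real (D x)) - (LINT x|lebesgue. G x * of_real (D x))"
      unfolding h_def left_diff_distrib using uv uv0 by (intro Bochner_Integration.integral_diff Di fint Gint) auto
    ultimately have "(LINT x|lebesgue. h x * of_real (D x)) = 0" by simp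
    then have "J (bump c u v) = \<kappa> * J (bump 1 u0 v0)"
      using Di(2)[of h] hint uv uv0 by (simp add: J_def)
    then show ?thesis by (simp add: K_def \<kappa>_def)
  qed
  have "AE x in lebesgue. x \<in> {0<..<b} \<longrightarrow> h x - K = 0"
  proof (rule AE_zero_if_bump_integrals_zero)
    fix u v :: real assume uv: "0 < u" "u < v" "v < b"
    show *: "set_integrable lebesgue {u..v} (\<lambda>x. h x - K)"
      using uv by (intro set_integral_diff(1) hint absolutely_integrable_continuous_real) auto
    fix c :: real assume c: "c > 0"
    have "(LINT x:{u..v}|lebesgue. (h x - K) * of_real (bump c u v x)) = (LINT x|lebesgue. (h x - K) * of_real (bump c u v x))"
      by (rule set_integral_mult_vanishing) (use bump_props(3)[OF c, of _ u v] in auto)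
    also have "\<dots> = J (bump c u v) - (LINT x|lebesgue. K * of_real (bump c u v x))"
      unfolding left_diff_distrib J_def
      by (intro Bochner_Integration.integral_diff integrable_mult_bump c hint absolutely_integrable_continuous_real uv) auto
    also have "(LINT x|lebesgue. K * of_real (bump c u v x)) = K * of_real (integral UNIV (bump c u v))"
      using LINT_eq_integral_UNIV_bump[OF c] by simp
    finally show "(LINT x:{u..v}|lebesgue. (h x - K) * of_real (bump c u v x)) = 0"
      using main[OF c uv] by simp
  qed
  then have "AE x in lebesgue. x \<in> {0<..<b} \<longrightarrow> f x = K + integral {0..x} g"
    by eventually_elim (auto simp: h_def G_def algebra_simps)
  then show ?thesis using that by blast
qed

lemma weak_deriv_AE_unique:
  assumes w: "has_weak_deriv S f g" "has_weak_deriv S f g'" and S: "{0<..<b} \<subseteq> S"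
  shows "AE x in lebesgue. x \<in> {0<..<b} \<longrightarrow> g x = g' x"
proof -
  have "AE x in lebesgue. x \<in> {0<..<b} \<longrightarrow> g x - g' x = 0"
  proof (rule AE_zero_if_bump_integrals_zero)
    fix u v :: real assume uv: "0 < u" "u < v" "v < b"
    then have uvS: "{u..v} \<subseteq> S" using S by auto
    then have gi: "set_integrable lebesgue {u..v} g" "set_integrable lebesgue {u..v} g'"
      using w by (auto simp: has_weak_deriv_def locally_integrable_on_def)
    then show "set_integrable lebesgue {u..v} (\<lambda>x. g x - g' x)" by (rule set_integral_diff(1))
    fix c :: real assume c: "c > 0"
    have b0: "complex_of_real (bump c u v x) = 0" if "x \<notin> {u..v}" for x
      using bump_props(3)[OF c, of x u v] that by auto
    have eq: "(LINT x:S|lebesgue. k x * of_real (bump c u v x)) = (LINT x|lebesgue. k x * of_real (bump c u v x))" for k :: "real \<Rightarrow> complex"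
      by (rule set_integral_mult_vanishing, rule b0) (use uvS in blast)
    have "test_function S (bump c u v)" by (rule test_function_bump[OF c uvS])
    then have "(LINT x:S|lebesgue. g x * of_real (bump c u v x)) = (LINT x:S|lebesgue. g' x * of_real (bump c u v x))"
      using w by (auto simp: has_weak_deriv_def)
    then have "(LINT x|lebesgue. g x * of_real (bump c u v x)) = (LINT x|lebesgue. g' x * of_real (bump c u v x))"
      by (simp add: eq)
    then have "(LINT x|lebesgue. (g x - g' x) * of_real (bump c u v x)) = 0"
      unfolding left_diff_distrib
      by (subst Bochner_Integration.integral_diff) (auto intro!: integrable_mult_bump c gi)
    then show "(LINT x:{u..v}|lebesgue. (g x - g' x) * of_real (bump c u v x)) = 0"
      using set_integral_mult_vanishing[of "{u..v}" "\<lambda>x. complex_of_real (bump c u v x)" "\<lambda>x. g x - g' x"] b0 by simp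
  qed
  then show ?thesis by simp
qed

text \<open>
  Two representatives agree almost everywhere, and a right neighbourhood of \<open>a\<close> is not a null set, so their
  limits cannot differ.
\<close>

lemma ess_lim_right_eq:
  assumes ae: "AE x in lebesgue. x \<in> {a<..<b} \<longrightarrow> f x = F x" and b: "a < b"
    and lim: "(F \<longlongrightarrow> L) (at_right a)"
  shows "right_lim f a = L"
  unfolding ess_lim_def
proof (rule the_equality)
  define h where "h x = (if x < b then F x else f x)" for x
  have "AE x in lebesgue. x \<in> {a<..} \<longrightarrow> f x = h x"
    using ae by eventually_elim (auto simp: h_def)
  moreover have "(h \<longlongrightarrow> L) (at_right a)"
    by (rule Lim_transform_eventually[OF lim])
      (use eventually_at_right_less b in \<open>auto simp: eventually_at_right_field h_def intro!: exI[of _ b]\<close>)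
  ultimately show "\<exists>h. (AE x in lebesgue. x \<in> {a<..} \<longrightarrow> f x = h x) \<and> (h \<longlongrightarrow> L) (at_right a)" by blast
next
  fix L' assume "\<exists>h. (AE x in lebesgue. x \<in> {a<..} \<longrightarrow> f x = h x) \<and> (h \<longlongrightarrow> L') (at_right a)"
  then obtain h where h: "AE x in lebesgue. x \<in> {a<..} \<longrightarrow> f x = h x" "(h \<longlongrightarrow> L') (at_right a)" by blast
  have ae2: "AE x in lebesgue. x \<in> {a<..<b} \<longrightarrow> h x = F x"
    using ae h(1) by eventually_elim auto
  show "L' = L"
  proof (rule ccontr)
    assume "L' \<noteq> L"
    have "((\<lambda>x. h x - F x) \<longlongrightarrow> L' - L) (at_right a)" by (intro tendsto_intros h lim)
    then have "\<forall>\<^sub>F x in at_right a. h x - F x \<noteq> 0"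
      using \<open>L' \<noteq> L\<close> by (intro tendsto_imp_eventually_ne) auto
    then obtain e where e: "e > a" "\<And>x. a < x \<Longrightarrow> x < e \<Longrightarrow> h x - F x \<noteq> 0"
      by (auto simp: eventually_at_right_field)
    have "AE x in lebesgue. x \<notin> {a<..<min b e}"
      using ae2 by eventually_elim (use e in auto)
    then have "{a<..<min b e} \<in> null_sets lebesgue"
      by (subst AE_iff_null_sets) auto
    then have "emeasure lebesgue {a<..<min b e} = 0" by auto
    then show False using b e by (auto simp: min_def split: if_splits)
  qed
qed

lemma square_integrable_imp_integrable:
  fixes f :: "real \<Rightarrow> complex"
  assumes f: "square_integrable_on f S" and S: "{a<..<b} \<subseteq> S"
  shows "set_integrable lebesgue {a..b} f" "set_integrable lebesgue {a..b} (\<lambda>x. (norm (f x))\<^sup>2)"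
proof -
  have 2: "set_integrable lebesgue {a<..<b} (\<lambda>x. (norm (f x))\<^sup>2)"
    using f S unfolding square_integrable_on_def by (auto intro: set_integrable_subset)
  have 1: "set_integrable lebesgue {a<..<b} f"
  proof (rule set_integrable_bound)
    show "set_integrable lebesgue {a<..<b} (\<lambda>x. 1 + (norm (f x))\<^sup>2)"
      by (intro set_integral_add(1) 2 set_integrable_subset[OF absolutely_integrable_continuous_real[of a b]]) auto
    show "set_borel_measurable lebesgue {a<..<b} f"
      using f S unfolding square_integrable_on_def by (auto intro: set_borel_measurable_subset)
    show "AE x in lebesgue. x \<in> {a<..<b} \<longrightarrow> norm (f x) \<le> norm (1 + (norm (f x))\<^sup>2)"
    proof (intro AE_I2 impI)
      fix x
      have "0 \<le> (norm (f x) - 1)\<^sup>2" by simp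
      then have "2 * norm (f x) \<le> 1 + (norm (f x))\<^sup>2" by (simp add: power2_eq_square algebra_simps)
      then have "norm (f x) \<le> 1 + (norm (f x))\<^sup>2" using norm_ge_zero[of "f x"] by linarith
      then show "norm (f x) \<le> norm (1 + (norm (f x))\<^sup>2)" by simp
    qed
  qed
  from 1 2 show "set_integrable lebesgue {a..b} f" "set_integrable lebesgue {a..b} (\<lambda>x. (norm (f x))\<^sup>2)"
    by (auto intro: set_integrable_open_imp_closed)
qed

lemma tendsto_indefinite_integral_right:
  fixes g :: "real \<Rightarrow> complex"
  assumes "set_integrable lebesgue {0..b} g" "b > 0"
  shows "((\<lambda>x. c + integral {0..x} g) \<longlongrightarrow> c) (at_right 0)"
proof -
  have "continuous_on {0..b} (\<lambda>x. integral {0..x} g)"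
    by (intro indefinite_integral_continuous_1 set_lebesgue_integral_eq_integral(1)[OF assms(1)])
  from this[unfolded continuous_on_def, THEN bspec, of 0] assms(2)
  have "((\<lambda>x. integral {0..x} g) \<longlongrightarrow> 0) (at 0 within {0..b})" by simp
  then have "((\<lambda>x. integral {0..x} g) \<longlongrightarrow> 0) (at_right 0)"
    using assms(2) by (simp add: at_within_Icc_at_right)
  from tendsto_add[OF tendsto_const this, of c] show ?thesis by simp
qed

text \<open>
  At the left end point an \<open>H\<^sup>1\<close> function is a constant plus the integral of an \<open>L\<^sup>2\<close> function; the constant is the
  one-sided limit.  For \<open>H\<^sup>2\<close>, below, the same holds once more for the derivative.
\<close>

lemma sobolev_H1_right_expansion:
  assumes f: "sobolev_H 1 S f" and S: "{0<..<b} \<subseteq> S" and b: "b > 0"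
  obtains c g where "set_integrable lebesgue {0..b} g" "set_integrable lebesgue {0..b} (\<lambda>x. (norm (g x))\<^sup>2)"
    "AE x in lebesgue. x \<in> {0<..<b} \<longrightarrow> f x = c + integral {0..x} g" "right_lim f 0 = c"
proof -
  obtain D where D: "D 0 = f" "\<forall>i\<le>1. square_integrable_on (D i) S" "\<forall>i<1. has_weak_deriv S (D i) (D (Suc i))"
    using f unfolding sobolev_H_def by blast
  have w: "has_weak_deriv S f (D 1)" using D(1,3) by force
  have g: "set_integrable lebesgue {0..b} (D 1)" "set_integrable lebesgue {0..b} (\<lambda>x. (norm (D 1 x))\<^sup>2)"
    using square_integrable_imp_integrable[OF _ S, of "D 1"] D(2) by auto
  have "set_integrable lebesgue {0<..<b} (D 1)" by (rule set_integrable_subset[OF g(1)]) auto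
  from weak_deriv_indefinite_integral[OF w S b this] obtain c where
    c: "AE x in lebesgue. x \<in> {0<..<b} \<longrightarrow> f x = c + integral {0..x} (D 1)" by blast
  show ?thesis
    by (rule that[OF g c ess_lim_right_eq[OF c b tendsto_indefinite_integral_right[OF g(1) b]]])
qed

lemma sobolev_H2_right_expansion:
  assumes f: "sobolev_H 2 S f" and S: "{0<..<b} \<subseteq> S" and b: "b > 0"
  obtains c d g where "set_integrable lebesgue {0..b} g" "set_integrable lebesgue {0..b} (\<lambda>x. (norm (g x))\<^sup>2)"
    "AE x in lebesgue. x \<in> {0<..<b} \<longrightarrow> f x = c + integral {0..x} (\<lambda>s. d + integral {0..s} g)"
    "right_lim f 0 = c" "right_lim (weak_deriv S f) 0 = d"
proof -
  obtain D where D: "D 0 = f" "\<forall>i\<le>2. square_integrable_on (D i) S" "\<forall>i<2. has_weak_deriv S (D i) (D (Suc i))"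
    using f unfolding sobolev_H_def by blast
  have w: "has_weak_deriv S f (D 1)" using D(1,3) by force
  have H1: "sobolev_H 1 S (D 1)"
    unfolding sobolev_H_def using D(2,3) by (intro exI[of _ "\<lambda>i. D (Suc i)"]) auto
  obtain d g where
    g: "set_integrable lebesgue {0..b} g" "set_integrable lebesgue {0..b} (\<lambda>x. (norm (g x))\<^sup>2)"
    and d: "AE x in lebesgue. x \<in> {0<..<b} \<longrightarrow> D 1 x = d + integral {0..x} g" "right_lim (D 1) 0 = d"
    by (rule sobolev_H1_right_expansion[OF H1 S b])
  define F where "F s = d + integral {0..s} g" for s
  have contF: "continuous_on {0..b} F" unfolding F_def
    by (intro continuous_intros indefinite_integral_continuous_1 set_lebesgue_integral_eq_integral(1)[OF g(1)])
  have D1: "set_integrable lebesgue {0..b} (D 1)"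
    using square_integrable_imp_integrable[OF _ S, of "D 1"] D(2) by auto
  have "set_integrable lebesgue {0<..<b} (D 1)" by (rule set_integrable_subset[OF D1]) auto
  from weak_deriv_indefinite_integral[OF w S b this] obtain c where
    c: "AE x in lebesgue. x \<in> {0<..<b} \<longrightarrow> f x = c + integral {0..x} (D 1)" by blast
  have eq: "integral {0..x} (D 1) = integral {0..x} F" if "x < b" for x
  proof -
    obtain N where N: "N \<in> null_sets lebesgue" "{x \<in> space lebesgue. \<not> (x \<in> {0<..<b} \<longrightarrow> D 1 x = F x)} \<subseteq> N"
      using d(1) unfolding F_def[symmetric] by (auto simp: eventually_ae_filter)
    show ?thesis
    proof (rule integral_spike[of "insert 0 N"])
      show "negligible (insert 0 N)" using N(1) by (simp add: negligible_iff_null_sets)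
      fix y assume "y \<in> {0..x} - insert 0 N"
      then have "y \<in> {0<..<b}" "y \<notin> N" using that by auto
      then show "F y = D 1 y" using N(2) by auto
    qed
  qed
  have c': "AE x in lebesgue. x \<in> {0<..<b} \<longrightarrow> f x = c + integral {0..x} F"
    using c
  proof eventually_elim
    case (elim x)
    then show ?case using eq[of x] by force
  qed
  have "right_lim f 0 = c"
    by (rule ess_lim_right_eq[OF c' b tendsto_indefinite_integral_right[OF absolutely_integrable_continuous_real[OF contF] b]])
  moreover have "right_lim (weak_deriv S f) 0 = d"
  proof (rule ess_lim_right_eq[OF _ b tendsto_indefinite_integral_right[OF g(1) b]])
    have "has_weak_deriv S f (weak_deriv S f)" using someI_ex[of "has_weak_deriv S f"] w unfolding weak_deriv_def by blast
    from weak_deriv_AE_unique[OF this w S] d(1)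
    show "AE x in lebesgue. x \<in> {0<..<b} \<longrightarrow> weak_deriv S f x = d + integral {0..x} g"
      by eventually_elim auto
  qed
  ultimately show ?thesis using that[OF g c'[unfolded F_def]] by blast
qed

section \<open>Improper contour integrals\<close>

text \<open>
  Integrability over the truncated contours is part of the notion: this makes it linear, and limits can be
  evaluated summand by summand.
\<close>

definition has_improper_integral :: "(real \<Rightarrow> real \<Rightarrow> complex) \<Rightarrow> (complex \<Rightarrow> complex) \<Rightarrow> complex \<Rightarrow> bool"
  where "has_improper_integral \<gamma> f L \<longleftrightarrow>
    (\<exists>I. (\<forall>\<^sub>F r in at_top. (f has_contour_integral I r) (\<gamma> r)) \<and> (I \<longlongrightarrow> L) at_top)"

lemma has_improper_integral_imp_eq:
  assumes "has_improper_integral \<gamma> f L"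
  shows "improper_contour_integral \<gamma> f = L"
proof -
  from assms obtain I where I: "\<forall>\<^sub>F r in at_top. (f has_contour_integral I r) (\<gamma> r)" "(I \<longlongrightarrow> L) at_top"
    unfolding has_improper_integral_def by blast
  have "((\<lambda>r. contour_integral (\<gamma> r) f) \<longlongrightarrow> L) at_top"
    by (rule tendsto_cong[THEN iffD1, OF _ I(2)], rule eventually_mono[OF I(1)])
       (simp add: contour_integral_unique)
  then show ?thesis unfolding improper_contour_integral_def
    by (intro tendsto_Lim) auto
qed

lemma has_improper_integral_unique:
  "has_improper_integral \<gamma> f L \<Longrightarrow> has_improper_integral \<gamma> f L' \<Longrightarrow> L = L'"
  using has_improper_integral_imp_eq by metis

lemma has_improper_integral_add:
  assumes "has_improper_integral \<gamma> f L" "has_improper_integral \<gamma> g L'"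
  shows "has_improper_integral \<gamma> (\<lambda>k. f k + g k) (L + L')"
proof -
  from assms obtain I J where
    "\<forall>\<^sub>F r in at_top. (f has_contour_integral I r) (\<gamma> r)" "(I \<longlongrightarrow> L) at_top"
    "\<forall>\<^sub>F r in at_top. (g has_contour_integral J r) (\<gamma> r)" "(J \<longlongrightarrow> L') at_top"
    unfolding has_improper_integral_def by blast
  then show ?thesis unfolding has_improper_integral_def
    by (intro exI[of _ "\<lambda>r. I r + J r"] conjI tendsto_add)
       (auto elim: eventually_elim2 intro: has_contour_integral_add)
qed

lemma has_improper_integral_cmult:
  assumes "has_improper_integral \<gamma> f L"
  shows "has_improper_integral \<gamma> (\<lambda>k. c * f k) (c * L)"
proof -
  from assms obtain I where
    "\<forall>\<^sub>F r in at_top. (f has_contour_integral I r) (\<gamma> r)" "(I \<longlongrightarrow> L) at_top"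
    unfolding has_improper_integral_def by blast
  then show ?thesis unfolding has_improper_integral_def
    by (intro exI[of _ "\<lambda>r. c * I r"] conjI tendsto_mult tendsto_const)
       (auto elim: eventually_mono intro: has_contour_integral_lmul)
qed

lemma has_improper_integral_diff:
  assumes "has_improper_integral \<gamma> f L" "has_improper_integral \<gamma> g L'"
  shows "has_improper_integral \<gamma> (\<lambda>k. f k - g k) (L - L')"
  using has_improper_integral_add[OF assms(1) has_improper_integral_cmult[OF assms(2), of "-1"]] by simp

lemma has_improper_integral_cong:
  assumes "has_improper_integral \<gamma> f L"
    "\<forall>\<^sub>F r in at_top. \<forall>k\<in>path_image (\<gamma> r). f k = g k"
  shows "has_improper_integral \<gamma> g L"
proof -
  from assms obtain I where
    I: "\<forall>\<^sub>F r in at_top. (f has_contour_integral I r) (\<gamma> r)" "(I \<longlongrightarrow> L) at_top"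
    unfolding has_improper_integral_def by blast
  show ?thesis unfolding has_improper_integral_def
    by (intro exI[of _ I] conjI I(2) eventually_mono[OF eventually_conj[OF I(1) assms(2)]])
       (auto intro: has_contour_integral_eq)
qed

text \<open>
  All contour integrals below are evaluated through primitives on a convex or slit domain.  Changing a
  contour then costs nothing, and convergence of an improper integral becomes convergence of a primitive
  along a ray or a line.
\<close>

lemma has_improper_integral_primitive:
  assumes "\<And>r. r > c \<Longrightarrow> valid_path (\<gamma> r)"
    "\<And>r k. r > c \<Longrightarrow> k \<in> path_image (\<gamma> r) \<Longrightarrow> k \<in> S"
    "\<And>k. k \<in> S \<Longrightarrow> (P has_field_derivative f k) (at k within S)"
    "((\<lambda>r. P (pathfinish (\<gamma> r)) - P (pathstart (\<gamma> r))) \<longlongrightarrow> L) at_top"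
  shows "has_improper_integral \<gamma> f L"
proof -
  have "(f has_contour_integral P (pathfinish (\<gamma> r)) - P (pathstart (\<gamma> r))) (\<gamma> r)" if "r > c" for r
    by (rule contour_integral_primitive[where S=S]) (use assms(1-3) that in auto)
  then have "\<forall>\<^sub>F r in at_top. (f has_contour_integral P (pathfinish (\<gamma> r)) - P (pathstart (\<gamma> r))) (\<gamma> r)"
    by (rule eventually_mono[OF eventually_gt_at_top[of c]])
  with assms(4) show ?thesis unfolding has_improper_integral_def
    by (intro exI[of _ "\<lambda>r. P (pathfinish (\<gamma> r)) - P (pathstart (\<gamma> r))"] conjI)
qed

text \<open>
  The substitute for absolutely convergent improper integrals: a primitive is compared with the explicit
  primitive \<open>p\<close> of a bound for its derivative.
\<close>

lemma tendsto_of_dominated_derivative: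
  fixes Q :: "real \<Rightarrow> complex"
  assumes Q: "\<And>r. r \<ge> s \<Longrightarrow> (Q has_vector_derivative Q' r) (at r)"
    and p: "\<And>r. r \<ge> s \<Longrightarrow> (p has_real_derivative p' r) (at r)"
    and bnd: "\<And>r. r \<ge> s \<Longrightarrow> norm (Q' r) \<le> p' r"
    and lim: "(p \<longlongrightarrow> p0) at_top"
  obtains l where "(Q \<longlongrightarrow> l) at_top" "norm (l - Q s) \<le> p0 - p s"
proof -
  have diff: "norm (Q b - Q a) \<le> p b - p a" if "s \<le> a" "a \<le> b" for a b
  proof (cases "a < b")
    case True
    then show ?thesis
    proof (rule differentiable_bound_general[where f'=Q' and \<phi>'=p'])
      show "continuous_on {a..b} Q" "continuous_on {a..b} p"
        using has_vector_derivative_continuous[OF Q] DERIV_isCont[OF p] that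
        by (auto intro!: continuous_at_imp_continuous_on)
    qed (use that Q p bnd in \<open>auto simp: has_real_derivative_iff_has_vector_derivative\<close>)
  qed (use that in auto)
  have c1: "convergent (\<lambda>n. Q (s + real n))"
  proof (rule Cauchy_convergent, rule CauchyI)
    fix e :: real assume "e > 0"
    have "(\<lambda>n. p (s + real n)) \<longlonglongrightarrow> p0"
      by (rule filterlim_compose[OF lim]) real_asymp
    then have "Cauchy (\<lambda>n. p (s + real n))" by (simp add: LIMSEQ_imp_Cauchy)
    then obtain M where M: "\<And>m n. m \<ge> M \<Longrightarrow> n \<ge> M \<Longrightarrow> norm (p (s + real m) - p (s + real n)) < e"
      using \<open>e > 0\<close> by (metis CauchyD)
    have "norm (Q (s + real m) - Q (s + real n)) < e" if "m \<ge> M" "n \<ge> M" for m n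
    proof (cases "m \<le> n")
      case True then show ?thesis using diff[of "s + real m" "s + real n"] M[of m n] that
        by (auto simp: norm_minus_commute)
    next
      case False then show ?thesis using diff[of "s + real n" "s + real m"] M[of m n] that by auto
    qed
    then show "\<exists>M. \<forall>m\<ge>M. \<forall>n\<ge>M. norm (Q (s + real m) - Q (s + real n)) < e" by blast
  qed
  then obtain l where l: "(\<lambda>n. Q (s + real n)) \<longlonglongrightarrow> l" by (auto simp: convergent_def)
  have bound: "norm (l - Q r) \<le> p0 - p r" if "r \<ge> s" for r
  proof (rule tendsto_le)
    show "(\<lambda>n. p (s + real n) - p r) \<longlonglongrightarrow> p0 - p r"
      by (intro tendsto_diff tendsto_const filterlim_compose[OF lim]) real_asymp
    show "(\<lambda>n. norm (Q (s + real n) - Q r)) \<longlonglongrightarrow> norm (l - Q r)"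
      by (intro tendsto_intros l)
    show "\<forall>\<^sub>F n in sequentially. norm (Q (s + real n) - Q r) \<le> p (s + real n) - p r"
    proof -
      obtain N where "r - s \<le> real N" using real_arch_simple by blast
      then show ?thesis using that
        by (intro eventually_sequentiallyI[of N] diff) auto
    qed
  qed simp
  have "((\<lambda>r. l - Q r) \<longlongrightarrow> 0) at_top"
  proof (rule Lim_null_comparison)
    show "\<forall>\<^sub>F r in at_top. norm (l - Q r) \<le> p0 - p r"
      using bound by (auto simp: eventually_at_top_linorder)
    show "((\<lambda>r. p0 - p r) \<longlongrightarrow> 0) at_top" using tendsto_diff[OF tendsto_const lim, of p0] by simp
  qed
  then have "(Q \<longlongrightarrow> l) at_top"
    using tendsto_diff[OF tendsto_const[of l], of "\<lambda>r. l - Q r" 0 at_top] by simp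
  with bound[of s] show ?thesis using that by blast
qed

section \<open>The oscillatory factor\<close>

lemma norm_osc: "norm (osc x t k) = exp (t * Im (k ^ 3) - x * Im k)"
  by (simp add: osc_def omega_def norm_exp_eq_Re algebra_simps)

lemma osc_holomorphic: "osc x t holomorphic_on S"
  unfolding osc_def omega_def by (intro holomorphic_intros)

lemma osc_DERIV: "(osc x t has_field_derivative osc x t k * (\<i> * (x - 3 * k\<^sup>2 * t))) (at k within S)"
  unfolding osc_def omega_def
  by (auto intro!: derivative_eq_intros simp: algebra_simps)

lemma Im_cube_cis: "Im ((of_real r * cis \<phi>) ^ 3) = r ^ 3 * sin (3 * \<phi>)"
proof -
  have "(of_real r * cis \<phi>) ^ 3 = of_real (r ^ 3) * cis (3 * \<phi>)"
    using Complex.DeMoivre[of \<phi> 3] by (simp add: power_mult_distrib)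
  then show ?thesis by (simp del: of_real_power)
qed

section \<open>Boundaries of sectors\<close>

text \<open>
  Common properties of \<open>D\<^sub>1\<^sup>+\<close> with \<open>\<beta> = \<alpha>\<^sup>2\<close> and \<open>D\<^sub>2\<^sup>+\<close> with \<open>\<beta> = \<alpha>\<close>, so that both are treated at once.  On the
  sector \<open>\<beta> k\<close> stays in a proper subsector of the lower half plane, where \<open>exp (- i \<beta> k y)\<close> decays for \<open>y > 0\<close>;
  \<open>k\<^sup>3\<close> is real on the two rays, where the time factor has modulus 1.
\<close>

definition decaying_sector :: "complex \<Rightarrow> real \<Rightarrow> real \<Rightarrow> bool"
  where "decaying_sector \<beta> \<theta>1 \<theta>2 \<longleftrightarrow> norm \<beta> = 1 \<and> \<theta>2 \<le> \<theta>1 \<and> \<theta>1 \<le> \<theta>2 + 2 \<and>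
    (\<forall>\<phi>\<in>{\<theta>2..\<theta>1}. Im (\<beta> * cis \<phi>) \<le> - 1 / 2 \<and> 0 \<le> sin \<phi>) \<and> sin (3 * \<theta>1) = 0 \<and> sin (3 * \<theta>2) = 0"

definition sector_path :: "real \<Rightarrow> real \<Rightarrow> real \<Rightarrow> real \<Rightarrow> real \<Rightarrow> complex"
  where "sector_path \<theta>1 \<theta>2 R r =
    linepath (of_real r * cis \<theta>1) (of_real R * cis \<theta>1) +++
    part_circlepath 0 R \<theta>1 \<theta>2 +++
    linepath (of_real R * cis \<theta>2) (of_real r * cis \<theta>2)"

lemma bdry_D1_eq: "bdry_D1 R r = sector_path (pi/3) 0 R r"
  by (simp add: bdry_D1_def sector_path_def)

lemma bdry_D2_eq: "bdry_D2 R r = sector_path pi (2*pi/3) R r"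
  by (simp add: bdry_D2_def sector_path_def)

lemma sin_ge_half:
  assumes "pi / 3 \<le> y" "y \<le> 2 * pi / 3"
  shows "sin y \<ge> 1 / 2"
proof -
  have "cos (pi / 3) \<le> cos \<bar>y - pi / 2\<bar>"
    using assms pi_gt_zero by (intro cos_monotone_0_pi_le) (auto simp: abs_if field_simps)
  also have "\<dots> = sin y" by (simp add: cos_diff)
  finally show ?thesis by (simp add: cos_60)
qed

lemma alpha_eq_cis: "alpha = cis (2 * pi / 3)"
  by (simp add: alpha_def cis_conv_exp mult.commute)

lemma alpha_cubed: "alpha ^ 3 = 1"
  using Complex.DeMoivre[of "2 * pi / 3" 3] by (simp add: alpha_eq_cis complex_eq_iff)

lemma decaying_sector_D2: "decaying_sector alpha pi (2 * pi / 3)"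
proof -
  have "Im (alpha * cis \<phi>) \<le> - 1 / 2 \<and> 0 \<le> sin \<phi>" if "\<phi> \<in> {2 * pi / 3..pi}" for \<phi>
  proof -
    have "sin (2 * pi / 3 + \<phi> - pi) \<ge> 1 / 2" using that by (intro sin_ge_half) auto
    then have "sin (2 * pi / 3 + \<phi>) \<le> - 1 / 2"
      using sin_periodic_pi[of "2 * pi / 3 + \<phi> - pi"] by simp
    moreover have "0 \<le> sin \<phi>" using that by (intro sin_ge_zero) (auto intro: order_trans[OF _ that[THEN atLeastAtMost_iff[THEN iffD1, THEN conjunct1]]])
    ultimately show ?thesis by (simp add: alpha_eq_cis cis_mult)
  qed
  moreover have "sin (3 * (2 * pi / 3)) = 0" by simp
  moreover have "sin (3 * pi) = 0" using sin_npi[of 3] by simp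
  ultimately show ?thesis using pi_less_4
    unfolding decaying_sector_def by (auto simp: alpha_eq_cis)
qed

lemma decaying_sector_D1: "decaying_sector (alpha\<^sup>2) (pi / 3) 0"
proof -
  have a2: "alpha\<^sup>2 = cis (4 * pi / 3)" by (simp add: alpha_eq_cis Complex.DeMoivre)
  have "Im (alpha\<^sup>2 * cis \<phi>) \<le> - 1 / 2 \<and> 0 \<le> sin \<phi>" if "\<phi> \<in> {0..pi / 3}" for \<phi>
  proof -
    have "sin (4 * pi / 3 + \<phi> - pi) \<ge> 1 / 2" using that by (intro sin_ge_half) auto
    then have "sin (4 * pi / 3 + \<phi>) \<le> - 1 / 2"
      using sin_periodic_pi[of "4 * pi / 3 + \<phi> - pi"] by simp
    moreover have "0 \<le> sin \<phi>" using that by (intro sin_ge_zero) auto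
    ultimately show ?thesis by (simp add: a2 cis_mult)
  qed
  then show ?thesis using pi_less_4
    unfolding decaying_sector_def by (auto simp: a2)
qed

lemma sector_path_ends [simp]:
  "pathstart (sector_path \<theta>1 \<theta>2 R r) = of_real r * cis \<theta>1"
  "pathfinish (sector_path \<theta>1 \<theta>2 R r) = of_real r * cis \<theta>2"
  by (simp_all add: sector_path_def)

lemma valid_sector_path [simp]: "valid_path (sector_path \<theta>1 \<theta>2 R r)"
  unfolding sector_path_def by (intro valid_path_join) (auto simp: cis_conv_exp)

lemma path_image_sector_path:
  assumes "R > 0" "r > 0" "\<theta>2 \<le> \<theta>1" "k \<in> path_image (sector_path \<theta>1 \<theta>2 R r)"
  obtains \<rho> \<phi> where "\<rho> > 0" "\<phi> \<in> {\<theta>2..\<theta>1}" "k = of_real \<rho> * cis \<phi>"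
proof -
  have ray: "\<exists>\<rho>>0. k = of_real \<rho> * cis \<theta>" if k: "k \<in> closed_segment (of_real a * cis \<theta>) (of_real b * cis \<theta>)" "a > 0" "b > 0" for a b \<theta>
  proof -
    obtain u :: real where u: "0 \<le> u" "u \<le> 1" "k = (1 - u) *\<^sub>R (of_real a * cis \<theta>) + u *\<^sub>R (of_real b * cis \<theta>)"
      using k(1) unfolding closed_segment_def by blast
    have "k = of_real ((1 - u) * a + u * b) * cis \<theta>"
      by (simp add: u(3) scaleR_conv_of_real algebra_simps)
    moreover have "(1 - u) * a + u * b > 0"
      using k u 
      by (cases "u = 0") (auto intro!: add_nonneg_pos)
    ultimately show ?thesis by blast
  qed
  have "k \<in> closed_segment (of_real r * cis \<theta>1) (of_real R * cis \<theta>1) \<or>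
        k \<in> path_image (part_circlepath 0 R \<theta>1 \<theta>2) \<or>
        k \<in> closed_segment (of_real R * cis \<theta>2) (of_real r * cis \<theta>2)"
    using assms(4) unfolding sector_path_def
    by (subst (asm) path_image_join; (subst (asm) path_image_join)?) (auto simp: cis_conv_exp)
  then show ?thesis
  proof (elim disjE)
    assume "k \<in> closed_segment (of_real r * cis \<theta>1) (of_real R * cis \<theta>1)"
    from ray[OF this assms(2,1)] show ?thesis using that assms(3) by auto
  next
    assume "k \<in> closed_segment (of_real R * cis \<theta>2) (of_real r * cis \<theta>2)"
    from ray[OF this assms(1,2)] show ?thesis using that assms(3) by auto
  next
    assume "k \<in> path_image (part_circlepath 0 R \<theta>1 \<theta>2)"
    then obtain \<phi> where "\<phi> \<in> closed_segment \<theta>1 \<theta>2" "k = of_real R * cis \<phi>"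
      unfolding path_image_part_circlepath' by auto
    then show ?thesis using that[of R \<phi>] assms(1,3) by (auto simp: closed_segment_eq_real_ivl split: if_splits)
  qed
qed

lemma half_plane_open_convex: "open {k. Im (\<beta> * k) < 0}" "convex {k. Im (\<beta> * k) < 0}"
proof -
  show "open {k. Im (\<beta> * k) < 0}" by (intro open_Collect_less continuous_intros)
  show "convex {k. Im (\<beta> * k) < 0}"
  proof (rule convexI)
    fix x y u v assume *: "x \<in> {k. Im (\<beta> * k) < 0}" "y \<in> {k. Im (\<beta> * k) < 0}" "(0::real) \<le> u" "0 \<le> v" "u + v = 1"
    have "Im (\<beta> * (u *\<^sub>R x + v *\<^sub>R y)) = u * Im (\<beta> * x) + v * Im (\<beta> * y)"
      by (simp add: algebra_simps)
    also have "\<dots> < 0" using * convex_bound_lt[of "Im (\<beta> * x)" 0 "Im (\<beta> * y)" u v] by simp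
    finally show "u *\<^sub>R x + v *\<^sub>R y \<in> {k. Im (\<beta> * k) < 0}" by simp
  qed
qed

lemma decaying_sectorD:
  assumes "decaying_sector \<beta> \<theta>1 \<theta>2"
  shows "norm \<beta> = 1" "\<beta> \<noteq> 0" "\<theta>2 \<le> \<theta>1" "\<theta>1 \<le> \<theta>2 + 2" "\<phi> \<in> {\<theta>2..\<theta>1} \<Longrightarrow> 0 \<le> sin \<phi>"
    "\<phi> \<in> {\<theta>2..\<theta>1} \<Longrightarrow> \<rho> > 0 \<Longrightarrow> Im (\<beta> * (of_real \<rho> * cis \<phi>)) \<le> - \<rho> / 2"
    "sin (3 * \<theta>1) = 0" "sin (3 * \<theta>2) = 0"
proof -
  assume *: "\<phi> \<in> {\<theta>2..\<theta>1}" "\<rho> > 0"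
  have "Im (\<beta> * (of_real \<rho> * cis \<phi>)) = \<rho> * Im (\<beta> * cis \<phi>)"
    by (simp add: algebra_simps)
  also have "\<dots> \<le> \<rho> * (- 1 / 2)"
    using * assms unfolding decaying_sector_def by (intro mult_left_mono) auto
  finally show "Im (\<beta> * (of_real \<rho> * cis \<phi>)) \<le> - \<rho> / 2" by simp
qed (use assms in \<open>auto simp: decaying_sector_def\<close>)

lemma sector_point_in_half_plane:
  assumes "decaying_sector \<beta> \<theta>1 \<theta>2" "\<phi> \<in> {\<theta>2..\<theta>1}" "\<rho> > 0"
  shows "of_real \<rho> * cis \<phi> \<in> {k. Im (\<beta> * k) < 0}"
  using decaying_sectorD(6)[OF assms] assms(3) by simp

lemma path_image_sector_path_half_plane:
  assumes "decaying_sector \<beta> \<theta>1 \<theta>2" "R > 0" "r > 0" "k \<in> path_image (sector_path \<theta>1 \<theta>2 R r)"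
  shows "k \<in> {k. Im (\<beta> * k) < 0}"
  using path_image_sector_path[OF assms(2,3) decaying_sectorD(3)[OF assms(1)] assms(4)]
    sector_point_in_half_plane[OF assms(1)] by metis

text \<open>
  Inside the sector the time factor grows, but on the arc of radius \<open>r\<close> at most by \<open>exp (t r\<^sup>3)\<close>, which is harmless
  for \<open>r \<le> t^(-1/3)\<close>.
\<close>

lemma norm_osc_sector:
  assumes "decaying_sector \<beta> \<theta>1 \<theta>2" "x \<ge> 0" "t \<ge> 0" "r > 0"
  shows "\<phi> \<in> {\<theta>2..\<theta>1} \<Longrightarrow> norm (osc x t (of_real r * cis \<phi>)) \<le> exp (t * r ^ 3)"
    "\<phi> \<in> {\<theta>1, \<theta>2} \<Longrightarrow> norm (osc x t (of_real r * cis \<phi>)) \<le> 1"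
proof -
  assume "\<phi> \<in> {\<theta>2..\<theta>1}"
  then have "0 \<le> x * (r * sin \<phi>)" using assms decaying_sectorD(5)[OF assms(1), of \<phi>] by auto
  moreover have "t * (r ^ 3 * sin (3 * \<phi>)) \<le> t * (r ^ 3 * 1)"
    using assms by (intro mult_left_mono) auto
  ultimately show "norm (osc x t (of_real r * cis \<phi>)) \<le> exp (t * r ^ 3)"
    by (simp only: norm_osc Im_cube_cis exp_le_cancel_iff) simp
next
  assume \<phi>: "\<phi> \<in> {\<theta>1, \<theta>2}"
  then have "0 \<le> sin \<phi>" using decaying_sectorD(3,5)[OF assms(1)] by auto
  then have "0 \<le> x * (r * sin \<phi>)" using assms by auto
  then show "norm (osc x t (of_real r * cis \<phi>)) \<le> 1"
    using \<phi> decaying_sectorD(7,8)[OF assms(1)] 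
    by (auto simp only: norm_osc Im_cube_cis exp_le_one_iff) auto
qed

lemma holomorphic_primitive_half_plane:
  assumes "f holomorphic_on {k. Im (\<beta> * k) < 0}"
  obtains P where "\<And>k. Im (\<beta> * k) < 0 \<Longrightarrow> (P has_field_derivative f k) (at k)"
proof -
  obtain P where P: "\<And>k. k \<in> {k. Im (\<beta> * k) < 0} \<Longrightarrow> (P has_field_derivative f k) (at k within {k. Im (\<beta> * k) < 0})"
    using holomorphic_convex_primitive'[OF half_plane_open_convex(2,1) assms] by blast
  show ?thesis
    by (rule that[of P]) (metis P at_within_open half_plane_open_convex(1) mem_Collect_eq)
qed

text \<open>
  The bound is required only on the rays beyond \<open>s\<close> and on the arc of radius \<open>s\<close>, whatever the radius \<open>R\<close> of the
  contour is: a primitive on the half plane sees the end points only.  Taking \<open>s\<close> large is what makes the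
  remainders small.
\<close>

lemma sector_integral_exists:
  assumes sec: "decaying_sector \<beta> \<theta>1 \<theta>2" and f: "f holomorphic_on {k. Im (\<beta> * k) < 0}"
    and R: "R > 0" and s: "s > 0" and B: "B \<ge> 0"
    and arc: "\<And>\<phi>. \<phi> \<in> {\<theta>2..\<theta>1} \<Longrightarrow> norm (f (of_real s * cis \<phi>)) \<le> B / s\<^sup>2"
    and rays: "\<And>r \<phi>. r \<ge> s \<Longrightarrow> \<phi> \<in> {\<theta>1, \<theta>2} \<Longrightarrow> norm (f (of_real r * cis \<phi>)) \<le> B / r\<^sup>2"
  obtains L where "has_improper_integral (sector_path \<theta>1 \<theta>2 R) f L" "norm L \<le> 4 * B / s"
proof -
  note th = decaying_sectorD(3)[OF sec]
  obtain P where P: "\<And>k. Im (\<beta> * k) < 0 \<Longrightarrow> (P has_field_derivative f k) (at k)"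
    using holomorphic_primitive_half_plane[OF f] by blast
  have "\<exists>l. ((\<lambda>r. P (of_real r * cis \<phi>)) \<longlongrightarrow> l) at_top \<and> norm (l - P (of_real s * cis \<phi>)) \<le> B / s"
    if \<phi>: "\<phi> \<in> {\<theta>1, \<theta>2}" for \<phi>
  proof -
    have "\<exists>l. ((\<lambda>r. P (of_real r * cis \<phi>)) \<longlongrightarrow> l) at_top \<and> norm (l - P (of_real s * cis \<phi>)) \<le> 0 - (- B / s)"
    proof (rule tendsto_of_dominated_derivative[of s "\<lambda>r. P (of_real r * cis \<phi>)" 
          "\<lambda>r. cis \<phi> * f (of_real r * cis \<phi>)" "\<lambda>r. - B / r" "\<lambda>r. B / r\<^sup>2" 0])
      fix r assume r: "r \<ge> s"
      then have *: "Im (\<beta> * (of_real r * cis \<phi>)) < 0"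
        using sector_point_in_half_plane[OF sec, of \<phi> r] \<phi> s th by auto
      have "((\<lambda>r. of_real r * cis \<phi>) has_vector_derivative cis \<phi>) (at r)"
        by (auto intro!: derivative_eq_intros)
      from field_vector_diff_chain_at[OF this P[OF *]]
      show "((\<lambda>r. P (of_real r * cis \<phi>)) has_vector_derivative cis \<phi> * f (of_real r * cis \<phi>)) (at r)"
        by (simp add: o_def)
      show "((\<lambda>r. - B / r) has_real_derivative B / r\<^sup>2) (at r)"
        using r s by (auto intro!: derivative_eq_intros simp: power2_eq_square)
      show "norm (cis \<phi> * f (of_real r * cis \<phi>)) \<le> B / r\<^sup>2"
        using rays[OF r \<phi>] by (simp add: norm_mult)
    next
      show "((\<lambda>r. - B / r) \<longlongrightarrow> 0) at_top" by real_asymp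
    qed auto
    then show ?thesis by simp
  qed
  then obtain l1 l2 where l1: "((\<lambda>r. P (of_real r * cis \<theta>1)) \<longlongrightarrow> l1) at_top" "norm (l1 - P (of_real s * cis \<theta>1)) \<le> B / s"
    and l2: "((\<lambda>r. P (of_real r * cis \<theta>2)) \<longlongrightarrow> l2) at_top" "norm (l2 - P (of_real s * cis \<theta>2)) \<le> B / s"
    by (metis insertCI)
  have arcb: "norm (P (of_real s * cis \<theta>1) - P (of_real s * cis \<theta>2)) \<le> 2 * B / s"
  proof -
    have "norm (P (of_real s * cis \<theta>1) - P (of_real s * cis \<theta>2)) \<le> B / s * norm (\<theta>1 - \<theta>2)"
    proof (rule differentiable_bound[of "{\<theta>2..\<theta>1}" "\<lambda>\<phi>. P (of_real s * cis \<phi>)" "\<lambda>\<phi> h. h *\<^sub>R (\<i> * of_real s * cis \<phi> * f (of_real s * cis \<phi>))"])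
      fix \<phi> assume \<phi>: "\<phi> \<in> {\<theta>2..\<theta>1}"
      then have *: "Im (\<beta> * (of_real s * cis \<phi>)) < 0"
        using sector_point_in_half_plane[OF sec, of \<phi> s] s by auto
      have "((\<lambda>\<phi>. of_real s * cis \<phi>) has_vector_derivative \<i> * of_real s * cis \<phi>) (at \<phi>)"
        unfolding cis_conv_exp
        by (rule has_vector_derivative_real_field[of "\<lambda>z. of_real s * exp (\<i> * z)"])
           (auto intro!: derivative_eq_intros)
      from field_vector_diff_chain_at[OF this P[OF *]]
      show "((\<lambda>\<phi>. P (of_real s * cis \<phi>)) has_derivative (\<lambda>h. h *\<^sub>R (\<i> * of_real s * cis \<phi> * f (of_real s * cis \<phi>)))) (at \<phi> within {\<theta>2..\<theta>1})"
        by (auto simp: o_def has_vector_derivative_def intro: has_derivative_at_withinI)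
      show "onorm (\<lambda>h. h *\<^sub>R (\<i> * of_real s * cis \<phi> * f (of_real s * cis \<phi>))) \<le> B / s"
      proof (rule onorm_le)
        fix h :: real
        have "s * norm (f (of_real s * cis \<phi>)) \<le> B / s"
          using arc[OF \<phi>] s by (simp add: field_simps power2_eq_square)
        then have "\<bar>h\<bar> * (s * norm (f (of_real s * cis \<phi>))) \<le> \<bar>h\<bar> * (B / s)"
          by (rule mult_left_mono) auto
        then show "norm (h *\<^sub>R (\<i> * of_real s * cis \<phi> * f (of_real s * cis \<phi>))) \<le> B / s * norm h"
          using s by (simp add: norm_mult mult_ac)
      qed
    qed (use th in auto)
    also have "\<dots> \<le> B / s * 2"
      using decaying_sectorD(3,4)[OF sec] B s by (intro mult_left_mono) auto
    finally show ?thesis by (simp add: mult.commute)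
  qed
  have "has_improper_integral (sector_path \<theta>1 \<theta>2 R) f (l2 - l1)"
  proof (rule has_improper_integral_primitive[where c=0 and P=P and S="{k. Im (\<beta> * k) < 0}"])
    show "((\<lambda>r. P (pathfinish (sector_path \<theta>1 \<theta>2 R r)) - P (pathstart (sector_path \<theta>1 \<theta>2 R r))) \<longlongrightarrow> l2 - l1) at_top"
      by (simp, intro tendsto_intros l1 l2)
    show "\<And>r k. 0 < r \<Longrightarrow> k \<in> path_image (sector_path \<theta>1 \<theta>2 R r) \<Longrightarrow> k \<in> {k. Im (\<beta> * k) < 0}"
      using path_image_sector_path_half_plane[OF sec R] by blast
    show "\<And>k. k \<in> {k. Im (\<beta> * k) < 0} \<Longrightarrow> (P has_field_derivative f k) (at k within {k. Im (\<beta> * k) < 0})"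
      using P by (blast intro: has_field_derivative_at_within)
  qed simp
  moreover have "norm (l2 - l1) \<le> 4 * B / s"
  proof -
    have "l2 - l1 = (l2 - P (of_real s * cis \<theta>2)) - (l1 - P (of_real s * cis \<theta>1))
       - (P (of_real s * cis \<theta>1) - P (of_real s * cis \<theta>2))" by simp
    also have "norm \<dots> \<le> B / s + B / s + 2 * B / s"
      by (intro norm_triangle_le_diff add_mono l1 l2 arcb order_trans[OF norm_triangle_ineq4])
    finally show ?thesis by simp
  qed
  ultimately show ?thesis using that by blast
qed

text \<open>
  The radius \<open>s\<close> in the estimate of the integral is arbitrary, so it may tend to infinity.
\<close>

lemma sector_integral_vanishes:
  assumes sec: "decaying_sector \<beta> \<theta>1 \<theta>2" and f: "f holomorphic_on {k. Im (\<beta> * k) < 0}"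
    and R: "R > 0" and B: "B \<ge> 0"
    and bnd: "\<And>k. k \<noteq> 0 \<Longrightarrow> Im k \<ge> 0 \<Longrightarrow> norm (f k) \<le> B / (norm k)\<^sup>2"
  shows "has_improper_integral (sector_path \<theta>1 \<theta>2 R) f 0"
proof -
  have ex: "\<exists>L. has_improper_integral (sector_path \<theta>1 \<theta>2 R) f L \<and> norm L \<le> 4 * B / s" if s: "s > 0" for s
  proof -
    have b: "norm (f (of_real r * cis \<phi>)) \<le> B / r\<^sup>2" if "\<phi> \<in> {\<theta>2..\<theta>1}" "r > 0" for r \<phi>
      using bnd[of "of_real r * cis \<phi>"] that decaying_sectorD(5)[OF sec that(1)] by (simp add: norm_mult)
    obtain L where "has_improper_integral (sector_path \<theta>1 \<theta>2 R) f L" "norm L \<le> 4 * B / s"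
      by (rule sector_integral_exists[OF sec f R s B b b]) (use s decaying_sectorD(3)[OF sec] in auto)
    then show ?thesis by blast
  qed
  obtain L where L: "has_improper_integral (sector_path \<theta>1 \<theta>2 R) f L" using ex[of 1] by auto
  have Lb: "norm L \<le> 4 * B / s" if "s > 0" for s
    using ex[OF that] has_improper_integral_unique[OF L] by blast
  have "norm L \<le> 0"
  proof (rule tendsto_le[OF _ _ tendsto_const])
    show "((\<lambda>s. 4 * B / s) \<longlongrightarrow> 0) at_top" by real_asymp
    show "\<forall>\<^sub>F s in at_top. norm L \<le> 4 * B / s"
      using eventually_gt_at_top[of 0] by eventually_elim (rule Lb)
  qed simp
  with L show ?thesis by simp
qed

lemma sector_integral_of_derivative:
  assumes sec: "decaying_sector \<beta> \<theta>1 \<theta>2" and R: "R > 0"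
    and P: "\<And>k. k \<noteq> 0 \<Longrightarrow> (P has_field_derivative f k) (at k)"
    and lim: "((\<lambda>r. P (of_real r * cis \<theta>1)) \<longlongrightarrow> 0) at_top" "((\<lambda>r. P (of_real r * cis \<theta>2)) \<longlongrightarrow> 0) at_top"
  shows "has_improper_integral (sector_path \<theta>1 \<theta>2 R) f 0"
proof (rule has_improper_integral_primitive[where c=0 and P=P and S="- {0}"])
  show "\<And>r k. 0 < r \<Longrightarrow> k \<in> path_image (sector_path \<theta>1 \<theta>2 R r) \<Longrightarrow> k \<in> - {0}"
    using path_image_sector_path_half_plane[OF sec R] by force
  show "\<And>k. k \<in> - {0} \<Longrightarrow> (P has_field_derivative f k) (at k within - {0})"
    using P by (auto intro: has_field_derivative_at_within)
  show "((\<lambda>r. P (pathfinish (sector_path \<theta>1 \<theta>2 R r)) - P (pathstart (sector_path \<theta>1 \<theta>2 R r))) \<longlongrightarrow> 0) at_top"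
    using tendsto_diff[OF lim(2,1)] by simp
qed simp

lemma half_plane_nonzero: "Im (\<beta> * k) < 0 \<Longrightarrow> k \<noteq> 0"
  by auto

text \<open>
  A form of Jordan's lemma.  The integrand \<open>exp (i k x) / k\<close> is not small enough for the previous lemma, but one
  integration by parts with respect to \<open>k\<close> gains a factor \<open>1 / k\<close>.
\<close>

lemma sector_integral_exp_vanishes:
  assumes sec: "decaying_sector \<beta> \<theta>1 \<theta>2" and R: "R > 0" and x: "x > 0"
  shows "has_improper_integral (sector_path \<theta>1 \<theta>2 R) (\<lambda>k. exp (\<i> * k * of_real x) / k\<^sup>2) 0"
    "has_improper_integral (sector_path \<theta>1 \<theta>2 R) (\<lambda>k. exp (\<i> * k * of_real x) / k) 0"
proof -
  have ne: "norm (exp (\<i> * k * of_real x)) \<le> 1" if "Im k \<ge> 0" for k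
    using that x by (simp add: norm_exp_eq_Re)
  have b2: "norm (exp (\<i> * k * of_real x) / k\<^sup>2) \<le> 1 / (norm k)\<^sup>2" if "k \<noteq> 0" "Im k \<ge> 0" for k
    unfolding norm_divide norm_power using ne[OF that(2)] by (rule divide_right_mono) simp
  show 2: "has_improper_integral (sector_path \<theta>1 \<theta>2 R) (\<lambda>k. exp (\<i> * k * of_real x) / k\<^sup>2) 0"
    by (rule sector_integral_vanishes[OF sec _ R _ b2])
      (auto intro!: holomorphic_intros dest: half_plane_nonzero)
  have lim: "((\<lambda>r. exp (\<i> * (of_real r * cis \<theta>) * of_real x) / (\<i> * of_real x * (of_real r * cis \<theta>))) \<longlongrightarrow> 0) at_top"
    if th: "\<theta> \<in> {\<theta>2..\<theta>1}" for \<theta>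
  proof (rule Lim_null_comparison)
    show "((\<lambda>r. 1 / (x * r)) \<longlongrightarrow> 0) at_top" using x by real_asymp
    show "\<forall>\<^sub>F r in at_top. norm (exp (\<i> * (of_real r * cis \<theta>) * of_real x) / (\<i> * of_real x * (of_real r * cis \<theta>))) \<le> 1 / (x * r)"
      using eventually_gt_at_top[of 0]
    proof eventually_elim
      fix r :: real assume r: "r > 0"
      have "Im (of_real r * cis \<theta>) \<ge> 0" using r decaying_sectorD(5)[OF sec th] by simp
      from ne[OF this] have "norm (exp (\<i> * (of_real r * cis \<theta>) * of_real x)) / (x * r) \<le> 1 / (x * r)"
        using r x by (intro divide_right_mono) auto
      then show "norm (exp (\<i> * (of_real r * cis \<theta>) * of_real x) / (\<i> * of_real x * (of_real r * cis \<theta>))) \<le> 1 / (x * r)"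
        using r x by (simp add: norm_divide norm_mult)
    qed
  qed
  have "has_improper_integral (sector_path \<theta>1 \<theta>2 R)
      (\<lambda>k. exp (\<i> * k * of_real x) / k - exp (\<i> * k * of_real x) / (\<i> * of_real x * k\<^sup>2)) 0"
  proof (rule sector_integral_of_derivative[OF sec R, where P="\<lambda>k. exp (\<i> * k * of_real x) / (\<i> * of_real x * k)"])
    fix k :: complex assume k: "k \<noteq> 0"
    then show "((\<lambda>k. exp (\<i> * k * of_real x) / (\<i> * of_real x * k)) has_field_derivative
      exp (\<i> * k * of_real x) / k - exp (\<i> * k * of_real x) / (\<i> * of_real x * k\<^sup>2)) (at k)"
      using x by (auto intro!: derivative_eq_intros simp: field_simps power2_eq_square)
  qed (use lim decaying_sectorD(3)[OF sec] in auto)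
  from has_improper_integral_add[OF this has_improper_integral_cmult[OF 2, of "1 / (\<i> * of_real x)"]]
  show "has_improper_integral (sector_path \<theta>1 \<theta>2 R) (\<lambda>k. exp (\<i> * k * of_real x) / k) 0"
    by simp
qed

text \<open>
  The integral of \<open>osc / k\<close> converges only conditionally.  Differentiating \<open>osc / k\<^sup>3\<close> produces \<open>osc / k\<close> from the cubic
  phase, together with terms that decay at least like \<open>k\<^sup>-\<^sup>3\<close>.
\<close>

lemma sector_integral_osc_exists:
  assumes sec: "decaying_sector \<beta> \<theta>1 \<theta>2" and R: "R > 0" and x: "x > 0" and t: "t > 0"
  shows "\<exists>L. has_improper_integral (sector_path \<theta>1 \<theta>2 R) (\<lambda>k. osc x t k / k\<^sup>2) L"
    "\<exists>L. has_improper_integral (sector_path \<theta>1 \<theta>2 R) (\<lambda>k. osc x t k / k) L"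
proof -
  note th = decaying_sectorD(3)[OF sec]
  have gen: "\<exists>L. has_improper_integral (sector_path \<theta>1 \<theta>2 R) (\<lambda>k. osc x t k / k ^ n) L" if n: "n \<ge> 2" for n
  proof -
    have b: "norm (osc x t (of_real r * cis \<phi>) / (of_real r * cis \<phi>) ^ n) \<le> exp t / r\<^sup>2"
      if "\<phi> \<in> {\<theta>2..\<theta>1}" "r \<ge> 1" "r = 1 \<or> \<phi> \<in> {\<theta>1, \<theta>2}" for r \<phi>
    proof -
      have 1: "norm (osc x t (of_real r * cis \<phi>)) \<le> exp t"
        using norm_osc_sector[OF sec, of x t r \<phi>] that x t by (auto intro: order_trans[of _ 1])
      have 2: "r\<^sup>2 \<le> r ^ n" using that n by (intro power_increasing) auto
      show ?thesis using that 1 2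
        by (simp add: norm_divide norm_mult norm_power, intro frac_le) auto
    qed
    obtain L where "has_improper_integral (sector_path \<theta>1 \<theta>2 R) (\<lambda>k. osc x t k / k ^ n) L" "norm L \<le> 4 * exp t / 1"
      by (rule sector_integral_exists[OF sec _ R, of "\<lambda>k. osc x t k / k ^ n" 1 "exp t"])
        (use th b b[of _ 1, simplified] in \<open>auto intro!: holomorphic_intros osc_holomorphic dest: half_plane_nonzero\<close>)
    then show ?thesis by blast
  qed
  show "\<exists>L. has_improper_integral (sector_path \<theta>1 \<theta>2 R) (\<lambda>k. osc x t k / k\<^sup>2) L" by (rule gen) simp
  obtain L3 where L3: "has_improper_integral (sector_path \<theta>1 \<theta>2 R) (\<lambda>k. osc x t k / k ^ 3) L3" using gen[of 3] by auto
  obtain L4 where L4: "has_improper_integral (sector_path \<theta>1 \<theta>2 R) (\<lambda>k. osc x t k / k ^ 4) L4" using gen[of 4] by auto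
  have lim: "((\<lambda>r. osc x t (of_real r * cis \<theta>) / (-3 * \<i> * of_real t * (of_real r * cis \<theta>) ^ 3)) \<longlongrightarrow> 0) at_top"
    if th: "\<theta> \<in> {\<theta>1, \<theta>2}" for \<theta>
  proof (rule Lim_null_comparison)
    show "((\<lambda>r. 1 / (3 * t * r ^ 3)) \<longlongrightarrow> 0) at_top" using t by real_asymp
    show "\<forall>\<^sub>F r in at_top. norm (osc x t (of_real r * cis \<theta>) / (-3 * \<i> * of_real t * (of_real r * cis \<theta>) ^ 3)) \<le> 1 / (3 * t * r ^ 3)"
      using eventually_gt_at_top[of 0]
    proof eventually_elim
      fix r :: real assume r: "r > 0"
      have "norm (osc x t (of_real r * cis \<theta>)) / (3 * t * r ^ 3) \<le> 1 / (3 * t * r ^ 3)"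
        using norm_osc_sector(2)[OF sec _ _ r th, of x t] x t r by (intro divide_right_mono) auto
      then show "norm (osc x t (of_real r * cis \<theta>) / (-3 * \<i> * of_real t * (of_real r * cis \<theta>) ^ 3)) \<le> 1 / (3 * t * r ^ 3)"
        using r t by (simp add: norm_divide norm_mult norm_power)
    qed
  qed
  have "has_improper_integral (sector_path \<theta>1 \<theta>2 R)
      (\<lambda>k. osc x t k / k - x / (3 * t) * (osc x t k / k ^ 3) + 1 / (\<i> * of_real t) * (osc x t k / k ^ 4)) 0"
  proof (rule sector_integral_of_derivative[OF sec R, where P="\<lambda>k. osc x t k / (-3 * \<i> * of_real t * k ^ 3)"])
    fix k :: complex assume k: "k \<noteq> 0"
    have "((\<lambda>k. osc x t k / (-3 * \<i> * of_real t * k ^ 3)) has_field_derivative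
       (osc x t k * (\<i> * (x - 3 * k\<^sup>2 * t)) * (-3 * \<i> * of_real t * k ^ 3) - osc x t k * (-9 * \<i> * of_real t * k ^ 2)) /
         ((-3 * \<i> * of_real t * k ^ 3) * (-3 * \<i> * of_real t * k ^ 3))) (at k)"
      by (rule DERIV_divide[OF osc_DERIV]) (use k t in \<open>auto intro!: derivative_eq_intros\<close>)
    moreover have "(osc x t k * (\<i> * (x - 3 * k\<^sup>2 * t)) * (-3 * \<i> * of_real t * k ^ 3) - osc x t k * (-9 * \<i> * of_real t * k ^ 2)) /
         ((-3 * \<i> * of_real t * k ^ 3) * (-3 * \<i> * of_real t * k ^ 3)) =
        osc x t k / k - x / (3 * t) * (osc x t k / k ^ 3) + 1 / (\<i> * of_real t) * (osc x t k / k ^ 4)"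
    proof -
      define z where "z = osc x t k"
      have t0: "complex_of_real t \<noteq> 0" using t by simp
      show ?thesis unfolding z_def[symmetric] using k t0
        by (simp add: field_simps power2_eq_square power3_eq_cube power4_eq_xxxx)
    qed
    ultimately show "((\<lambda>k. osc x t k / (-3 * \<i> * of_real t * k ^ 3)) has_field_derivative
      osc x t k / k - x / (3 * t) * (osc x t k / k ^ 3) + 1 / (\<i> * of_real t) * (osc x t k / k ^ 4)) (at k)" by simp
  qed (use lim in auto)
  from has_improper_integral_diff[OF has_improper_integral_add[OF this has_improper_integral_cmult[OF L3, of "x / (3 * t)"]]
      has_improper_integral_cmult[OF L4, of "1 / (\<i> * of_real t)"]]
  have "has_improper_integral (sector_path \<theta>1 \<theta>2 R) (\<lambda>k. osc x t k / k) (0 + x / (3 * t) * L3 - 1 / (\<i> * of_real t) * L4)"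
    by (simp add: algebra_simps)
  then show "\<exists>L. has_improper_integral (sector_path \<theta>1 \<theta>2 R) (\<lambda>k. osc x t k / k) L" by blast
qed

section \<open>Integrals over horizontal lines\<close>

definition line_path :: "real \<Rightarrow> real \<Rightarrow> real \<Rightarrow> complex"
  where "line_path \<eta> r = linepath (Complex (- r) (- \<eta>)) (Complex r (- \<eta>))"

lemma real_line_eq: "real_line = line_path 0"
proof -
  have "- complex_of_real r = Complex (- r) (- 0)" "complex_of_real r = Complex r (- 0)" for r
    by (auto simp: complex_eq_iff)
  then show ?thesis by (simp add: fun_eq_iff real_line_def line_path_def)
qed

lemma line_path_props [simp]:
  "valid_path (line_path \<eta> r)" "pathstart (line_path \<eta> r) = Complex (- r) (- \<eta>)"
  "pathfinish (line_path \<eta> r) = Complex r (- \<eta>)"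
  by (simp_all add: line_path_def)

lemma path_image_line_path:
  assumes "k \<in> path_image (line_path \<eta> r)"
  shows "Im k = - \<eta>"
proof -
  obtain u :: real where "k = (1 - u) *\<^sub>R Complex (- r) (- \<eta>) + u *\<^sub>R Complex r (- \<eta>)"
    using assms unfolding line_path_def path_image_linepath closed_segment_def by blast
  then have "Im k = (1 - u) * (- \<eta>) + u * (- \<eta>)" by simp
  then show ?thesis by (simp add: algebra_simps)
qed

text \<open>
  Here the comparison function is \<open>B / \<eta> * arctan (\<xi> / \<eta>)\<close>, with derivative \<open>B / (\<xi>\<^sup>2 + \<eta>\<^sup>2)\<close>.
\<close>

lemma line_integral_exists:
  assumes f: "f holomorphic_on {k. Im k < 0}" and \<eta>: "\<eta> > 0" and B: "B \<ge> 0"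
    and bnd: "\<And>k. Im k = - \<eta> \<Longrightarrow> norm (f k) \<le> B / (norm k)\<^sup>2"
  obtains L where "has_improper_integral (line_path \<eta>) f L" "norm L \<le> B * pi / \<eta>"
proof -
  obtain P where P: "\<And>k. Im k < 0 \<Longrightarrow> (P has_field_derivative f k) (at k)"
    using holomorphic_primitive_half_plane[of f 1] f by auto
  have ex: "\<exists>l. ((\<lambda>r. P (Complex (\<sigma> * r) (- \<eta>))) \<longlongrightarrow> l) at_top \<and>
      norm (l - P (Complex (\<sigma> * 0) (- \<eta>))) \<le> B / \<eta> * (pi / 2) - B / \<eta> * arctan (0 / \<eta>)"
    if \<sigma>: "\<bar>\<sigma>\<bar> = 1" for \<sigma> :: real
  proof (rule tendsto_of_dominated_derivative[of 0 "\<lambda>r. P (Complex (\<sigma> * r) (- \<eta>))"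
      "\<lambda>r. of_real \<sigma> * f (Complex (\<sigma> * r) (- \<eta>))" "\<lambda>r. B / \<eta> * arctan (r / \<eta>)" "\<lambda>r. B / (\<eta>\<^sup>2 + r\<^sup>2)" "B / \<eta> * (pi / 2)"])
    fix r :: real
    have "(\<lambda>r. Complex (\<sigma> * r) (- \<eta>)) = (\<lambda>r. of_real \<sigma> * of_real r - \<i> * of_real \<eta>)"
      by (auto simp: fun_eq_iff complex_eq_iff)
    then have "((\<lambda>r. Complex (\<sigma> * r) (- \<eta>)) has_vector_derivative of_real \<sigma>) (at r)"
      by (auto intro!: derivative_eq_intros)
    from field_vector_diff_chain_at[OF this P[of "Complex (\<sigma> * r) (- \<eta>)"]]
    show "((\<lambda>r. P (Complex (\<sigma> * r) (- \<eta>))) has_vector_derivative of_real \<sigma> * f (Complex (\<sigma> * r) (- \<eta>))) (at r)"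
      using \<eta> by (simp add: o_def)
    have "\<eta>\<^sup>2 + r\<^sup>2 > 0" using \<eta> by (simp add: sum_power2_gt_zero_iff)
    then have "inverse (1 + (r / \<eta>)\<^sup>2) = \<eta>\<^sup>2 / (\<eta>\<^sup>2 + r\<^sup>2)"
      using \<eta> by (simp add: field_simps)
    then show "((\<lambda>r. B / \<eta> * arctan (r / \<eta>)) has_real_derivative B / (\<eta>\<^sup>2 + r\<^sup>2)) (at r)"
      using \<eta> by (auto intro!: derivative_eq_intros simp: power2_eq_square)
    have "(norm (Complex (\<sigma> * r) (- \<eta>)))\<^sup>2 = \<eta>\<^sup>2 + r\<^sup>2"
      using \<sigma> by (simp add: cmod_power2 power_mult_distrib) (metis power2_abs one_power2 mult_1)
    then show "norm (of_real \<sigma> * f (Complex (\<sigma> * r) (- \<eta>))) \<le> B / (\<eta>\<^sup>2 + r\<^sup>2)"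
      using bnd[of "Complex (\<sigma> * r) (- \<eta>)"] \<sigma> by (simp add: norm_mult)
  next
    have "filterlim (\<lambda>r. r / \<eta>) at_top at_top" using \<eta> by real_asymp
    from filterlim_compose[OF tendsto_arctan_at_top this]
    show "((\<lambda>r. B / \<eta> * arctan (r / \<eta>)) \<longlongrightarrow> B / \<eta> * (pi / 2)) at_top"
      by (intro tendsto_intros)
  qed blast
  obtain l1 l2 where l: "((\<lambda>r. P (Complex r (- \<eta>))) \<longlongrightarrow> l1) at_top" "norm (l1 - P (Complex 0 (- \<eta>))) \<le> B / \<eta> * (pi / 2)"
     "((\<lambda>r. P (Complex (- r) (- \<eta>))) \<longlongrightarrow> l2) at_top" "norm (l2 - P (Complex 0 (- \<eta>))) \<le> B / \<eta> * (pi / 2)"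
    using ex[of 1] ex[of "-1"] by auto
  show ?thesis
  proof (rule that)
    show "has_improper_integral (line_path \<eta>) f (l1 - l2)"
    proof (rule has_improper_integral_primitive[where c=0 and P=P and S="{k. Im k < 0}"])
      show "((\<lambda>r. P (pathfinish (line_path \<eta> r)) - P (pathstart (line_path \<eta> r))) \<longlongrightarrow> l1 - l2) at_top"
        by (simp, intro tendsto_intros l)
      show "\<And>k. k \<in> {k. Im k < 0} \<Longrightarrow> (P has_field_derivative f k) (at k within {k. Im k < 0})"
        using P by (blast intro: has_field_derivative_at_within)
      show "\<And>r k. 0 < r \<Longrightarrow> k \<in> path_image (line_path \<eta> r) \<Longrightarrow> k \<in> {k. Im k < 0}"
        using path_image_line_path \<eta> by auto
    qed simp
    have "l1 - l2 = (l1 - P (Complex 0 (- \<eta>))) - (l2 - P (Complex 0 (- \<eta>)))" by simp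
    also have "norm \<dots> \<le> B / \<eta> * (pi / 2) + B / \<eta> * (pi / 2)"
      by (intro order_trans[OF norm_triangle_ineq4] add_mono l)
    finally show "norm (l1 - l2) \<le> B * pi / \<eta>" by (simp add: field_simps)
  qed
qed

text \<open>
  The term \<open>- 3 t \<xi>\<^sup>2 s\<close> comes from \<open>Im (\<xi> - i s)\<^sup>3\<close>: below the real axis the cubic phase gives Gaussian decay.
\<close>

lemma norm_osc_vertical:
  assumes "x \<ge> 0" "t \<ge> 0" "0 \<le> s" "s \<le> \<eta>"
  shows "norm (osc x t (Complex \<xi> (- s))) \<le> exp (x * \<eta> + t * \<eta> ^ 3) * exp (- 3 * t * \<xi>\<^sup>2 * s)"
proof -
  have "Im (Complex \<xi> (- s) ^ 3) = s ^ 3 - 3 * \<xi>\<^sup>2 * s"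
    by (simp add: power3_eq_cube power2_eq_square algebra_simps)
  moreover have "t * s ^ 3 \<le> t * \<eta> ^ 3" "x * s \<le> x * \<eta>"
    using assms by (auto intro!: mult_left_mono power_mono)
  moreover have "t * (s ^ 3 - 3 * \<xi>\<^sup>2 * s) = t * s ^ 3 - 3 * t * \<xi>\<^sup>2 * s" by (simp add: algebra_simps)
  ultimately have "t * Im (Complex \<xi> (- s) ^ 3) - x * - s \<le> x * \<eta> + t * \<eta> ^ 3 + - 3 * t * \<xi>\<^sup>2 * s"
    by simp
  then show ?thesis
    by (simp only: norm_osc exp_add[symmetric] exp_le_cancel_iff complex.sel)
qed

text \<open>
  On the real axis there is no decay at all, so a supremum bound on the vertical sides of a rectangle does
  not suffice; the integral of \<open>exp (- 3 t r\<^sup>2 s)\<close> in \<open>s\<close> is still of order \<open>1 / r\<^sup>2\<close>.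
\<close>

lemma vertical_side_vanishes:
  assumes P: "\<And>r s. r > 0 \<Longrightarrow> s \<in> {\<eta>1..\<eta>2} \<Longrightarrow> continuous (at s within {\<eta>1..\<eta>2}) (\<lambda>s. P (Complex (\<sigma> * r) (- s)))"
    and dP: "\<And>r s. r > 0 \<Longrightarrow> s \<in> {\<eta>1<..<\<eta>2} \<Longrightarrow> (P has_field_derivative osc x t (Complex (\<sigma> * r) (- s)) * f (Complex (\<sigma> * r) (- s))) (at (Complex (\<sigma> * r) (- s)))"
    and f: "\<And>r s. r > c \<Longrightarrow> s \<in> {\<eta>1<..<\<eta>2} \<Longrightarrow> norm (f (Complex (\<sigma> * r) (- s))) \<le> M"
    and \<eta>: "0 \<le> \<eta>1" "\<eta>1 \<le> \<eta>2" and x: "x \<ge> 0" and t: "t > 0" and \<sigma>: "\<bar>\<sigma>\<bar> = 1" and M: "M \<ge> 0"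
  shows "((\<lambda>r. P (Complex (\<sigma> * r) (- \<eta>2)) - P (Complex (\<sigma> * r) (- \<eta>1))) \<longlongrightarrow> 0) at_top"
proof (cases "\<eta>1 = \<eta>2")
  case False
  then have \<eta>12: "\<eta>1 < \<eta>2" using \<eta> by simp
  define C where "C = M * exp (x * \<eta>2 + t * \<eta>2 ^ 3)"
  have C: "C \<ge> 0" using M by (simp add: C_def)
  show ?thesis
  proof (rule Lim_null_comparison)
    show "((\<lambda>r. C / (3 * t * r\<^sup>2)) \<longlongrightarrow> 0) at_top" using t by real_asymp
    show "\<forall>\<^sub>F r in at_top. norm (P (Complex (\<sigma> * r) (- \<eta>2)) - P (Complex (\<sigma> * r) (- \<eta>1))) \<le> C / (3 * t * r\<^sup>2)"
      using eventually_gt_at_top[of "max 0 c"]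
    proof eventually_elim
      fix r assume r: "r > max 0 c"
      define p where "p s = - (C / (3 * t * r\<^sup>2)) * exp (- 3 * t * r\<^sup>2 * s)" for s
      have "norm (P (Complex (\<sigma> * r) (- \<eta>2)) - P (Complex (\<sigma> * r) (- \<eta>1))) \<le> p \<eta>2 - p \<eta>1"
      proof (rule differentiable_bound_general[OF \<eta>12, where f="\<lambda>s. P (Complex (\<sigma> * r) (- s))" and \<phi>'="\<lambda>s. C * exp (- 3 * t * r\<^sup>2 * s)"
          and f'="\<lambda>s. - \<i> * (osc x t (Complex (\<sigma> * r) (- s)) * f (Complex (\<sigma> * r) (- s)))"])
        show "continuous_on {\<eta>1..\<eta>2} (\<lambda>s. P (Complex (\<sigma> * r) (- s)))"
          using P[of r] r by (simp add: continuous_on_eq_continuous_within)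
        show "continuous_on {\<eta>1..\<eta>2} p" unfolding p_def by (intro continuous_intros)
        fix s assume s: "\<eta>1 < s" "s < \<eta>2"
        have "(\<lambda>s. Complex (\<sigma> * r) (- s)) = (\<lambda>s. of_real (\<sigma> * r) - \<i> * of_real s)"
          by (auto simp: fun_eq_iff complex_eq_iff)
        then have "((\<lambda>s. Complex (\<sigma> * r) (- s)) has_vector_derivative - \<i>) (at s)"
          by (auto intro!: derivative_eq_intros)
        from field_vector_diff_chain_at[OF this dP[of r s]]
        show "((\<lambda>s. P (Complex (\<sigma> * r) (- s))) has_vector_derivative - \<i> * (osc x t (Complex (\<sigma> * r) (- s)) * f (Complex (\<sigma> * r) (- s)))) (at s)"
          using r s by (simp add: o_def)
        have "(p has_real_derivative C * exp (- 3 * t * r\<^sup>2 * s)) (at s)"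
          unfolding p_def using r t by (auto intro!: derivative_eq_intros simp: field_simps power2_eq_square)
        then show "(p has_vector_derivative C * exp (- 3 * t * r\<^sup>2 * s)) (at s)"
          by (simp add: has_real_derivative_iff_has_vector_derivative)
        have "norm (osc x t (Complex (\<sigma> * r) (- s)) * f (Complex (\<sigma> * r) (- s))) \<le>
            exp (x * \<eta>2 + t * \<eta>2 ^ 3) * exp (- 3 * t * (\<sigma> * r)\<^sup>2 * s) * M"
          unfolding norm_mult using norm_osc_vertical[of x t s \<eta>2 "\<sigma> * r"] f[of r s] x t \<eta> s r M
          by (intro mult_mono) auto
        also have "(\<sigma> * r)\<^sup>2 = r\<^sup>2" using \<sigma> by (metis abs_mult mult_1 power2_abs)
        finally show "norm (- \<i> * (osc x t (Complex (\<sigma> * r) (- s)) * f (Complex (\<sigma> * r) (- s)))) \<le> C * exp (- 3 * t * r\<^sup>2 * s)"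
          by (simp add: C_def norm_mult mult_ac)
      qed
      also have "\<dots> \<le> C / (3 * t * r\<^sup>2) * 1"
      proof -
        have "p \<eta>2 \<le> 0" using C t by (simp add: p_def)
        moreover have "- p \<eta>1 \<le> C / (3 * t * r\<^sup>2) * 1"
          unfolding p_def minus_mult_left[symmetric] minus_minus using C t \<eta>
          by (intro mult_left_mono) auto
        ultimately show ?thesis by linarith
      qed
      finally show "norm (P (Complex (\<sigma> * r) (- \<eta>2)) - P (Complex (\<sigma> * r) (- \<eta>1))) \<le> C / (3 * t * r\<^sup>2)" by simp
    qed
  qed
qed simp

text \<open>
  The strip is closed and \<open>f\<close> need only be continuous on its boundary: the transform of an \<open>L\<^sup>1\<close> function is not
  holomorphic at real points.
\<close>

lemma line_integral_shift:
  assumes \<eta>: "0 \<le> \<eta>1" "\<eta>1 \<le> \<eta>2"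
    and cont: "continuous_on {k. - \<eta>2 \<le> Im k \<and> Im k \<le> - \<eta>1} f"
    and hol: "f holomorphic_on {k. - \<eta>2 < Im k \<and> Im k < - \<eta>1}"
    and bnd: "\<And>k. - \<eta>2 \<le> Im k \<Longrightarrow> Im k \<le> - \<eta>1 \<Longrightarrow> norm (f k) \<le> M"
    and x: "x \<ge> 0" and t: "t > 0"
    and L: "has_improper_integral (line_path \<eta>2) (\<lambda>k. osc x t k * f k) L"
  shows "has_improper_integral (line_path \<eta>1) (\<lambda>k. osc x t k * f k) L"
proof -
  define S where "S = {k. - \<eta>2 \<le> Im k \<and> Im k \<le> - \<eta>1}"
  define S' where "S' = {k. - \<eta>2 < Im k \<and> Im k < - \<eta>1}"
  have opS': "open S'" unfolding S'_def by (intro open_Collect_conj open_Collect_less continuous_intros)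
  have convS: "convex S"
  proof -
    have "S = {k. Im k \<ge> - \<eta>2} \<inter> {k. Im k \<le> - \<eta>1}" by (auto simp: S_def)
    then show ?thesis using convex_halfspace_Im_ge convex_halfspace_Im_le by (auto intro: convex_Int)
  qed
  have intS: "interior S \<subseteq> S'"
  proof
    fix k assume "k \<in> interior S"
    then obtain e where e: "e > 0" "ball k e \<subseteq> S" by (auto simp: mem_interior)
    have "k + \<i> * of_real (e/2) \<in> ball k e" "k - \<i> * of_real (e/2) \<in> ball k e"
      using e by (auto simp: dist_norm norm_mult)
    then have "k + \<i> * of_real (e/2) \<in> S" "k - \<i> * of_real (e/2) \<in> S" using e by blast+
    then show "k \<in> S'" using e by (auto simp: S_def S'_def)
  qed
  obtain P where P: "\<And>k. k \<in> S \<Longrightarrow> (P has_field_derivative osc x t k * f k) (at k within S)"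
  proof (rule holomorphic_convex_primitive[OF convS finite.emptyI, of "\<lambda>k. osc x t k * f k"])
    show "continuous_on S (\<lambda>k. osc x t k * f k)"
      using continuous_on_mult[OF holomorphic_on_imp_continuous_on[OF osc_holomorphic] cont] by (simp add: S_def)
    fix k assume "k \<in> interior S - {}"
    then have k: "k \<in> S'" using intS by auto
    have "(\<lambda>k. osc x t k * f k) holomorphic_on S'"
      using hol by (intro holomorphic_intros osc_holomorphic) (simp add: S'_def)
    then show "(\<lambda>k. osc x t k * f k) field_differentiable at k"
      using opS' k by (rule holomorphic_on_imp_differentiable_at)
  qed blast
  have dP: "(P has_field_derivative osc x t k * f k) (at k)" if "k \<in> S'" for k
  proof -
    have "k \<in> interior S" using that opS' by (intro interiorI[of S']) (auto simp: S_def S'_def)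
    then show ?thesis using P[of k] by (metis at_within_interior interior_subset subsetD)
  qed
  have side: "((\<lambda>r. P (Complex (\<sigma> * r) (- \<eta>2)) - P (Complex (\<sigma> * r) (- \<eta>1))) \<longlongrightarrow> 0) at_top"
    if \<sigma>: "\<bar>\<sigma>\<bar> = 1" for \<sigma>
  proof (rule vertical_side_vanishes[where f=f and c=0 and M="\<bar>M\<bar>"])
    fix r s assume s: "s \<in> {\<eta>1..\<eta>2}"
    have "continuous_on S P" using P by (intro DERIV_continuous_on)
    then have "continuous_on {\<eta>1..\<eta>2} (\<lambda>s. P (Complex (\<sigma> * r) (- s)))"
      by (rule continuous_on_compose2) (auto simp: S_def Complex_eq intro!: continuous_intros)
    then show "continuous (at s within {\<eta>1..\<eta>2}) (\<lambda>s. P (Complex (\<sigma> * r) (- s)))"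
      using s by (simp add: continuous_on_eq_continuous_within)
  next
    fix r s assume s: "s \<in> {\<eta>1<..<\<eta>2}"
    show "(P has_field_derivative osc x t (Complex (\<sigma> * r) (- s)) * f (Complex (\<sigma> * r) (- s))) (at (Complex (\<sigma> * r) (- s)))"
      by (rule dP) (use s in \<open>auto simp: S'_def\<close>)
    show "norm (f (Complex (\<sigma> * r) (- s))) \<le> \<bar>M\<bar>"
      using bnd[of "Complex (\<sigma> * r) (- s)"] s by auto
  qed (use \<eta> x t \<sigma> in auto)
  define I where "I \<eta> r = P (Complex r (- \<eta>)) - P (Complex (- r) (- \<eta>))" for \<eta> r
  have I: "((\<lambda>k. osc x t k * f k) has_contour_integral I \<eta> r) (line_path \<eta> r)" if "\<eta> \<in> {\<eta>1, \<eta>2}" for \<eta> r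
  proof -
    have "((\<lambda>k. osc x t k * f k) has_contour_integral P (pathfinish (line_path \<eta> r)) - P (pathstart (line_path \<eta> r))) (line_path \<eta> r)"
      by (rule contour_integral_primitive[where S=S]) (use P path_image_line_path[of _ \<eta> r] that \<eta> in \<open>auto simp: S_def\<close>)
    then show ?thesis by (simp add: I_def)
  qed
  obtain J where J: "\<forall>\<^sub>F r in at_top. ((\<lambda>k. osc x t k * f k) has_contour_integral J r) (line_path \<eta>2 r)" "(J \<longlongrightarrow> L) at_top"
    using L unfolding has_improper_integral_def by blast
  have "(I \<eta>2 \<longlongrightarrow> L) at_top"
    by (rule tendsto_cong[THEN iffD1, OF _ J(2)], rule eventually_mono[OF J(1)],
        rule has_contour_integral_unique, assumption, rule I) simp
  moreover have "((\<lambda>r. I \<eta>2 r - I \<eta>1 r) \<longlongrightarrow> 0) at_top"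
    using tendsto_diff[OF side[of 1] side[of "-1"]] by (simp add: I_def algebra_simps)
  ultimately have "((\<lambda>r. I \<eta>2 r - (I \<eta>2 r - I \<eta>1 r)) \<longlongrightarrow> L - 0) at_top" by (rule tendsto_diff)
  then have "(I \<eta>1 \<longlongrightarrow> L) at_top" by simp
  then show ?thesis unfolding has_improper_integral_def
    by (intro exI[of _ "I \<eta>1"]) (use I in auto)
qed

section \<open>The residue at the origin\<close>

lemma Ln_primitive_of_inverse:
  assumes "c \<noteq> 0" "c * k \<notin> \<real>\<^sub>\<le>\<^sub>0"
  shows "((\<lambda>k. Ln (c * k)) has_field_derivative 1 / k) (at k)"
proof -
  have "k \<noteq> 0" using assms by auto
  then show ?thesis using assms
    by (auto intro!: derivative_eq_intros simp: field_simps)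
qed

text \<open>
  The line passes below the pole at 0, the two sector boundaries, joined by a segment high up in the upper
  half plane, pass above it.  Away from the simple pole \<open>a / k\<close> the function has a global primitive; for \<open>a / k\<close>
  two branches of the logarithm are used, slit along the negative and the positive imaginary axis, and they
  differ by \<open>2 \<pi> i\<close> between \<open>-r\<close> and \<open>r\<close>.
\<close>

lemma line_integral_eq_sector_integrals:
  fixes L1 L2 :: complex
  assumes x: "x > 0" and t: "t > 0" and \<eta>: "\<eta> > 0" and R: "R > 0"
    and G: "G holomorphic_on UNIV" and f: "\<And>k. k \<noteq> 0 \<Longrightarrow> f k = G k + a / k + b / k\<^sup>2"
    and fh: "\<And>k. k \<noteq> 0 \<Longrightarrow> f k = osc x t k * h k" and h: "\<And>k. norm k \<ge> 1 \<Longrightarrow> norm (h k) \<le> 1"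
    and L1: "has_improper_integral (bdry_D1 R) f L1" and L2: "has_improper_integral (bdry_D2 R) f L2"
  shows "has_improper_integral (line_path \<eta>) f (L1 + L2 + 2 * pi * \<i> * a)"
proof -
  obtain PG where PG: "\<And>k. (PG has_field_derivative G k) (at k)"
    using holomorphic_convex_primitive'[OF convex_UNIV open_UNIV G] by auto
  define PU where "PU k = PG k + a * Ln (- \<i> * k) - b / k" for k
  define PL where "PL k = PG k + a * Ln (\<i> * k) - b / k" for k
  have PU: "(PU has_field_derivative f k) (at k)" if "\<not> (Re k = 0 \<and> Im k \<le> 0)" for k
  proof -
    have k: "k \<noteq> 0" using that by auto
    have "((\<lambda>k. Ln (- \<i> * k)) has_field_derivative 1 / k) (at k)"
      by (rule Ln_primitive_of_inverse) (use that in \<open>auto simp: complex_nonpos_Reals_iff\<close>)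
    moreover have "((\<lambda>k. b / k) has_field_derivative - (b / k\<^sup>2)) (at k)"
      using k by (auto intro!: derivative_eq_intros simp: power2_eq_square)
    ultimately show ?thesis unfolding PU_def f[OF k]
      using DERIV_diff[OF DERIV_add[OF PG DERIV_cmult]] by force
  qed
  have PL: "(PL has_field_derivative f k) (at k)" if "\<not> (Re k = 0 \<and> Im k \<ge> 0)" for k
  proof -
    have k: "k \<noteq> 0" using that by auto
    have "((\<lambda>k. Ln (\<i> * k)) has_field_derivative 1 / k) (at k)"
      by (rule Ln_primitive_of_inverse) (use that in \<open>auto simp: complex_nonpos_Reals_iff\<close>)
    moreover have "((\<lambda>k. b / k) has_field_derivative - (b / k\<^sup>2)) (at k)"
      using k by (auto intro!: derivative_eq_intros simp: power2_eq_square)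
    ultimately show ?thesis unfolding PL_def f[OF k]
      using DERIV_diff[OF DERIV_add[OF PG DERIV_cmult]] by force
  qed
  have sector: "(f has_contour_integral PU (of_real r * cis \<theta>2) - PU (of_real r * cis \<theta>1)) (sector_path \<theta>1 \<theta>2 R r)"
    if "decaying_sector \<beta> \<theta>1 \<theta>2" "r > 0" for \<beta> \<theta>1 \<theta>2 r
  proof -
    have "\<not> (Re k = 0 \<and> Im k \<le> 0)" if k: "k \<in> path_image (sector_path \<theta>1 \<theta>2 R r)" for k
    proof -
      obtain \<rho> \<phi> where *: "\<rho> > 0" "\<phi> \<in> {\<theta>2..\<theta>1}" "k = of_real \<rho> * cis \<phi>"
        using path_image_sector_path[OF R \<open>r > 0\<close> decaying_sectorD(3)[OF \<open>decaying_sector \<beta> \<theta>1 \<theta>2\<close>] k] by blast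
      have "0 \<le> sin \<phi>" using decaying_sectorD(5)[OF \<open>decaying_sector \<beta> \<theta>1 \<theta>2\<close> *(2)] .
      moreover have "cos \<phi> = 0 \<Longrightarrow> sin \<phi> \<noteq> 0" using sin_cos_squared_add[of \<phi>] by auto
      ultimately show ?thesis using * by (auto simp: mult_le_0_iff)
    qed
    then have "(f has_contour_integral PU (pathfinish (sector_path \<theta>1 \<theta>2 R r)) - PU (pathstart (sector_path \<theta>1 \<theta>2 R r))) (sector_path \<theta>1 \<theta>2 R r)"
      by (intro contour_integral_primitive[where S="path_image (sector_path \<theta>1 \<theta>2 R r)"])
         (auto intro: has_field_derivative_at_within[OF PU])
    then show ?thesis by simp
  qed
  define I1 where "I1 r = PU (of_real r) - PU (of_real r * cis (pi/3))" for r
  define I2 where "I2 r = PU (of_real r * cis (2*pi/3)) - PU (of_real (- r))" for r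
  have lim_unique: "(I \<longlongrightarrow> L) at_top" if \<gamma>: "has_improper_integral \<gamma> f L" "\<And>r. r > 0 \<Longrightarrow> (f has_contour_integral I r) (\<gamma> r)" for \<gamma> I L
  proof -
    obtain J where J: "\<forall>\<^sub>F r in at_top. (f has_contour_integral J r) (\<gamma> r)" "(J \<longlongrightarrow> L) at_top"
      using \<gamma>(1) unfolding has_improper_integral_def by blast
    have "\<forall>\<^sub>F r in at_top. I r = J r" using J(1) eventually_gt_at_top[of 0]
      by eventually_elim (use \<gamma>(2) has_contour_integral_unique in blast)
    then show ?thesis using J(2) by (simp add: tendsto_cong)
  qed
  have I1: "(I1 \<longlongrightarrow> L1) at_top"
    by (rule lim_unique[OF L1]) (use sector[OF decaying_sector_D1] in \<open>simp add: I1_def bdry_D1_eq\<close>)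
  have I2: "(I2 \<longlongrightarrow> L2) at_top"
    by (rule lim_unique[OF L2]) (use sector[OF decaying_sector_D2] in \<open>simp add: I2_def bdry_D2_eq\<close>)
  have top: "((\<lambda>r. PU (of_real r * cis (pi/3)) - PU (of_real r * cis (2*pi/3))) \<longlongrightarrow> 0) at_top"
  proof (rule Lim_null_comparison)
    show "((\<lambda>r. exp (- (x * (sqrt 3 / 2)) * r) * r) \<longlongrightarrow> 0) at_top" 
    proof -
      have "((\<lambda>r. exp (- y * r) * r) \<longlongrightarrow> 0) at_top" if "y > 0" for y :: real
        using that by real_asymp
      from this[of "x * (sqrt 3 / 2)"] show ?thesis using x by simp
    qed
    show "\<forall>\<^sub>F r in at_top. norm (PU (of_real r * cis (pi/3)) - PU (of_real r * cis (2*pi/3))) \<le> exp (- (x * (sqrt 3 / 2)) * r) * r"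
      using eventually_ge_at_top[of 2]
    proof eventually_elim
      fix r :: real assume r: "r \<ge> 2"
      define A B where "A = of_real r * cis (2*pi/3)" and "B = of_real r * cis (pi/3)"
      have A: "A = Complex (- r / 2) (r * (sqrt 3 / 2))" and B: "B = Complex (r / 2) (r * (sqrt 3 / 2))"
        by (simp_all add: A_def B_def complex_eq_iff cos_60 sin_60 cos_120 sin_120)
      have seg: "Im k = r * (sqrt 3 / 2)" "\<bar>Re k\<bar> \<le> r / 2" if k: "k \<in> closed_segment A B" for k
      proof -
        obtain u :: real where u: "0 \<le> u" "u \<le> 1" "k = (1 - u) *\<^sub>R A + u *\<^sub>R B"
          using k unfolding closed_segment_def by blast
        show "Im k = r * (sqrt 3 / 2)" by (simp add: u(3) A B algebra_simps)
        have "Re k = (2 * u - 1) * (r / 2)" by (simp add: u(3) A B algebra_simps)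
        then have "\<bar>Re k\<bar> = \<bar>2 * u - 1\<bar> * \<bar>r / 2\<bar>" by (simp only: abs_mult)
        also have "\<bar>2 * u - 1\<bar> * \<bar>r / 2\<bar> \<le> 1 * (r / 2)" using u r by (intro mult_mono) auto
        finally show "\<bar>Re k\<bar> \<le> r / 2" by simp
      qed
      have "norm (PU B - PU A) \<le> exp (- (x * (sqrt 3 / 2)) * r) * norm (B - A)"
      proof (rule field_differentiable_bound[where S="closed_segment A B" and f'=f])
        fix k assume k: "k \<in> closed_segment A B"
        have "r * (sqrt 3 / 2) > 0" using r by (intro mult_pos_pos) auto
        then have Imk: "Im k > 0" by (simp only: seg(1)[OF k])
        then show "(PU has_field_derivative f k) (at k within closed_segment A B)"
          by (intro has_field_derivative_at_within[OF PU]) auto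
        have "norm k \<ge> 1"
        proof -
          have "sqrt 3 / 2 \<ge> 1 / 2" by (simp add: real_le_rsqrt)
          then have "r * (sqrt 3 / 2) \<ge> 2 * (1 / 2)" using r by (intro mult_mono) auto
          then show ?thesis using seg(1)[OF k] abs_Im_le_cmod[of k] by linarith
        qed
        have "Im (k ^ 3) = Im k * (3 * (Re k)\<^sup>2 - (Im k)\<^sup>2)"
          by (simp add: power3_eq_cube power2_eq_square algebra_simps)
        also have "\<dots> \<le> 0"
        proof (rule mult_nonneg_nonpos)
          have "(Re k)\<^sup>2 \<le> (r / 2)\<^sup>2" using seg(2)[OF k] by (metis abs_ge_zero power2_abs power_mono)
          moreover have "(Im k)\<^sup>2 = 3 * (r / 2)\<^sup>2" by (simp add: seg(1)[OF k] power_mult_distrib power_divide)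
          ultimately show "3 * (Re k)\<^sup>2 - (Im k)\<^sup>2 \<le> 0" by simp
        qed (use Imk in simp)
        finally have "t * Im (k ^ 3) \<le> 0" using t by (simp add: mult_nonneg_nonpos)
        then have "norm (osc x t k) \<le> exp (- (x * (sqrt 3 / 2)) * r)"
          unfolding norm_osc by (simp add: seg(1)[OF k] mult_ac)
        then have "norm (osc x t k) * norm (h k) \<le> exp (- (x * (sqrt 3 / 2)) * r) * 1"
          using h[OF \<open>norm k \<ge> 1\<close>] by (intro mult_mono) auto
        moreover have "f k = osc x t k * h k" using Imk by (intro fh) auto
        ultimately show "norm (f k) \<le> exp (- (x * (sqrt 3 / 2)) * r)" by (simp add: norm_mult)
      qed auto
      also have "norm (B - A) = r"
      proof -
        have "B - A = of_real r" by (simp add: A B complex_eq_iff)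
        then show ?thesis using r by simp
      qed
      finally show "norm (PU (of_real r * cis (pi/3)) - PU (of_real r * cis (2*pi/3))) \<le> exp (- (x * (sqrt 3 / 2)) * r) * r"
        by (simp add: A_def B_def)
    qed
  qed
  have side: "((\<lambda>r. PL (Complex (\<sigma> * r) (- \<eta>)) - PL (Complex (\<sigma> * r) (- 0))) \<longlongrightarrow> 0) at_top"
    if \<sigma>: "\<bar>\<sigma>\<bar> = 1" for \<sigma>
  proof (rule vertical_side_vanishes[where f=h and c=1 and M=1 and x=x and t=t])
    fix r s :: real assume r: "r > 0"
    then have nz: "Re (Complex (\<sigma> * r) (- s)) \<noteq> 0" using \<sigma> by auto
    then have D: "(PL has_field_derivative f (Complex (\<sigma> * r) (- s))) (at (Complex (\<sigma> * r) (- s)))"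
      by (intro PL) auto
    then have "isCont PL (Complex (\<sigma> * r) (- s))" by (rule DERIV_isCont)
    moreover have "isCont (\<lambda>s. Complex (\<sigma> * r) (- s)) s" unfolding Complex_eq by (intro continuous_intros)
    ultimately have "isCont (\<lambda>s. PL (Complex (\<sigma> * r) (- s))) s" by (metis isCont_o2)
    then show "continuous (at s within {0..\<eta>}) (\<lambda>s. PL (Complex (\<sigma> * r) (- s)))"
      by (rule continuous_at_imp_continuous_within)
    show "(PL has_field_derivative osc x t (Complex (\<sigma> * r) (- s)) * h (Complex (\<sigma> * r) (- s))) (at (Complex (\<sigma> * r) (- s)))"
      using D fh[of "Complex (\<sigma> * r) (- s)"] nz by (metis zero_complex.sel(1))
  next
    fix r s :: real assume "r > 1"
    then have "1 \<le> norm (Complex (\<sigma> * r) (- s))" using abs_Re_le_cmod[of "Complex (\<sigma> * r) (- s)"] \<sigma> by (simp add: abs_mult)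
    then show "norm (h (Complex (\<sigma> * r) (- s))) \<le> 1" by (rule h)
  qed (use \<sigma> \<eta> x t in auto)
  define I where "I r = PL (Complex r (- \<eta>)) - PL (Complex (- r) (- \<eta>))" for r
  have hasI: "(f has_contour_integral I r) (line_path \<eta> r)" for r
  proof -
    have "(f has_contour_integral PL (pathfinish (line_path \<eta> r)) - PL (pathstart (line_path \<eta> r))) (line_path \<eta> r)"
      by (rule contour_integral_primitive[where S="path_image (line_path \<eta> r)"])
        (use path_image_line_path[of _ \<eta> r] \<eta> in \<open>force intro: has_field_derivative_at_within[OF PL]\<close>)+
    then show ?thesis by (simp add: I_def)
  qed
  have jump: "PL (of_real r) - PL (of_real (- r)) = PU (of_real r) - PU (of_real (- r)) + 2 * pi * \<i> * a" if r: "r > 0" for r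
  proof -
    have ln: "Ln (\<i> * of_real r) = Ln (of_real r) + \<i> * (pi / 2)" "Ln (- (\<i> * of_real r)) = Ln (of_real r) - \<i> * (pi / 2)"
      using Ln_times_of_real[OF r, of "\<i>"] Ln_times_of_real[OF r, of "-\<i>"] by (simp_all add: mult.commute Ln_ii Ln_minus_ii)
    show ?thesis by (simp add: PL_def PU_def ln algebra_simps)
  qed
  have cr: "Complex r (- 0) = of_real r" "Complex (- r) (- 0) = of_real (- r)" for r by (simp_all add: complex_eq_iff)
  have "((\<lambda>r. I1 r + I2 r + 2 * pi * \<i> * a + (PU (of_real r * cis (pi/3)) - PU (of_real r * cis (2*pi/3)))
      + (PL (Complex (1 * r) (- \<eta>)) - PL (Complex (1 * r) (- 0))) - (PL (Complex (- 1 * r) (- \<eta>)) - PL (Complex (- 1 * r) (- 0))))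
      \<longlongrightarrow> L1 + L2 + 2 * pi * \<i> * a + 0 + 0 - 0) at_top"
    by (intro tendsto_intros I1 I2 top side) auto
  moreover have "\<forall>\<^sub>F r in at_top. I1 r + I2 r + 2 * pi * \<i> * a + (PU (of_real r * cis (pi/3)) - PU (of_real r * cis (2*pi/3)))
      + (PL (Complex (1 * r) (- \<eta>)) - PL (Complex (1 * r) (- 0))) - (PL (Complex (- 1 * r) (- \<eta>)) - PL (Complex (- 1 * r) (- 0))) = I r"
    using eventually_gt_at_top[of 0]
  proof eventually_elim
    fix r :: real assume "r > 0"
    from jump[OF this] show "I1 r + I2 r + 2 * pi * \<i> * a + (PU (of_real r * cis (pi/3)) - PU (of_real r * cis (2*pi/3)))
      + (PL (Complex (1 * r) (- \<eta>)) - PL (Complex (1 * r) (- 0))) - (PL (Complex (- 1 * r) (- \<eta>)) - PL (Complex (- 1 * r) (- 0))) = I r"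
      by (simp only: I1_def I2_def I_def mult_1 mult_minus1 cr) (simp add: algebra_simps)
  qed
  ultimately have "(I \<longlongrightarrow> L1 + L2 + 2 * pi * \<i> * a) at_top" by (simp add: tendsto_cong)
  then show ?thesis unfolding has_improper_integral_def using hasI by (intro exI[of _ I]) auto
qed

lemma osc_pole_decomposition:
  shows "\<exists>G. G holomorphic_on UNIV \<and> (\<forall>k. k \<noteq> 0 \<longrightarrow> osc x t k / k = G k + 1 / k + 0 / k\<^sup>2)"
    "\<exists>G. G holomorphic_on UNIV \<and> (\<forall>k. k \<noteq> 0 \<longrightarrow> osc x t k / k\<^sup>2 = G k + (\<i> * x) / k + 1 / k\<^sup>2)"
proof -
  define G1 where "G1 z = (if z = 0 then deriv (osc x t) 0 else (osc x t z - osc x t 0) / (z - 0))" for z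
  define G2 where "G2 z = (if z = 0 then deriv G1 0 else (G1 z - G1 0) / (z - 0))" for z
  have G1: "G1 holomorphic_on UNIV" unfolding G1_def by (rule pole_lemma[OF osc_holomorphic]) simp
  have G2: "G2 holomorphic_on UNIV" unfolding G2_def by (rule pole_lemma[OF G1]) simp
  have 0: "osc x t 0 = 1" by (simp add: osc_def omega_def)
  have "deriv (osc x t) 0 = \<i> * x" using osc_DERIV[of x t 0 UNIV] by (simp add: DERIV_imp_deriv 0)
  then have G10: "G1 0 = \<i> * x" by (simp add: G1_def)
  show "\<exists>G. G holomorphic_on UNIV \<and> (\<forall>k. k \<noteq> 0 \<longrightarrow> osc x t k / k = G k + 1 / k + 0 / k\<^sup>2)"
    by (intro exI[of _ G1] conjI G1) (auto simp: G1_def 0 diff_divide_distrib)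
  show "\<exists>G. G holomorphic_on UNIV \<and> (\<forall>k. k \<noteq> 0 \<longrightarrow> osc x t k / k\<^sup>2 = G k + (\<i> * x) / k + 1 / k\<^sup>2)"
  proof (intro exI[of _ G2] conjI G2 allI impI)
    fix k :: complex assume k: "k \<noteq> 0"
    then have "G2 k = ((osc x t k - 1) / k - \<i> * x) / k" using G10 by (simp add: G2_def, simp add: G1_def 0)
    then show "osc x t k / k\<^sup>2 = G2 k + (\<i> * x) / k + 1 / k\<^sup>2"
      using k by (simp add: field_simps power2_eq_square)
  qed
qed

text \<open>
  The residues \<open>1\<close> and \<open>i x\<close> are the source of the summands \<open>1\<close> and \<open>x\<close> in the local solution.
\<close>

lemma line_integral_osc:
  fixes L1 L2 :: complex
  assumes x: "x > 0" and t: "t > 0" and \<eta>: "\<eta> > 0" and R: "R > 0"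
  shows "has_improper_integral (bdry_D1 R) (\<lambda>k. osc x t k / k) L1 \<Longrightarrow> has_improper_integral (bdry_D2 R) (\<lambda>k. osc x t k / k) L2
      \<Longrightarrow> has_improper_integral (line_path \<eta>) (\<lambda>k. osc x t k / k) (L1 + L2 + 2 * pi * \<i>)"
    "has_improper_integral (bdry_D1 R) (\<lambda>k. osc x t k / k\<^sup>2) L1 \<Longrightarrow> has_improper_integral (bdry_D2 R) (\<lambda>k. osc x t k / k\<^sup>2) L2
      \<Longrightarrow> has_improper_integral (line_path \<eta>) (\<lambda>k. osc x t k / k\<^sup>2) (L1 + L2 - 2 * pi * x)"
proof -
  assume *: "has_improper_integral (bdry_D1 R) (\<lambda>k. osc x t k / k) L1" "has_improper_integral (bdry_D2 R) (\<lambda>k. osc x t k / k) L2"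
  obtain G where G: "G holomorphic_on UNIV" "\<And>k. k \<noteq> 0 \<Longrightarrow> osc x t k / k = G k + 1 / k + 0 / k\<^sup>2"
    using osc_pole_decomposition(1) by metis
  have "has_improper_integral (line_path \<eta>) (\<lambda>k. osc x t k / k) (L1 + L2 + 2 * pi * \<i> * 1)"
  proof (rule line_integral_eq_sector_integrals[OF x t \<eta> R G(1), where b=0 and h="\<lambda>k. 1 / k", OF G(2) _ _ *])
    show "norm (1 / k) \<le> 1" if "norm k \<ge> 1" for k :: complex
      using that by (simp add: norm_divide divide_le_eq_1)
  qed auto
  then show "has_improper_integral (line_path \<eta>) (\<lambda>k. osc x t k / k) (L1 + L2 + 2 * pi * \<i>)"
    by simp
next
  assume *: "has_improper_integral (bdry_D1 R) (\<lambda>k. osc x t k / k\<^sup>2) L1" "has_improper_integral (bdry_D2 R) (\<lambda>k. osc x t k / k\<^sup>2) L2"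
  obtain G where G: "G holomorphic_on UNIV" "\<And>k. k \<noteq> 0 \<Longrightarrow> osc x t k / k\<^sup>2 = G k + (\<i> * x) / k + 1 / k\<^sup>2"
    using osc_pole_decomposition(2) by metis
  have "has_improper_integral (line_path \<eta>) (\<lambda>k. osc x t k / k\<^sup>2) (L1 + L2 + 2 * pi * \<i> * (\<i> * x))"
  proof (rule line_integral_eq_sector_integrals[OF x t \<eta> R G(1), where b=1 and h="\<lambda>k. 1 / k\<^sup>2", OF G(2) _ _ *])
    show "norm (1 / k\<^sup>2) \<le> 1" if "norm k \<ge> 1" for k :: complex
      using one_le_power[OF that, of 2] by (simp add: norm_divide norm_power divide_le_eq_1)
  qed auto
  moreover have "complex_of_real (2 * pi) * \<i> * (\<i> * complex_of_real x) = - complex_of_real (2 * pi * x)"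
    by (simp add: complex_eq_iff)
  ultimately show "has_improper_integral (line_path \<eta>) (\<lambda>k. osc x t k / k\<^sup>2) (L1 + L2 - 2 * pi * x)"
    by (simp only: add_uminus_conv_diff)
qed

section \<open>Laplace-Fourier transforms\<close>

lemma norm_exp_transform: "norm (exp (- \<i> * \<kappa> * of_real y)) = exp (Im \<kappa> * y)"
  by (simp add: norm_exp_eq_Re)

lemma continuous_on_exp_transform: "continuous_on A (\<lambda>y. exp (- \<i> * \<kappa> * complex_of_real y))"
  by (intro continuous_intros)

lemma transform_by_parts:
  assumes \<kappa>: "\<kappa> \<noteq> 0" and \<delta>: "\<delta> \<ge> 0" and g: "set_integrable lebesgue {0..\<delta>} g"
  shows "integral {0..\<delta>} (\<lambda>y. exp (- \<i> * \<kappa> * of_real y) * (c + integral {0..y} g)) =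
    c / (\<i> * \<kappa>) - exp (- \<i> * \<kappa> * of_real \<delta>) * (c + integral {0..\<delta>} g) / (\<i> * \<kappa>)
    + integral {0..\<delta>} (\<lambda>y. exp (- \<i> * \<kappa> * of_real y) * g y) / (\<i> * \<kappa>)"
proof -
  define v where "v y = exp (- \<i> * \<kappa> * complex_of_real y)" for y
  define V where "V y = - v y / (\<i> * \<kappa>)" for y
  have V: "(V has_vector_derivative v y) (at y within A)" for y A
  proof -
    have "((\<lambda>z. - exp (- \<i> * \<kappa> * z) / (\<i> * \<kappa>)) has_field_derivative exp (- \<i> * \<kappa> * of_real y)) (at (of_real y))"
      using \<kappa> by (auto intro!: derivative_eq_intros)
    from has_vector_derivative_real_field[OF this] show ?thesis by (simp add: V_def[abs_def] v_def)
  qed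
  have contv: "continuous_on {0..\<delta>} v" unfolding v_def by (rule continuous_on_exp_transform)
  have contG: "continuous_on {0..\<delta>} (\<lambda>y. integral {0..y} g)"
    by (intro indefinite_integral_continuous_1 set_lebesgue_integral_eq_integral(1)[OF g])
  have "integral {0..\<delta>} (\<lambda>y. v y * (c + integral {0..y} g)) =
      integral {0..\<delta>} (\<lambda>y. v y * c) + integral {0..\<delta>} (\<lambda>y. v y * integral {0..y} g)"
    unfolding distrib_left
    by (intro Henstock_Kurzweil_Integration.integral_add integrable_continuous_real continuous_intros contv contG)
  also have "integral {0..\<delta>} (\<lambda>y. v y * c) = (V \<delta> - V 0) * c"
    using fundamental_theorem_of_calculus[OF \<delta> V] by (simp add: integral_unique)
  also have "integral {0..\<delta>} (\<lambda>y. v y * integral {0..y} g) = V \<delta> * integral {0..\<delta>} g - integral {0..\<delta>} (\<lambda>y. V y * g y)"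
    by (rule integral_by_parts_indefinite[OF \<delta> g contv V])
  also have "(\<lambda>y. V y * g y) = (\<lambda>y. (- 1 / (\<i> * \<kappa>)) * (v y * g y))" by (simp add: V_def fun_eq_iff)
  also have "integral {0..\<delta>} \<dots> = (- 1 / (\<i> * \<kappa>)) * integral {0..\<delta>} (\<lambda>y. v y * g y)" by (rule integral_mult_right)
  also have "(V \<delta> - V 0) * c + (V \<delta> * integral {0..\<delta>} g - (- 1 / (\<i> * \<kappa>)) * integral {0..\<delta>} (\<lambda>y. v y * g y)) =
     c / (\<i> * \<kappa>) - v \<delta> * (c + integral {0..\<delta>} g) / (\<i> * \<kappa>) + integral {0..\<delta>} (\<lambda>y. v y * g y) / (\<i> * \<kappa>)"
  proof -
    have "v 0 = 1" by (simp add: v_def)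
    then show ?thesis unfolding V_def using \<kappa> by (simp add: field_simps)
  qed
  finally show ?thesis by (simp add: v_def)
qed

lemma transform_by_parts_twice:
  fixes c d :: complex and g :: "real \<Rightarrow> complex"
  assumes \<kappa>: "\<kappa> \<noteq> 0" and \<delta>: "\<delta> \<ge> 0" and g: "set_integrable lebesgue {0..\<delta>} g"
  defines "F1 \<equiv> \<lambda>s. d + integral {0..s} g"
  defines "F \<equiv> \<lambda>y. c + integral {0..y} F1"
  shows "integral {0..\<delta>} (\<lambda>y. exp (- \<i> * \<kappa> * of_real y) * F y) =
    c / (\<i> * \<kappa>) + d / (\<i> * \<kappa>)\<^sup>2 - exp (- \<i> * \<kappa> * of_real \<delta>) * (F \<delta> / (\<i> * \<kappa>) + F1 \<delta> / (\<i> * \<kappa>)\<^sup>2)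
    + integral {0..\<delta>} (\<lambda>y. exp (- \<i> * \<kappa> * of_real y) * g y) / (\<i> * \<kappa>)\<^sup>2"
proof -
  have "continuous_on {0..\<delta>} F1" unfolding F1_def
    by (intro continuous_intros indefinite_integral_continuous_1 set_lebesgue_integral_eq_integral(1)[OF g])
  then have F1: "set_integrable lebesgue {0..\<delta>} F1" by (rule absolutely_integrable_continuous_real)
  have "integral {0..\<delta>} (\<lambda>y. exp (- \<i> * \<kappa> * of_real y) * F y) = 
    c / (\<i> * \<kappa>) - exp (- \<i> * \<kappa> * of_real \<delta>) * F \<delta> / (\<i> * \<kappa>)
    + integral {0..\<delta>} (\<lambda>y. exp (- \<i> * \<kappa> * of_real y) * F1 y) / (\<i> * \<kappa>)"
    unfolding F_def by (rule transform_by_parts[OF \<kappa> \<delta> F1])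
  also have "integral {0..\<delta>} (\<lambda>y. exp (- \<i> * \<kappa> * of_real y) * F1 y) = 
    d / (\<i> * \<kappa>) - exp (- \<i> * \<kappa> * of_real \<delta>) * F1 \<delta> / (\<i> * \<kappa>)
    + integral {0..\<delta>} (\<lambda>y. exp (- \<i> * \<kappa> * of_real y) * g y) / (\<i> * \<kappa>)"
    unfolding F1_def by (rule transform_by_parts[OF \<kappa> \<delta> g])
  finally show ?thesis by (simp add: power2_eq_square add_divide_distrib diff_divide_distrib algebra_simps)
qed

lemma set_integrable_transform:
  assumes f: "set_integrable lebesgue S f" and S: "S \<subseteq> {0..}" and \<kappa>: "Im \<kappa> \<le> 0"
  shows "set_integrable lebesgue S (\<lambda>y. exp (- \<i> * \<kappa> * of_real y) * f y)"
proof (rule set_integrable_lebesgue_bounded_mult[OF f continuous_on_exp_transform])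
  fix y assume "y \<in> S"
  then have "Im \<kappa> * y \<le> 0" using S \<kappa> by (auto simp: mult_nonpos_nonneg)
  then show "norm (exp (- \<i> * \<kappa> * of_real y)) \<le> 1" by (simp only: norm_exp_transform exp_le_one_iff)
qed

lemma norm_transform_le:
  assumes f: "set_integrable lebesgue S f" and S: "S \<subseteq> {\<delta>..}" and \<delta>: "\<delta> \<ge> 0" and \<kappa>: "Im \<kappa> \<le> 0"
  shows "norm (LINT y:S|lebesgue. exp (- \<i> * \<kappa> * of_real y) * f y) \<le> exp (Im \<kappa> * \<delta>) * (LINT y:S|lebesgue. norm (f y))"
proof -
  have S0: "S \<subseteq> {0..}" using S \<delta> by force
  have nf: "set_integrable lebesgue S (\<lambda>y. norm (f y))" using f by (rule set_integrable_norm)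
  have "norm (LINT y:S|lebesgue. exp (- \<i> * \<kappa> * of_real y) * f y) \<le> (LINT y:S|lebesgue. norm (exp (- \<i> * \<kappa> * of_real y) * f y))"
    by (rule set_integral_norm_bound[OF set_integrable_transform[OF f S0 \<kappa>]])
  also have "\<dots> \<le> (LINT y:S|lebesgue. exp (Im \<kappa> * \<delta>) * norm (f y))"
  proof (rule set_integral_mono)
    show "set_integrable lebesgue S (\<lambda>y. norm (exp (- \<i> * \<kappa> * of_real y) * f y))"
      by (rule set_integrable_norm[OF set_integrable_transform[OF f S0 \<kappa>]])
    show "set_integrable lebesgue S (\<lambda>y. exp (Im \<kappa> * \<delta>) * norm (f y))" using nf by simp
    fix y assume "y \<in> S"
    then have "Im \<kappa> * y \<le> Im \<kappa> * \<delta>" using S \<kappa> by (auto intro: mult_left_mono_neg)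
    then show "norm (exp (- \<i> * \<kappa> * of_real y) * f y) \<le> exp (Im \<kappa> * \<delta>) * norm (f y)"
      unfolding norm_mult norm_exp_transform by (intro mult_right_mono) auto
  qed
  finally show ?thesis by simp
qed

lemma transform_continuous:
  assumes f: "set_integrable lebesgue S f" and S: "S \<subseteq> {0..}"
  shows "continuous_on {\<kappa>. Im \<kappa> \<le> 0} (\<lambda>\<kappa>. LINT y:S|lebesgue. exp (- \<i> * \<kappa> * of_real y) * f y)"
proof (rule continuous_on_sequentiallyI)
  fix u a assume u: "\<forall>n. u n \<in> {\<kappa>. Im \<kappa> \<le> 0}" "a \<in> {\<kappa>. Im \<kappa> \<le> 0}" "u \<longlonglongrightarrow> a"
  show "(\<lambda>n. LINT y:S|lebesgue. exp (- \<i> * u n * of_real y) * f y) \<longlonglongrightarrow> (LINT y:S|lebesgue. exp (- \<i> * a * of_real y) * f y)"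
    unfolding set_lebesgue_integral_def
  proof (rule integral_dominated_convergence[where w="\<lambda>y. norm (indicat_real S y *\<^sub>R f y)"])
    show "integrable lebesgue (\<lambda>y. norm (indicat_real S y *\<^sub>R f y))"
      using f by (intro integrable_norm) (simp add: set_integrable_def)
    show "(\<lambda>y. indicat_real S y *\<^sub>R (exp (- \<i> * a * of_real y) * f y)) \<in> borel_measurable lebesgue"
      using set_integrable_transform[OF f S, of a] u(2) by (simp add: set_integrable_def)
    show "(\<lambda>y. indicat_real S y *\<^sub>R (exp (- \<i> * u n * of_real y) * f y)) \<in> borel_measurable lebesgue" for n
      using set_integrable_transform[OF f S, of "u n"] u(1) by (simp add: set_integrable_def)
    show "AE y in lebesgue. (\<lambda>n. indicat_real S y *\<^sub>R (exp (- \<i> * u n * of_real y) * f y)) \<longlonglongrightarrow> indicat_real S y *\<^sub>R (exp (- \<i> * a * of_real y) * f y)"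
      by (intro AE_I2 tendsto_intros u)
    show "AE y in lebesgue. norm (indicat_real S y *\<^sub>R (exp (- \<i> * u n * of_real y) * f y)) \<le> norm (indicat_real S y *\<^sub>R f y)" for n
    proof (rule AE_I2)
      fix y
      show "norm (indicat_real S y *\<^sub>R (exp (- \<i> * u n * of_real y) * f y)) \<le> norm (indicat_real S y *\<^sub>R f y)"
      proof (cases "y \<in> S")
        case True
        then have "Im (u n) * y \<le> 0" using S u(1) by (auto simp: mult_nonpos_nonneg)
        then have "norm (exp (- \<i> * u n * of_real y)) \<le> 1" by (simp only: norm_exp_transform exp_le_one_iff)
        then show ?thesis using True by (simp only: norm_scaleR norm_mult) (auto intro!: mult_left_le_one_le)
      qed simp
    qed
  qed
qed

text \<open>
  The integrand is differentiated under the integral sign: a second order Taylor bound in \<open>\<kappa>\<close>, uniform in \<open>y\<close>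
  because \<open>y\<^sup>2 exp (- \<eta> y)\<close> is bounded, can be integrated against \<open>|f|\<close>.
\<close>

lemma transform_holomorphic:
  assumes f: "set_integrable lebesgue S f" and S: "S \<subseteq> {0..}"
  shows "(\<lambda>\<kappa>. LINT y:S|lebesgue. exp (- \<i> * \<kappa> * of_real y) * f y) holomorphic_on {\<kappa>. Im \<kappa> < 0}"
proof -
  define \<Psi> where "\<Psi> \<kappa> = (LINT y:S|lebesgue. exp (- \<i> * \<kappa> * of_real y) * f y)" for \<kappa>
  have "\<Psi> field_differentiable at a" if a: "Im a < 0" for a
  proof -
    define \<eta> where "\<eta> = - Im a / 2"
    have \<eta>: "\<eta> > 0" using a by (simp add: \<eta>_def)
    define H where "H = {\<kappa>. Im \<kappa> \<le> - \<eta>}"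
    have aH: "a \<in> H" "a \<in> interior H"
    proof -
      show "a \<in> H" using a by (simp add: H_def \<eta>_def)
      have "open {\<kappa>. Im \<kappa> < - \<eta>}" by (intro open_Collect_less continuous_intros)
      then show "a \<in> interior H" using a by (intro interiorI[of "{\<kappa>. Im \<kappa> < - \<eta>}"]) (auto simp: H_def \<eta>_def)
    qed
    define E where "E i y \<kappa> = (- \<i> * complex_of_real y) ^ i * exp (- \<i> * \<kappa> * of_real y)" for i y \<kappa>
    have nE: "norm (E i y \<kappa>) \<le> fact i / \<eta> ^ i" if "y \<in> S" "\<kappa> \<in> H" for i y \<kappa>
    proof -
      have y: "y \<ge> 0" using that S by auto
      have "norm (E i y \<kappa>) = y ^ i * exp (Im \<kappa> * y)"
        unfolding E_def norm_mult norm_exp_transform using y by (simp add: norm_power norm_mult)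
      also have "\<dots> \<le> y ^ i * exp (- \<eta> * y)"
        using that y by (intro mult_left_mono) (auto simp: H_def dest: mult_right_mono[of "Im \<kappa>" "- \<eta>" y])
      also have "\<dots> \<le> fact i / \<eta> ^ i"
      proof -
        have "(\<eta> * y) ^ i / fact i \<le> exp (\<eta> * y)" 
        proof -
          have "(\<Sum>j\<in>{i}. (\<eta> * y) ^ j /\<^sub>R fact j) \<le> exp (\<eta> * y)"
            unfolding exp_def using \<eta> y
            by (intro sum_le_suminf summable_exp_generic) auto
          then show ?thesis by (simp add: divide_inverse mult.commute)
        qed
        then have "y ^ i * exp (- (\<eta> * y)) * exp (\<eta> * y) \<le> fact i / \<eta> ^ i * exp (\<eta> * y)"
          using \<eta> by (simp add: exp_minus power_mult_distrib field_simps)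
        from mult_right_le_imp_le[OF this exp_gt_zero] show ?thesis by simp
      qed
      finally show ?thesis .
    qed
    have Ei: "set_integrable lebesgue S (\<lambda>y. E i y \<kappa> * f y)" if "\<kappa> \<in> H" for i \<kappa>
      by (rule set_integrable_lebesgue_bounded_mult[OF f _ nE[OF _ that]])
        (auto simp: E_def intro!: continuous_intros)
    define D where "D = (LINT y:S|lebesgue. E 1 y a * f y)"
    define C where "C = fact 2 / \<eta> ^ 2 * (LINT y:S|lebesgue. norm (f y))"
    have quad: "norm (\<Psi> \<kappa> - \<Psi> a - (\<kappa> - a) * D) \<le> C * (norm (\<kappa> - a))\<^sup>2" if \<kappa>: "\<kappa> \<in> H" for \<kappa>
    proof -
      have I: "set_integrable lebesgue S (\<lambda>y. (E 0 y \<kappa> - E 0 y a - E 1 y a * (\<kappa> - a)) * f y)"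
      proof -
        have "set_integrable lebesgue S (\<lambda>y. E 0 y \<kappa> * f y - E 0 y a * f y - (\<kappa> - a) * (E 1 y a * f y))"
          by (intro set_integral_diff(1) set_integrable_mult_right Ei \<kappa> aH(1))
        then show ?thesis by (simp add: algebra_simps)
      qed
      have PsiE: "\<Psi> \<kappa> = (LINT y:S|lebesgue. E 0 y \<kappa> * f y)" for \<kappa> by (simp add: \<Psi>_def E_def)
      have "\<Psi> \<kappa> - \<Psi> a - (\<kappa> - a) * D = (LINT y:S|lebesgue. E 0 y \<kappa> * f y - E 0 y a * f y - (\<kappa> - a) * (E 1 y a * f y))"
        unfolding D_def PsiE
        by (subst set_integral_diff(2), (intro set_integral_diff(1) set_integrable_mult_right Ei \<kappa> aH(1))+,
            subst set_integral_diff(2), (intro Ei \<kappa> aH(1))+) simp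
      also have "\<dots> = (LINT y:S|lebesgue. (E 0 y \<kappa> - E 0 y a - E 1 y a * (\<kappa> - a)) * f y)"
        by (simp add: algebra_simps)
      also have "norm \<dots> \<le> (LINT y:S|lebesgue. norm ((E 0 y \<kappa> - E 0 y a - E 1 y a * (\<kappa> - a)) * f y))"
        by (rule set_integral_norm_bound[OF I])
      also have "\<dots> \<le> (LINT y:S|lebesgue. (fact 2 / \<eta> ^ 2 * (norm (\<kappa> - a))\<^sup>2) * norm (f y))"
      proof (rule set_integral_mono)
        show "set_integrable lebesgue S (\<lambda>y. norm ((E 0 y \<kappa> - E 0 y a - E 1 y a * (\<kappa> - a)) * f y))"
          by (rule set_integrable_norm[OF I])
        show "set_integrable lebesgue S (\<lambda>y. (fact 2 / \<eta> ^ 2 * (norm (\<kappa> - a))\<^sup>2) * norm (f y))"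
          using set_integrable_norm[OF f] by (intro set_integrable_mult_right)
        fix y assume y: "y \<in> S"
        have "norm (E 0 y \<kappa> - (\<Sum>i\<le>1. E i y a * (\<kappa> - a) ^ i / fact i)) \<le> fact 2 / \<eta> ^ 2 * norm (\<kappa> - a) ^ Suc 1 / fact 1"
        proof (rule complex_Taylor[where S=H])
          show "convex H" unfolding H_def by (rule convex_halfspace_Im_le)
          fix i z assume "z \<in> H"
          show "((\<lambda>\<kappa>. E i y \<kappa>) has_field_derivative E (Suc i) y z) (at z within H)"
            unfolding E_def by (auto intro!: derivative_eq_intros)
          show "norm (E (Suc 1) y z) \<le> fact 2 / \<eta> ^ 2" using nE[OF y \<open>z \<in> H\<close>, of 2] by (simp add: numeral_2_eq_2)
        qed (use \<kappa> aH in auto)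
        then have "norm (E 0 y \<kappa> - E 0 y a - E 1 y a * (\<kappa> - a)) \<le> fact 2 / \<eta> ^ 2 * (norm (\<kappa> - a))\<^sup>2"
          by (simp add: diff_diff_eq power2_eq_square)
        then show "norm ((E 0 y \<kappa> - E 0 y a - E 1 y a * (\<kappa> - a)) * f y) \<le> (fact 2 / \<eta> ^ 2 * (norm (\<kappa> - a))\<^sup>2) * norm (f y)"
          unfolding norm_mult by (rule mult_right_mono) simp
      qed
      finally show ?thesis by (simp add: C_def mult_ac)
    qed
    have "((\<lambda>\<kappa>. (\<Psi> \<kappa> - \<Psi> a) / (\<kappa> - a) - D) \<longlongrightarrow> 0) (at a)"
    proof (rule Lim_null_comparison)
      have "\<forall>\<^sub>F \<kappa> in at a. \<kappa> \<in> interior H"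
        using aH(2) by (intro eventually_at_in_open') auto
      then show "\<forall>\<^sub>F \<kappa> in at a. norm ((\<Psi> \<kappa> - \<Psi> a) / (\<kappa> - a) - D) \<le> C * norm (\<kappa> - a)"
        using eventually_neq_at_within[of a]
      proof eventually_elim
        fix \<kappa> assume \<kappa>: "\<kappa> \<in> interior H" "\<kappa> \<noteq> a"
        have "(\<Psi> \<kappa> - \<Psi> a) / (\<kappa> - a) - D = (\<Psi> \<kappa> - \<Psi> a - (\<kappa> - a) * D) / (\<kappa> - a)"
          using \<kappa> by (simp add: field_simps)
        also have "norm \<dots> \<le> C * (norm (\<kappa> - a))\<^sup>2 / norm (\<kappa> - a)"
          unfolding norm_divide using quad[of \<kappa>] \<kappa> interior_subset by (intro divide_right_mono) auto
        finally show "norm ((\<Psi> \<kappa> - \<Psi> a) / (\<kappa> - a) - D) \<le> C * norm (\<kappa> - a)"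
          using \<kappa> by (simp add: power2_eq_square)
      qed
      show "((\<lambda>\<kappa>. C * norm (\<kappa> - a)) \<longlongrightarrow> 0) (at a)"
        by (rule tendsto_eq_intros refl | simp)+
    qed
    then have "(\<Psi> has_field_derivative D) (at a)"
      by (simp add: has_field_derivative_iff Lim_null[symmetric])
    then show ?thesis by (auto simp: field_differentiable_def)
  qed
  then show ?thesis unfolding \<Psi>_def
    by (auto simp: holomorphic_on_def intro: field_differentiable_at_within)
qed

text \<open>
  On a bounded interval a weight \<open>exp (B y)\<close> does no harm, and it shifts the half plane of holomorphy by \<open>B\<close>.
\<close>

lemma transform_entire:
  assumes f: "set_integrable lebesgue S f" and S: "S \<subseteq> {0..N}"
  shows "(\<lambda>\<kappa>. LINT y:S|lebesgue. exp (- \<i> * \<kappa> * of_real y) * f y) holomorphic_on A"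
proof -
  have "(\<lambda>\<kappa>. LINT y:S|lebesgue. exp (- \<i> * \<kappa> * of_real y) * f y) holomorphic_on {\<kappa>. Im \<kappa> < B}" for B
  proof -
    define f' where "f' y = complex_of_real (exp (B * y)) * f y" for y
    have f': "set_integrable lebesgue S f'" unfolding f'_def
    proof (rule set_integrable_lebesgue_bounded_mult[OF f])
      show "continuous_on UNIV (\<lambda>y. complex_of_real (exp (B * y)))" by (intro continuous_intros)
      fix y assume "y \<in> S"
      then have "y \<in> {0..N}" using S by auto
      then have "B * y \<le> \<bar>B\<bar> * N" by (intro mult_mono) auto
      then show "norm (complex_of_real (exp (B * y))) \<le> exp (\<bar>B\<bar> * N)" by simp
    qed
    have "(\<lambda>\<kappa>. LINT y:S|lebesgue. exp (- \<i> * \<kappa> * of_real y) * f' y) \<circ> (\<lambda>\<kappa>. \<kappa> - \<i> * of_real B) holomorphic_on {\<kappa>. Im \<kappa> < B}"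
      by (rule holomorphic_on_compose_gen[OF _ transform_holomorphic[OF f']])
        (use S in \<open>auto intro!: holomorphic_intros\<close>)
    moreover have "exp (- \<i> * (\<kappa> - \<i> * of_real B) * of_real y) * f' y = exp (- \<i> * \<kappa> * of_real y) * f y" for \<kappa> y
    proof -
      have "exp (- \<i> * (\<kappa> - \<i> * of_real B) * of_real y) * exp (complex_of_real (B * y)) = exp (- \<i> * \<kappa> * of_real y)"
        unfolding exp_add[symmetric] by (rule arg_cong[of _ _ exp]) (simp add: algebra_simps)
      then show ?thesis by (simp only: f'_def exp_of_real[symmetric] mult.assoc[symmetric])
    qed
    ultimately show ?thesis by (simp add: o_def)
  qed
  then have "(\<lambda>\<kappa>. LINT y:S|lebesgue. exp (- \<i> * \<kappa> * of_real y) * f y) holomorphic_on (\<Union>B. {\<kappa>. Im \<kappa> < B})"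
    by (intro holomorphic_on_UN_open) (auto intro!: open_Collect_less continuous_intros)
  moreover have "(\<Union>B. {\<kappa>. Im \<kappa> < B}) = UNIV" by (auto simp: gt_ex)
  ultimately have "(\<lambda>\<kappa>. LINT y:S|lebesgue. exp (- \<i> * \<kappa> * of_real y) * f y) holomorphic_on UNIV"
    by simp
  then show ?thesis by (rule holomorphic_on_subset) simp
qed

section \<open>Expansion of the transforms of the data\<close>

text \<open>
  The transform of the initial datum, with \<open>c\<close> and \<open>d\<close> the value and the slope at 0.  The remainder \<open>N\<close> is the
  contribution of the second derivative near 0; \<open>W\<close> collects everything at distance at least \<open>\<delta>\<close> from 0, the
  jumps included.
\<close>

definition transform_expansion ::
  "(complex \<Rightarrow> complex) \<Rightarrow> complex \<Rightarrow> complex \<Rightarrow> real \<Rightarrow> real \<Rightarrow> (complex \<Rightarrow> complex) \<Rightarrow> (complex \<Rightarrow> complex) \<Rightarrow> bool"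
  where "transform_expansion h c d \<delta> A N W \<longleftrightarrow>
    0 \<le> A \<and> N holomorphic_on {\<kappa>. Im \<kappa> < 0} \<and> W holomorphic_on {\<kappa>. Im \<kappa> < 0} \<and>
    (\<forall>\<kappa>. Im \<kappa> < 0 \<longrightarrow> h \<kappa> = c / (\<i> * \<kappa>) + d / (\<i> * \<kappa>)\<^sup>2 + N \<kappa> + W \<kappa>) \<and>
    (\<forall>\<kappa>. Im \<kappa> < 0 \<longrightarrow> norm (N \<kappa>) \<le> A / (sqrt (- Im \<kappa>) * (norm \<kappa>)\<^sup>2)) \<and>
    (\<forall>\<kappa>. Im \<kappa> < 0 \<longrightarrow> 1 \<le> norm \<kappa> \<longrightarrow> norm (W \<kappa>) \<le> A * exp (\<delta> * Im \<kappa>))"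

text \<open>
  The contribution of a boundary datum with value \<open>\<gamma>\<close> at time 0.  The time factor cancels in the boundary term
  at the upper limit \<open>s = t\<close> of the time transform, which leaves \<open>m exp (i k x) / k^n\<close>; this integrates to zero.
\<close>

definition boundary_expansion ::
  "(real \<Rightarrow> complex) \<Rightarrow> nat \<Rightarrow> nat \<Rightarrow> complex \<Rightarrow> (real \<Rightarrow> real) \<Rightarrow> real \<Rightarrow> real \<Rightarrow> bool"
  where "boundary_expansion g p n \<gamma> B x t \<longleftrightarrow> (\<exists>m Z. Z holomorphic_on - {0} \<and>
    (\<forall>k. k \<noteq> 0 \<longrightarrow> osc x t k * (k ^ p * time_transform g (- omega k) t) =
      \<i> * \<gamma> * (osc x t k / k ^ n) - m * (exp (\<i> * k * of_real x) / k ^ n) + Z k) \<and>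
    (\<forall>k. k \<noteq> 0 \<longrightarrow> Im k \<ge> 0 \<longrightarrow> t * Im (k ^ 3) \<le> 1 \<longrightarrow> norm (Z k) \<le> B (norm k)))"

lemma norm_osc_le:
  assumes "x \<ge> 0" "Im k \<ge> 0" "0 \<le> s" "s \<le> t" "t * Im (k ^ 3) \<le> 1"
  shows "norm (osc x s k) \<le> exp 1"
proof -
  have "s * Im (k ^ 3) \<le> 1"
  proof (cases "Im (k ^ 3) \<ge> 0")
    case True
    then have "s * Im (k ^ 3) \<le> t * Im (k ^ 3)" using assms by (intro mult_right_mono) auto
    then show ?thesis using assms by simp
  next
    case False
    then have "s * Im (k ^ 3) \<le> 0" using assms by (intro mult_nonneg_nonpos) auto
    then show ?thesis by simp
  qed
  moreover have "0 \<le> x * Im k" using assms by simp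
  ultimately have "s * Im (k ^ 3) - x * Im k \<le> 1" by linarith
  then show ?thesis by (simp only: norm_osc exp_le_cancel_iff)
qed

lemma set_integral_eq_HK_Ioo:
  fixes f F :: "real \<Rightarrow> complex"
  assumes F: "set_integrable lebesgue {a..b} F"
    and ae: "AE x in lebesgue. x \<in> {a<..<b} \<longrightarrow> f x = F x" and S: "{a<..<b} \<subseteq> S" "S \<subseteq> {a..b}"
    and fS: "set_borel_measurable lebesgue S f"
  shows "(LINT x:S|lebesgue. f x) = integral {a..b} F"
proof -
  have "AE x in lebesgue. x \<noteq> a" "AE x in lebesgue. x \<noteq> b"
    by (rule AE_completion, rule AE_lborel_singleton)+
  with ae have ae': "AE x in lebesgue. indicat_real S x *\<^sub>R f x = indicat_real {a..b} x *\<^sub>R F x"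
  proof eventually_elim
    case (elim x)
    show ?case
    proof (cases "x \<in> {a<..<b}")
      case True then show ?thesis using elim S by auto
    next
      case False
      then have "x \<notin> {a..b}" using elim by auto
      then show ?thesis using S by (auto split: split_indicator)
    qed
  qed
  have "(LINT x:S|lebesgue. f x) = (LINT x:{a..b}|lebesgue. F x)"
    unfolding set_lebesgue_integral_def
    by (rule integral_cong_AE[OF _ _ ae'])
      (use fS F in \<open>auto simp: set_borel_measurable_def set_integrable_def\<close>)
  then show ?thesis using set_lebesgue_integral_eq_integral(2)[OF F] by simp
qed

lemma set_integrable_exp_transform_Icc:
  fixes F :: "real \<Rightarrow> complex"
  assumes "set_integrable lebesgue {0..\<delta>} F"
  shows "set_integrable lebesgue {0..\<delta>} (\<lambda>y. exp (- \<i> * \<kappa> * of_real y) * F y)"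
proof (rule set_integrable_lebesgue_bounded_mult[OF assms continuous_on_exp_transform])
  fix y assume y: "y \<in> {0..\<delta>}"
  then have "Im \<kappa> * y \<le> \<bar>Im \<kappa>\<bar> * \<delta>" by (intro mult_mono) auto
  then show "norm (exp (- \<i> * \<kappa> * of_real y)) \<le> exp (\<bar>Im \<kappa>\<bar> * \<delta>)" by (simp only: norm_exp_transform exp_le_cancel_iff)
qed

lemma HK_transform_entire:
  fixes F :: "real \<Rightarrow> complex"
  assumes "set_integrable lebesgue {0..\<delta>} F"
  shows "(\<lambda>\<kappa>. integral {0..\<delta>} (\<lambda>y. exp (- \<i> * \<kappa> * of_real y) * F y)) holomorphic_on A"
proof -
  have "(\<lambda>\<kappa>. LINT y:{0..\<delta>}|lebesgue. exp (- \<i> * \<kappa> * of_real y) * F y) holomorphic_on A"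
    by (rule transform_entire[OF assms order_refl])
  then show ?thesis
    using set_lebesgue_integral_eq_integral(2)[OF set_integrable_exp_transform_Icc[OF assms]] by simp
qed

lemma product_le_weighted_squares:
  fixes a b w :: real
  assumes "w > 0"
  shows "a * b \<le> w * a\<^sup>2 + b\<^sup>2 / w"
proof -
  have "0 \<le> (w * a - b)\<^sup>2 / w" using assms by simp
  also have "(w * a - b)\<^sup>2 / w = w * a\<^sup>2 + b\<^sup>2 / w - 2 * (a * b)"
    using assms by (simp add: field_simps power2_eq_square)
  finally have 1: "2 * (a * b) \<le> w * a\<^sup>2 + b\<^sup>2 / w" by simp
  have "0 \<le> w * a\<^sup>2 + b\<^sup>2 / w" using assms by simp
  with 1 show ?thesis by linarith
qed

text \<open>
  The Cauchy-Schwarz inequality in the form \<open>a b \<le> w a\<^sup>2 + b\<^sup>2 / w\<close>, with the weight \<open>w = sqrt (- Im \<kappa>)\<close> that balances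
  the two terms.
\<close>

lemma norm_transform_L2_le:
  fixes g :: "real \<Rightarrow> complex"
  assumes g: "set_integrable lebesgue {0..\<delta>} g" "set_integrable lebesgue {0..\<delta>} (\<lambda>y. (norm (g y))\<^sup>2)"
    and \<kappa>: "Im \<kappa> < 0" and \<delta>: "\<delta> \<ge> 0"
  shows "norm (integral {0..\<delta>} (\<lambda>y. exp (- \<i> * \<kappa> * of_real y) * g y)) \<le>
    (1 + integral {0..\<delta>} (\<lambda>y. (norm (g y))\<^sup>2)) / sqrt (- Im \<kappa>)"
proof -
  define s where "s = - Im \<kappa>"
  have s: "s > 0" "sqrt s > 0" using \<kappa> by (auto simp: s_def)
  define h where "h y = sqrt s * exp (- 2 * s * y) + (norm (g y))\<^sup>2 / sqrt s" for y
  have e: "((\<lambda>y. sqrt s * exp (- 2 * s * y)) has_integral (sqrt s * (1 - exp (- 2 * s * \<delta>)) / (2 * s))) {0..\<delta>}"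
  proof -
    have "((\<lambda>y. sqrt s * exp (- 2 * s * y)) has_integral
       (- sqrt s * exp (- 2 * s * \<delta>) / (2 * s) - (- sqrt s * exp (- 2 * s * 0) / (2 * s)))) {0..\<delta>}"
      by (rule fundamental_theorem_of_calculus[OF \<delta>])
        (use s in \<open>auto intro!: derivative_eq_intros simp flip: has_real_derivative_iff_has_vector_derivative\<close>)
    then show ?thesis by (simp add: right_diff_distrib diff_divide_distrib)
  qed
  have g2: "((\<lambda>y. (norm (g y))\<^sup>2 / sqrt s) has_integral integral {0..\<delta>} (\<lambda>y. (norm (g y))\<^sup>2) / sqrt s) {0..\<delta>}"
    using set_lebesgue_integral_eq_integral(1)[OF g(2)] by (intro has_integral_divide integrable_integral)
  have h: "(h has_integral (sqrt s * (1 - exp (- 2 * s * \<delta>)) / (2 * s) + integral {0..\<delta>} (\<lambda>y. (norm (g y))\<^sup>2) / sqrt s)) {0..\<delta>}"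
    unfolding h_def by (rule has_integral_add[OF e g2])
  have "norm (integral {0..\<delta>} (\<lambda>y. exp (- \<i> * \<kappa> * of_real y) * g y)) \<le> integral {0..\<delta>} h"
  proof (rule integral_norm_bound_integral)
    show "(\<lambda>y. exp (- \<i> * \<kappa> * of_real y) * g y) integrable_on {0..\<delta>}"
      using set_integrable_exp_transform_Icc[OF g(1)] by (rule set_lebesgue_integral_eq_integral(1))
    show "h integrable_on {0..\<delta>}" using h by blast
    fix y
    have "norm (exp (- \<i> * \<kappa> * of_real y) * g y) = exp (- s * y) * norm (g y)"
      unfolding norm_mult norm_exp_transform by (simp add: s_def)
    also have "\<dots> \<le> sqrt s * (exp (- s * y))\<^sup>2 + (norm (g y))\<^sup>2 / sqrt s"
      by (rule product_le_weighted_squares[OF s(2)])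
    also have "(exp (- s * y))\<^sup>2 = exp (- 2 * s * y)" by (simp add: power2_eq_square exp_add[symmetric])
    finally show "norm (exp (- \<i> * \<kappa> * of_real y) * g y) \<le> h y" by (simp add: h_def)
  qed
  also have "integral {0..\<delta>} h = sqrt s * (1 - exp (- 2 * s * \<delta>)) / (2 * s) + integral {0..\<delta>} (\<lambda>y. (norm (g y))\<^sup>2) / sqrt s"
    using h by (rule integral_unique)
  also have "sqrt s * (1 - exp (- 2 * s * \<delta>)) / (2 * s) \<le> 1 / sqrt s"
  proof -
    have "sqrt s * (1 - exp (- 2 * s * \<delta>)) / (2 * s) \<le> sqrt s * 1 / (1 * s)"
      using s by (intro frac_le mult_left_mono) auto
    also have "\<dots> = 1 / sqrt s" using s by (simp add: field_simps)
    finally show ?thesis .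
  qed
  finally show ?thesis by (simp add: s_def add_divide_distrib)
qed

lemma integral_norm_L2_le:
  fixes g :: "real \<Rightarrow> complex"
  assumes g: "set_integrable lebesgue {0..b} g" "set_integrable lebesgue {0..b} (\<lambda>y. (norm (g y))\<^sup>2)"
    and t: "0 < t" "t \<le> b"
  shows "integral {0..t} (\<lambda>y. norm (g y)) \<le> (1 + integral {0..b} (\<lambda>y. (norm (g y))\<^sup>2)) * sqrt t"
proof -
  have sub: "set_integrable lebesgue {0..t} (\<lambda>y. norm (g y))" "set_integrable lebesgue {0..t} (\<lambda>y. (norm (g y))\<^sup>2)"
    using t by (auto intro!: set_integrable_norm set_integrable_subset[OF g(1)] set_integrable_subset[OF g(2)])
  note i = sub[THEN set_lebesgue_integral_eq_integral(1)]
  have "integral {0..t} (\<lambda>y. norm (g y)) \<le> integral {0..t} (\<lambda>y. 1 / sqrt t + sqrt t * (norm (g y))\<^sup>2)"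
  proof (rule integral_le[OF i(1)])
    show "(\<lambda>y. 1 / sqrt t + sqrt t * (norm (g y))\<^sup>2) integrable_on {0..t}"
      by (intro integrable_add integrable_on_mult_right i integrable_const_ivl)
    fix y
    show "norm (g y) \<le> 1 / sqrt t + sqrt t * (norm (g y))\<^sup>2"
      using product_le_weighted_squares[of "sqrt t" "norm (g y)" 1] t by simp
  qed
  also have "\<dots> = t / sqrt t + sqrt t * integral {0..t} (\<lambda>y. (norm (g y))\<^sup>2)"
    using t by (subst Henstock_Kurzweil_Integration.integral_add)
      (auto intro!: integrable_on_mult_right i)
  also have "integral {0..t} (\<lambda>y. (norm (g y))\<^sup>2) \<le> integral {0..b} (\<lambda>y. (norm (g y))\<^sup>2)"
    by (rule integral_subset_le) (use t i set_lebesgue_integral_eq_integral(1)[OF g(2)] in auto)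
  finally show ?thesis using t by (simp add: real_div_sqrt algebra_simps)
qed

text \<open>
  Two integrations by parts on \<open>(0, \<delta>)\<close>; the boundary terms at \<open>\<delta>\<close> and the rest of the half line go into \<open>W\<close>.
\<close>

lemma half_line_fourier_expansion:
  fixes f g :: "real \<Rightarrow> complex" and c d :: complex
  assumes f: "set_integrable lebesgue {0<..} f" and \<delta>: "\<delta> > 0"
    and g: "set_integrable lebesgue {0..\<delta>} g" "set_integrable lebesgue {0..\<delta>} (\<lambda>y. (norm (g y))\<^sup>2)"
    and ae: "AE x in lebesgue. x \<in> {0<..<\<delta>} \<longrightarrow> f x = c + integral {0..x} (\<lambda>s. d + integral {0..s} g)"
  obtains N W A where "transform_expansion (half_line_fourier f) c d \<delta> A N W"
proof -
  define F1 where "F1 s = d + integral {0..s} g" for s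
  define F where "F x = c + integral {0..x} F1" for x
  have cF1: "continuous_on {0..\<delta>} F1" unfolding F1_def
    by (intro continuous_intros indefinite_integral_continuous_1 set_lebesgue_integral_eq_integral(1)[OF g(1)])
  have cF: "continuous_on {0..\<delta>} F" unfolding F_def
    by (intro continuous_intros indefinite_integral_continuous_1 integrable_continuous_real cF1)
  define J where "J \<kappa> = integral {0..\<delta>} (\<lambda>y. exp (- \<i> * \<kappa> * of_real y) * g y)" for \<kappa>
  define \<Psi> where "\<Psi> \<kappa> = (LINT y:{\<delta><..}|lebesgue. exp (- \<i> * \<kappa> * of_real y) * f y)" for \<kappa>
  define N where "N \<kappa> = J \<kappa> / (\<i> * \<kappa>)\<^sup>2" for \<kappa>
  define W where "W \<kappa> = \<Psi> \<kappa> - exp (- \<i> * \<kappa> * of_real \<delta>) * (F \<delta> / (\<i> * \<kappa>) + F1 \<delta> / (\<i> * \<kappa>)\<^sup>2)" for \<kappa>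
  have fsub: "set_integrable lebesgue {\<delta><..} f" "set_integrable lebesgue {0<..\<delta>} f"
    using \<delta> by (auto intro!: set_integrable_subset[OF f])
  define A where "A = (1 + integral {0..\<delta>} (\<lambda>y. (norm (g y))\<^sup>2)) + (LINT y:{\<delta><..}|lebesgue. norm (f y)) + norm (F \<delta>) + norm (F1 \<delta>)"
  have A1: "0 \<le> integral {0..\<delta>} (\<lambda>y. (norm (g y))\<^sup>2)"
    by (rule integral_nonneg) (use set_lebesgue_integral_eq_integral(1)[OF g(2)] in auto)
  have A2: "0 \<le> (LINT y:{\<delta><..}|lebesgue. norm (f y))"
    unfolding set_lebesgue_integral_def by (rule Bochner_Integration.integral_nonneg) auto
  have "transform_expansion (half_line_fourier f) c d \<delta> A N W"
    unfolding transform_expansion_def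
  proof (intro conjI allI impI)
    show "N holomorphic_on {\<kappa>. Im \<kappa> < 0}" unfolding N_def J_def
      by (intro holomorphic_intros HK_transform_entire g) auto
    have "\<Psi> holomorphic_on {\<kappa>. Im \<kappa> < 0}" unfolding \<Psi>_def
      by (rule transform_holomorphic[OF fsub(1)]) (use \<delta> in auto)
    then show "W holomorphic_on {\<kappa>. Im \<kappa> < 0}" unfolding W_def
      by (intro holomorphic_intros) auto
    show "A \<ge> 0" using A1 A2 by (simp add: A_def)
    fix \<kappa> :: complex assume \<kappa>: "Im \<kappa> < 0"
    then have \<kappa>0: "\<kappa> \<noteq> 0" by auto
    have "half_line_fourier f \<kappa> = (LINT y:{0<..\<delta>} \<union> {\<delta><..}|lebesgue. exp (- \<i> * \<kappa> * of_real y) * f y)"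
    proof -
      have "{0<..} = {0<..\<delta>} \<union> {\<delta><..}" using \<delta> by auto
      then show ?thesis by (simp add: half_line_fourier_def)
    qed
    also have "\<dots> = (LINT y:{0<..\<delta>}|lebesgue. exp (- \<i> * \<kappa> * of_real y) * f y) + \<Psi> \<kappa>"
      unfolding \<Psi>_def by (intro set_integral_Un set_integrable_transform fsub) (use \<kappa> \<delta> in auto)
    also have "(LINT y:{0<..\<delta>}|lebesgue. exp (- \<i> * \<kappa> * of_real y) * f y) = integral {0..\<delta>} (\<lambda>y. exp (- \<i> * \<kappa> * of_real y) * F y)"
    proof (rule set_integral_eq_HK_Ioo)
      show "set_integrable lebesgue {0..\<delta>} (\<lambda>y. exp (- \<i> * \<kappa> * of_real y) * F y)"
        by (intro absolutely_integrable_continuous_real continuous_intros cF)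
      show "AE y in lebesgue. y \<in> {0<..<\<delta>} \<longrightarrow> exp (- \<i> * \<kappa> * of_real y) * f y = exp (- \<i> * \<kappa> * of_real y) * F y"
        using ae by eventually_elim (auto simp: F_def F1_def[abs_def])
      have "set_integrable lebesgue {0<..\<delta>} (\<lambda>y. exp (- \<i> * \<kappa> * of_real y) * f y)"
        by (rule set_integrable_transform[OF fsub(2)]) (use \<kappa> in auto)
      then show "set_borel_measurable lebesgue {0<..\<delta>} (\<lambda>y. exp (- \<i> * \<kappa> * of_real y) * f y)"
        by (auto simp: set_integrable_def set_borel_measurable_def)
    qed auto
    also have "\<dots> = c / (\<i> * \<kappa>) + d / (\<i> * \<kappa>)\<^sup>2 - exp (- \<i> * \<kappa> * of_real \<delta>) * (F \<delta> / (\<i> * \<kappa>) + F1 \<delta> / (\<i> * \<kappa>)\<^sup>2) + N \<kappa>"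
      unfolding F_def F1_def[abs_def] N_def J_def using \<delta> by (intro transform_by_parts_twice \<kappa>0 g) auto
    finally show "half_line_fourier f \<kappa> = c / (\<i> * \<kappa>) + d / (\<i> * \<kappa>)\<^sup>2 + N \<kappa> + W \<kappa>"
      by (simp add: W_def)
    have "norm (J \<kappa>) \<le> A / sqrt (- Im \<kappa>)"
    proof -
      have "norm (J \<kappa>) \<le> (1 + integral {0..\<delta>} (\<lambda>y. (norm (g y))\<^sup>2)) / sqrt (- Im \<kappa>)"
        unfolding J_def using \<delta> by (intro norm_transform_L2_le g \<kappa>) auto
      also have "\<dots> \<le> A / sqrt (- Im \<kappa>)" using \<kappa> A2 by (intro divide_right_mono) (auto simp: A_def)
      finally show ?thesis .
    qed
    then have "norm (J \<kappa>) / (norm \<kappa>)\<^sup>2 \<le> A / sqrt (- Im \<kappa>) / (norm \<kappa>)\<^sup>2" by (rule divide_right_mono) simp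
    then show "norm (N \<kappa>) \<le> A / (sqrt (- Im \<kappa>) * (norm \<kappa>)\<^sup>2)"
      by (simp add: N_def norm_divide norm_mult norm_power)
    assume \<kappa>1: "norm \<kappa> \<ge> 1"
    have n: "norm (F \<delta> / (\<i> * \<kappa>)) \<le> norm (F \<delta>)" "norm (F1 \<delta> / (\<i> * \<kappa>)\<^sup>2) \<le> norm (F1 \<delta>)"
    proof -
      have "norm (F \<delta>) / norm \<kappa> \<le> norm (F \<delta>) / 1" using \<kappa>1 by (intro divide_left_mono) auto
      then show "norm (F \<delta> / (\<i> * \<kappa>)) \<le> norm (F \<delta>)" by (simp add: norm_divide norm_mult)
      have "norm (F1 \<delta>) / (norm \<kappa>)\<^sup>2 \<le> norm (F1 \<delta>) / 1"
        using \<kappa>1 one_le_power[OF \<kappa>1, of 2] by (intro divide_left_mono) auto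
      then show "norm (F1 \<delta> / (\<i> * \<kappa>)\<^sup>2) \<le> norm (F1 \<delta>)" by (simp add: norm_divide norm_mult norm_power)
    qed
    have "norm (W \<kappa>) \<le> norm (\<Psi> \<kappa>) + norm (exp (- \<i> * \<kappa> * of_real \<delta>) * (F \<delta> / (\<i> * \<kappa>) + F1 \<delta> / (\<i> * \<kappa>)\<^sup>2))"
      unfolding W_def by (rule norm_triangle_ineq4)
    also have "\<dots> \<le> exp (Im \<kappa> * \<delta>) * (LINT y:{\<delta><..}|lebesgue. norm (f y)) + exp (Im \<kappa> * \<delta>) * (norm (F \<delta>) + norm (F1 \<delta>))"
    proof (rule add_mono)
      show "norm (\<Psi> \<kappa>) \<le> exp (Im \<kappa> * \<delta>) * (LINT y:{\<delta><..}|lebesgue. norm (f y))"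
        unfolding \<Psi>_def by (rule norm_transform_le[OF fsub(1)]) (use \<delta> \<kappa> in auto)
      have "norm (F \<delta> / (\<i> * \<kappa>) + F1 \<delta> / (\<i> * \<kappa>)\<^sup>2) \<le> norm (F \<delta>) + norm (F1 \<delta>)"
        by (rule order_trans[OF norm_triangle_ineq add_mono[OF n]])
      then show "norm (exp (- \<i> * \<kappa> * of_real \<delta>) * (F \<delta> / (\<i> * \<kappa>) + F1 \<delta> / (\<i> * \<kappa>)\<^sup>2)) \<le> exp (Im \<kappa> * \<delta>) * (norm (F \<delta>) + norm (F1 \<delta>))"
        unfolding norm_mult norm_exp_transform by (intro mult_left_mono) auto
    qed
    also have "\<dots> = exp (\<delta> * Im \<kappa>) * ((LINT y:{\<delta><..}|lebesgue. norm (f y)) + norm (F \<delta>) + norm (F1 \<delta>))"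
      by (simp add: algebra_simps)
    also have "\<dots> \<le> exp (\<delta> * Im \<kappa>) * A"
      using A1 by (intro mult_left_mono) (auto simp: A_def)
    finally show "norm (W \<kappa>) \<le> A * exp (\<delta> * Im \<kappa>)" by (simp add: mult.commute)
  qed
  then show ?thesis by (rule that)
qed

lemma osc_time_kernel:
  "osc x t k * exp (- \<i> * (- omega k) * of_real s) = osc x (t - s) k"
  by (simp add: osc_def exp_add[symmetric] algebra_simps)

lemma osc_0: "osc x 0 k = exp (\<i> * k * of_real x)"
  by (simp add: osc_def)

text \<open>
  The factor \<open>osc x t k\<close> has to be moved under the integral: only \<open>osc x (t - s) k\<close> with \<open>0 \<le> s \<le> t\<close> is bounded.
\<close>

lemma norm_osc_time_transform_le:
  fixes g :: "real \<Rightarrow> complex"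
  assumes g: "set_integrable lebesgue {0..b} g" and t: "0 < t" "t \<le> b"
    and x: "x \<ge> 0" and k: "Im k \<ge> 0" "t * Im (k ^ 3) \<le> 1"
  shows "norm (osc x t k * integral {0..t} (\<lambda>s. exp (- \<i> * (- omega k) * of_real s) * g s)) \<le> exp 1 * integral {0..t} (\<lambda>s. norm (g s))"
proof -
  have gt: "set_integrable lebesgue {0..t} g" using t by (intro set_integrable_subset[OF g]) auto
  have "norm (integral {0..t} (\<lambda>s. osc x t k * (exp (- \<i> * (- omega k) * of_real s) * g s))) \<le> integral {0..t} (\<lambda>s. exp 1 * norm (g s))"
  proof (rule integral_norm_bound_integral)
    show "(\<lambda>s. osc x t k * (exp (- \<i> * (- omega k) * of_real s) * g s)) integrable_on {0..t}"
      by (intro integrable_on_mult_right set_lebesgue_integral_eq_integral(1) set_integrable_exp_transform_Icc gt)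
    show "(\<lambda>s. exp 1 * norm (g s)) integrable_on {0..t}"
      by (intro integrable_on_mult_right set_lebesgue_integral_eq_integral(1) set_integrable_norm gt)
    fix s assume s: "s \<in> {0..t}"
    have "norm (osc x t k * (exp (- \<i> * (- omega k) * of_real s) * g s)) = norm (osc x (t - s) k) * norm (g s)"
      by (simp only: mult.assoc[symmetric] osc_time_kernel norm_mult)
    also have "\<dots> \<le> exp 1 * norm (g s)"
      using s x k by (intro mult_right_mono norm_osc_le[of _ _ _ t]) auto
    finally show "norm (osc x t k * (exp (- \<i> * (- omega k) * of_real s) * g s)) \<le> exp 1 * norm (g s)" .
  qed
  then show ?thesis by simp
qed

lemma time_transform_eq_HK:
  fixes f F :: "real \<Rightarrow> complex"
  assumes F: "continuous_on {0..t} F" and ae: "AE s in lebesgue. s \<in> {0<..<t} \<longrightarrow> f s = F s"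
    and f: "set_borel_measurable lebesgue {0<..<t} f"
  shows "time_transform f \<kappa> t = integral {0..t} (\<lambda>s. exp (- \<i> * \<kappa> * of_real s) * F s)"
  unfolding time_transform_def
proof (rule set_integral_eq_HK_Ioo)
  show "set_integrable lebesgue {0..t} (\<lambda>s. exp (- \<i> * \<kappa> * of_real s) * F s)"
    by (intro absolutely_integrable_continuous_real continuous_intros F)
  show "AE s in lebesgue. s \<in> {0<..<t} \<longrightarrow> exp (- \<i> * \<kappa> * of_real s) * f s = exp (- \<i> * \<kappa> * of_real s) * F s"
    using ae by eventually_elim auto
  have m: "(\<lambda>s. exp (- \<i> * \<kappa> * of_real s)) \<in> borel_measurable lebesgue"
    by (intro measurable_completion) (auto intro!: borel_measurable_continuous_onI continuous_intros)
  have "(\<lambda>s. exp (- \<i> * \<kappa> * of_real s) * (indicat_real {0<..<t} s *\<^sub>R f s)) \<in> borel_measurable lebesgue"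
    using f by (intro borel_measurable_times m) (simp add: set_borel_measurable_def)
  then show "set_borel_measurable lebesgue {0<..<t} (\<lambda>s. exp (- \<i> * \<kappa> * of_real s) * f s)"
    by (simp only: set_borel_measurable_def mult_scaleR_right)
qed auto

lemma HK_time_transform_holomorphic:
  fixes F :: "real \<Rightarrow> complex"
  assumes "continuous_on {0..t} F"
  shows "(\<lambda>k. integral {0..t} (\<lambda>s. exp (- \<i> * (- omega k) * of_real s) * F s)) holomorphic_on A"
proof -
  have "(\<lambda>\<kappa>. integral {0..t} (\<lambda>s. exp (- \<i> * \<kappa> * of_real s) * F s)) \<circ> (\<lambda>k. - omega k) holomorphic_on A"
    by (rule holomorphic_on_compose_gen[OF _ HK_transform_entire[OF absolutely_integrable_continuous_real[OF assms], of UNIV]])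
      (auto simp: omega_def intro!: holomorphic_intros)
  then show ?thesis by (simp add: o_def)
qed

text \<open>
  For \<open>g\<^sub>0\<close> the factor \<open>k\<^sup>2\<close> is divided by \<open>k\<^sup>3\<close> in each integration by parts: one would leave \<open>1 / k\<close>, which is not
  absolutely integrable, and two give \<open>1 / k\<^sup>4\<close>.  For \<open>g\<^sub>1\<close>, below, a single one gives \<open>1 / k\<^sup>2\<close>, and the smallness
  \<open>sqrt t\<close> comes from the \<open>L\<^sup>2\<close> norm of the derivative on \<open>(0, t)\<close>.
\<close>

lemma osc_time_transform_H2:
  fixes f g :: "real \<Rightarrow> complex" and c d :: complex
  assumes b: "b > 0" and g: "set_integrable lebesgue {0..b} g"
    and ae: "AE x in lebesgue. x \<in> {0<..<b} \<longrightarrow> f x = c + integral {0..x} (\<lambda>s. d + integral {0..s} g)"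
    and fm: "set_borel_measurable lebesgue {0<..<b} f"
  obtains A where "A \<ge> 0" "\<And>x t. 0 < x \<Longrightarrow> 0 < t \<Longrightarrow> t < b \<Longrightarrow> boundary_expansion f 2 1 c (\<lambda>r. A / r ^ 4) x t"
proof -
  define F1 where "F1 s = d + integral {0..s} g" for s
  define F where "F x = c + integral {0..x} F1" for x
  have cF1: "continuous_on {0..b} F1" unfolding F1_def
    by (intro continuous_intros indefinite_integral_continuous_1 set_lebesgue_integral_eq_integral(1)[OF g])
  have cF: "continuous_on {0..b} F" unfolding F_def
    by (intro continuous_intros indefinite_integral_continuous_1 integrable_continuous_real cF1)
  define G where "G = integral {0..b} (\<lambda>s. norm (g s))"
  have gn: "(\<lambda>s. norm (g s)) integrable_on {0..b}"
    by (intro set_lebesgue_integral_eq_integral(1) set_integrable_norm g)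
  have Gt: "integral {0..t} (\<lambda>s. norm (g s)) \<le> G" "norm (integral {0..t} g) \<le> G" if "0 < t" "t < b" for t
  proof -
    have gt: "set_integrable lebesgue {0..t} g" using that by (intro set_integrable_subset[OF g]) auto
    have gnt: "(\<lambda>s. norm (g s)) integrable_on {0..t}"
      by (intro set_lebesgue_integral_eq_integral(1) set_integrable_norm gt)
    show 1: "integral {0..t} (\<lambda>s. norm (g s)) \<le> G" unfolding G_def
      by (rule integral_subset_le) (use that gn gnt in auto)
    show "norm (integral {0..t} g) \<le> G"
      by (rule order_trans[OF _ 1], rule integral_norm_bound_integral[OF set_lebesgue_integral_eq_integral(1)[OF gt] gnt]) auto
  qed
  have G0: "G \<ge> 0" unfolding G_def by (rule integral_nonneg[OF gn]) auto
  define A where "A = exp 1 * norm d + (norm d + G) + exp 1 * G"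
  show ?thesis
  proof
    show "A \<ge> 0" using G0 by (simp add: A_def)
    fix x t :: real assume x: "0 < x" and t: "0 < t" "t < b"
    define J where "J k = integral {0..t} (\<lambda>s. exp (- \<i> * (- omega k) * of_real s) * g s)" for k
    have cFt: "continuous_on {0..t} F" by (rule continuous_on_subset[OF cF]) (use t in auto)
    have tt: "time_transform f \<kappa> t = integral {0..t} (\<lambda>s. exp (- \<i> * \<kappa> * of_real s) * F s)" for \<kappa>
    proof (rule time_transform_eq_HK[OF cFt])
      show "AE s in lebesgue. s \<in> {0<..<t} \<longrightarrow> f s = F s"
        using ae by eventually_elim (use t in \<open>auto simp: F_def F1_def[abs_def]\<close>)
      show "set_borel_measurable lebesgue {0<..<t} f"
        by (rule set_borel_measurable_subset[OF fm]) (use t in auto)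
    qed
    define m where "m = \<i> * F t"
    define Z where "Z k = osc x t k * (k\<^sup>2 * time_transform f (- omega k) t) - \<i> * c * (osc x t k / k) + m * (exp (\<i> * k * of_real x) / k)" for k
    have holZ: "Z holomorphic_on - {0}"
      unfolding Z_def tt by (intro holomorphic_intros osc_holomorphic HK_time_transform_holomorphic cFt) auto
    have Zeq: "Z k = (- d * osc x t k + F1 t * exp (\<i> * k * of_real x) - osc x t k * J k) / k ^ 4" if k: "k \<noteq> 0" for k
    proof -
      define E where "E = osc x t k"
      define e where "e = exp (\<i> * k * of_real x)"
      have w0: "- omega k \<noteq> 0" using k by (simp add: omega_def)
      have gt: "set_integrable lebesgue {0..t} g" using t by (intro set_integrable_subset[OF g]) auto
      have "time_transform f (- omega k) t = c / (\<i> * (- omega k)) + d / (\<i> * (- omega k))\<^sup>2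
         - exp (- \<i> * (- omega k) * of_real t) * (F t / (\<i> * (- omega k)) + F1 t / (\<i> * (- omega k))\<^sup>2) + J k / (\<i> * (- omega k))\<^sup>2"
        unfolding tt F_def F1_def[abs_def] J_def using t by (intro transform_by_parts_twice w0 gt) auto
      moreover have "E * exp (- \<i> * (- omega k) * of_real t) = e"
        using osc_time_kernel[of x t k t] by (simp add: E_def e_def osc_0)
      ultimately have "E * time_transform f (- omega k) t = E * (c / (\<i> * (- omega k)) + d / (\<i> * (- omega k))\<^sup>2)
         - e * (F t / (\<i> * (- omega k)) + F1 t / (\<i> * (- omega k))\<^sup>2) + E * (J k / (\<i> * (- omega k))\<^sup>2)"
        by (simp only: distrib_left right_diff_distrib mult.assoc[symmetric])
      moreover have "z / (\<i> * (- omega k)) = \<i> * z / k ^ 3" for z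
        by (subst nonzero_divide_eq_eq) (use k in \<open>auto simp: omega_def mult_ac\<close>)
      moreover have "z / (\<i> * (- omega k))\<^sup>2 = - z / k ^ 6" for z
        by (simp add: omega_def power_mult_distrib power_mult[symmetric])
      ultimately have main: "E * time_transform f (- omega k) t = E * (\<i> * c / k ^ 3 + - d / k ^ 6)
         - e * (\<i> * F t / k ^ 3 + - F1 t / k ^ 6) + E * (- J k / k ^ 6)" by (simp only:)
      have "E * (k\<^sup>2 * time_transform f (- omega k) t) = k\<^sup>2 * (E * (\<i> * c / k ^ 3 + - d / k ^ 6)
         - e * (\<i> * F t / k ^ 3 + - F1 t / k ^ 6) + E * (- J k / k ^ 6))"
        by (simp only: main[symmetric]) simp
      also have "\<dots> = \<i> * c * (E / k) - m * (e / k) + (- d * E + F1 t * e - E * J k) / k ^ 4"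
        using k by (simp add: m_def field_simps eval_nat_numeral)
      finally show ?thesis by (simp add: Z_def E_def e_def)
    qed
    show "boundary_expansion f 2 1 c (\<lambda>r. A / r ^ 4) x t"
      unfolding boundary_expansion_def power_one_right
    proof (rule exI[of _ m], rule exI[of _ Z], intro conjI allI impI holZ)
      fix k :: complex assume k: "k \<noteq> 0"
      show "osc x t k * (k\<^sup>2 * time_transform f (- omega k) t) = \<i> * c * (osc x t k / k) - m * (exp (\<i> * k * of_real x) / k) + Z k"
        by (simp add: Z_def)
      assume I: "Im k \<ge> 0" "t * Im (k ^ 3) \<le> 1"
      have "norm (- d * osc x t k + F1 t * exp (\<i> * k * of_real x) - osc x t k * J k) \<le>
        norm (- d * osc x t k) + norm (F1 t * exp (\<i> * k * of_real x)) + norm (osc x t k * J k)"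
        by (intro norm_triangle_le_diff norm_triangle_le add_mono order_refl)
      also have "\<dots> \<le> exp 1 * norm d + (norm d + G) + exp 1 * G"
      proof (intro add_mono)
        have "norm (osc x t k) \<le> exp 1" using x t I by (intro norm_osc_le[of _ _ _ t]) auto
        then have "norm d * norm (osc x t k) \<le> norm d * exp 1" by (intro mult_left_mono) auto
        then show "norm (- d * osc x t k) \<le> exp 1 * norm d" by (simp add: norm_mult mult.commute)
        have "norm (F1 t) \<le> norm d + G" unfolding F1_def
          by (intro norm_triangle_le add_mono Gt t) simp
        moreover have "norm (exp (\<i> * k * of_real x)) \<le> 1" using x I by (simp add: norm_exp_eq_Re)
        ultimately have "norm (F1 t) * norm (exp (\<i> * k * of_real x)) \<le> (norm d + G) * 1" using G0 by (intro mult_mono) auto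
        then show "norm (F1 t * exp (\<i> * k * of_real x)) \<le> norm d + G" by (simp add: norm_mult)
        have "norm (osc x t k * J k) \<le> exp 1 * integral {0..t} (\<lambda>s. norm (g s))"
          unfolding J_def using x t I by (intro norm_osc_time_transform_le[OF g]) auto
        also have "\<dots> \<le> exp 1 * G" using Gt(1)[OF t] by (intro mult_left_mono) auto
        finally show "norm (osc x t k * J k) \<le> exp 1 * G" .
      qed
      finally show "norm (Z k) \<le> A / norm k ^ 4"
        unfolding Zeq[OF k] norm_divide norm_power A_def by (rule divide_right_mono) simp
    qed
  qed
qed

lemma osc_time_transform_H1:
  fixes f g :: "real \<Rightarrow> complex" and c :: complex
  assumes b: "b > 0" and g: "set_integrable lebesgue {0..b} g" "set_integrable lebesgue {0..b} (\<lambda>y. (norm (g y))\<^sup>2)"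
    and ae: "AE x in lebesgue. x \<in> {0<..<b} \<longrightarrow> f x = c + integral {0..x} g"
    and fm: "set_borel_measurable lebesgue {0<..<b} f"
  obtains A where "A \<ge> 0" "\<And>x t. 0 < x \<Longrightarrow> 0 < t \<Longrightarrow> t < b \<Longrightarrow> boundary_expansion f 1 2 c (\<lambda>r. A * sqrt t / r\<^sup>2) x t"
proof -
  define F where "F x = c + integral {0..x} g" for x
  have cF: "continuous_on {0..b} F" unfolding F_def
    by (intro continuous_intros indefinite_integral_continuous_1 set_lebesgue_integral_eq_integral(1)[OF g(1)])
  define A where "A = exp 1 * (1 + integral {0..b} (\<lambda>y. (norm (g y))\<^sup>2))"
  show ?thesis
  proof
    have "0 \<le> integral {0..b} (\<lambda>y. (norm (g y))\<^sup>2)"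
      by (rule integral_nonneg) (use set_lebesgue_integral_eq_integral(1)[OF g(2)] in auto)
    then show "A \<ge> 0" by (simp add: A_def)
    fix x t :: real assume x: "0 < x" and t: "0 < t" "t < b"
    define J where "J k = integral {0..t} (\<lambda>s. exp (- \<i> * (- omega k) * of_real s) * g s)" for k
    have cFt: "continuous_on {0..t} F" by (rule continuous_on_subset[OF cF]) (use t in auto)
    have tt: "time_transform f \<kappa> t = integral {0..t} (\<lambda>s. exp (- \<i> * \<kappa> * of_real s) * F s)" for \<kappa>
    proof (rule time_transform_eq_HK[OF cFt])
      show "AE s in lebesgue. s \<in> {0<..<t} \<longrightarrow> f s = F s"
        using ae by eventually_elim (use t in \<open>auto simp: F_def\<close>)
      show "set_borel_measurable lebesgue {0<..<t} f"
        by (rule set_borel_measurable_subset[OF fm]) (use t in auto)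
    qed
    define m where "m = \<i> * F t"
    define Z where "Z k = osc x t k * (k * time_transform f (- omega k) t) - \<i> * c * (osc x t k / k\<^sup>2) + m * (exp (\<i> * k * of_real x) / k\<^sup>2)" for k
    have holZ: "Z holomorphic_on - {0}"
      unfolding Z_def tt by (intro holomorphic_intros osc_holomorphic HK_time_transform_holomorphic cFt) auto
    have Zeq: "Z k = \<i> * (osc x t k * J k) / k\<^sup>2" if k: "k \<noteq> 0" for k
    proof -
      define E where "E = osc x t k"
      define e where "e = exp (\<i> * k * of_real x)"
      have w0: "- omega k \<noteq> 0" using k by (simp add: omega_def)
      have gt: "set_integrable lebesgue {0..t} g" using t by (intro set_integrable_subset[OF g(1)]) auto
      have "time_transform f (- omega k) t = c / (\<i> * (- omega k))
         - exp (- \<i> * (- omega k) * of_real t) * F t / (\<i> * (- omega k)) + J k / (\<i> * (- omega k))"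
        unfolding tt F_def J_def using t by (intro transform_by_parts w0 gt) auto
      moreover have "E * exp (- \<i> * (- omega k) * of_real t) = e"
        using osc_time_kernel[of x t k t] by (simp add: E_def e_def osc_0)
      ultimately have "E * time_transform f (- omega k) t = E * (c / (\<i> * (- omega k)))
         - e * F t / (\<i> * (- omega k)) + E * (J k / (\<i> * (- omega k)))"
        by (simp only: distrib_left right_diff_distrib mult.assoc[symmetric] times_divide_eq_right)
      moreover have "z / (\<i> * (- omega k)) = \<i> * z / k ^ 3" for z
        by (subst nonzero_divide_eq_eq) (use k in \<open>auto simp: omega_def mult_ac\<close>)
      ultimately have main: "E * time_transform f (- omega k) t = E * (\<i> * c / k ^ 3)
         - \<i> * (e * F t) / k ^ 3 + E * (\<i> * J k / k ^ 3)" by (simp only:)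
      have "E * (k * time_transform f (- omega k) t) = k * (E * (\<i> * c / k ^ 3)
         - \<i> * (e * F t) / k ^ 3 + E * (\<i> * J k / k ^ 3))"
        by (simp only: main[symmetric]) simp
      also have "\<dots> = \<i> * c * (E / k\<^sup>2) - m * (e / k\<^sup>2) + \<i> * (E * J k) / k\<^sup>2"
        using k by (simp add: m_def field_simps eval_nat_numeral)
      finally show ?thesis by (simp add: Z_def E_def e_def)
    qed
    show "boundary_expansion f 1 2 c (\<lambda>r. A * sqrt t / r\<^sup>2) x t"
      unfolding boundary_expansion_def power_one_right
    proof (rule exI[of _ m], rule exI[of _ Z], intro conjI allI impI holZ)
      fix k :: complex assume k: "k \<noteq> 0"
      show "osc x t k * (k * time_transform f (- omega k) t) = \<i> * c * (osc x t k / k\<^sup>2) - m * (exp (\<i> * k * of_real x) / k\<^sup>2) + Z k"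
        by (simp add: Z_def)
      assume I: "Im k \<ge> 0" "t * Im (k ^ 3) \<le> 1"
      have "norm (osc x t k * J k) \<le> exp 1 * integral {0..t} (\<lambda>s. norm (g s))"
        unfolding J_def using x t I by (intro norm_osc_time_transform_le[OF g(1)]) auto
      also have "\<dots> \<le> exp 1 * ((1 + integral {0..b} (\<lambda>y. (norm (g y))\<^sup>2)) * sqrt t)"
        using t by (intro mult_left_mono integral_norm_L2_le g) auto
      finally have "norm (\<i> * (osc x t k * J k)) \<le> A * sqrt t" by (simp add: A_def norm_mult)
      then show "norm (Z k) \<le> A * sqrt t / (norm k)\<^sup>2"
        unfolding Zeq[OF k] norm_divide norm_power by (rule divide_right_mono) simp
    qed
  qed
qed

section \<open>Remainder estimates and the local solution\<close>

lemma exp_neg_le_cubic: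
  fixes u :: real
  assumes "u > 0"
  shows "exp (- u) \<le> 27 / u ^ 3"
  using exp_neg_inverse_le[of u 1 3] assms by (simp add: power_divide)

text \<open>
  The four remainders at a point of modulus \<open>r \<ge> 1 / \<rho>\<close>.  Each power of \<open>1 / r\<close> beyond the second is traded for a
  power of \<open>\<rho>\<close>; what is left is integrable and, integrated from \<open>1 / \<rho>\<close> on, contributes another factor \<open>\<rho>\<close>.
\<close>

lemma sector_remainder_bound:
  fixes \<rho> t r \<delta> A A0 A1 B0 B1 :: real
  assumes \<rho>: "0 < \<rho>" "\<rho> \<le> 1" and t: "0 < t" "t \<le> \<rho> ^ 3" and r: "r \<ge> 1 / \<rho>" and \<delta>: "\<delta> > 0"
    and A: "A \<ge> 0" "A0 \<ge> 0" "A1 \<ge> 0" "B0 \<ge> 0" "B1 \<ge> 0"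
    and im: "im \<le> - r / 2"
  shows "exp 1 * (A / (sqrt (- im) * r\<^sup>2) + A * exp (\<delta> * im)) + B0 * (A0 / r ^ 4) + B1 * (A1 * sqrt t / r\<^sup>2)
    \<le> (exp 1 * (2 * A + 216 * A / \<delta> ^ 3) + B0 * A0 + B1 * A1) * sqrt \<rho> / r\<^sup>2"
proof -
  have r0: "r > 0" "r \<ge> 1" using \<rho> r by (auto intro: less_le_trans[of _ "1 / \<rho>"] order_trans[of _ "1 / \<rho>"])
  have inv: "1 / r \<le> \<rho>" using r \<rho> r0 by (simp add: field_simps)
  have sq: "\<rho> \<le> sqrt \<rho>" using \<rho> real_sqrt_le_mono[of "\<rho>\<^sup>2" \<rho>] by (simp add: power2_eq_square mult_left_le)
  have 1: "A / (sqrt (- im) * r\<^sup>2) \<le> (2 * A) * sqrt \<rho> / r\<^sup>2"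
  proof -
    have "1 / sqrt (- im) \<le> 2 * sqrt \<rho>"
    proof -
      have "1 / (- im) \<le> 1 / (r / 2)" using im r0 by (intro frac_le) auto
      also have "\<dots> \<le> 4 * \<rho>" using inv r0 by (simp add: field_simps)
      finally have "sqrt (1 / (- im)) \<le> sqrt (4 * \<rho>)" by (rule real_sqrt_le_mono)
      moreover have "sqrt (1 / (- im)) = 1 / sqrt (- im)" by (simp only: real_sqrt_divide real_sqrt_one)
      moreover have "sqrt (4 * \<rho>) = 2 * sqrt \<rho>" by (simp add: real_sqrt_mult)
      ultimately show ?thesis by (simp only:)
    qed
    then have "A / r\<^sup>2 * (1 / sqrt (- im)) \<le> A / r\<^sup>2 * (2 * sqrt \<rho>)" using A by (intro mult_left_mono) auto
    then show ?thesis by (simp add: mult_ac)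
  qed
  have 2: "A * exp (\<delta> * im) \<le> (216 * A / \<delta> ^ 3) * sqrt \<rho> / r\<^sup>2"
  proof -
    have "\<delta> * im \<le> \<delta> * (- r / 2)" using \<delta> im by (intro mult_left_mono) auto
    then have "exp (\<delta> * im) \<le> exp (- (\<delta> * r / 2))" by simp
    also have "\<dots> \<le> 27 / (\<delta> * r / 2) ^ 3" using \<delta> r0 by (intro exp_neg_le_cubic) auto
    also have "\<dots> = 216 / \<delta> ^ 3 * (1 / r) / r\<^sup>2" by (simp add: power_mult_distrib power_divide power2_eq_square power3_eq_cube)
    also have "\<dots> \<le> 216 / \<delta> ^ 3 * sqrt \<rho> / r\<^sup>2"
      using \<delta> inv sq by (intro divide_right_mono mult_left_mono) auto
    finally have "A * exp (\<delta> * im) \<le> A * (216 / \<delta> ^ 3 * sqrt \<rho> / r\<^sup>2)" using A by (intro mult_left_mono) auto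
    then show ?thesis by (simp add: mult_ac)
  qed
  have 3: "B0 * (A0 / r ^ 4) \<le> B0 * A0 * sqrt \<rho> / r\<^sup>2"
  proof -
    have "1 / r\<^sup>2 \<le> 1 / r" using r0 by (simp add: field_simps power2_eq_square)
    then have "1 / r\<^sup>2 \<le> sqrt \<rho>" using inv sq by linarith
    then have "B0 * A0 / r\<^sup>2 * (1 / r\<^sup>2) \<le> B0 * A0 / r\<^sup>2 * sqrt \<rho>" using A by (intro mult_left_mono) auto
    then show ?thesis by (simp add: eval_nat_numeral mult_ac)
  qed
  have 4: "B1 * (A1 * sqrt t / r\<^sup>2) \<le> B1 * A1 * sqrt \<rho> / r\<^sup>2"
  proof -
    have "\<rho> ^ 3 \<le> \<rho> ^ 1" using \<rho> by (intro power_decreasing) auto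
    then have "sqrt t \<le> sqrt \<rho>" using t by (intro real_sqrt_le_mono) auto
    then have "B1 * A1 * sqrt t / r\<^sup>2 \<le> B1 * A1 * sqrt \<rho> / r\<^sup>2" using A by (intro divide_right_mono mult_left_mono) auto
    then show ?thesis by (simp add: mult_ac)
  qed
  have "exp 1 * (A / (sqrt (- im) * r\<^sup>2) + A * exp (\<delta> * im)) \<le> exp 1 * ((2 * A) * sqrt \<rho> / r\<^sup>2 + (216 * A / \<delta> ^ 3) * sqrt \<rho> / r\<^sup>2)"
    using 1 2 by (intro mult_left_mono add_mono) auto
  with 3 4 show ?thesis by (simp add: add_divide_distrib algebra_simps)
qed

text \<open>
  The arc is moved to radius \<open>1 / \<rho>\<close>, where the time factor is still bounded because \<open>t \<le> \<rho>\<^sup>3\<close>.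
\<close>

lemma sector_solution_integral:
  fixes c d \<gamma>0 \<gamma>1 b0 b1 \<beta> :: complex and hq :: "complex \<Rightarrow> complex"
  assumes sec: "decaying_sector \<beta> \<theta>1 \<theta>2" and R: "R > 0"
    and x: "x > 0" and t: "t > 0" and \<rho>: "\<rho> \<le> 1" "x \<le> \<rho>" "t \<le> \<rho> ^ 3" and \<delta>: "\<delta> > 0"
    and expansion: "transform_expansion hq c d \<delta> A N W"
    and g0: "boundary_expansion g0 2 1 \<gamma>0 (\<lambda>r. A0 / r ^ 4) x t" and A0: "A0 \<ge> 0"
    and g1: "boundary_expansion g1 1 2 \<gamma>1 (\<lambda>r. A1 * sqrt t / r\<^sup>2) x t" and A1: "A1 \<ge> 0"
    and La: "has_improper_integral (sector_path \<theta>1 \<theta>2 R) (\<lambda>k. osc x t k / k) La"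
    and Lb: "has_improper_integral (sector_path \<theta>1 \<theta>2 R) (\<lambda>k. osc x t k / k\<^sup>2) Lb"
  shows "\<exists>e. has_improper_integral (sector_path \<theta>1 \<theta>2 R) (\<lambda>k. osc x t k * (hq (\<beta> * k) + b0 * k\<^sup>2 * time_transform g0 (- omega k) t - \<i> * b1 * k * time_transform g1 (- omega k) t))
      (c / (\<i> * \<beta>) * La - d / \<beta>\<^sup>2 * Lb + b0 * \<i> * \<gamma>0 * La + b1 * \<gamma>1 * Lb + e) \<and>
    norm e \<le> 4 * (exp 1 * (2 * A + 216 * A / \<delta> ^ 3) + norm b0 * A0 + norm b1 * A1) * (\<rho> * sqrt \<rho>)"
proof -
  have N: "N holomorphic_on {\<kappa>. Im \<kappa> < 0}" and W: "W holomorphic_on {\<kappa>. Im \<kappa> < 0}" and A: "A \<ge> 0"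
    and hq: "\<And>\<kappa>. Im \<kappa> < 0 \<Longrightarrow> hq \<kappa> = c / (\<i> * \<kappa>) + d / (\<i> * \<kappa>)\<^sup>2 + N \<kappa> + W \<kappa>"
    and Nb: "\<And>\<kappa>. Im \<kappa> < 0 \<Longrightarrow> norm (N \<kappa>) \<le> A / (sqrt (- Im \<kappa>) * (norm \<kappa>)\<^sup>2)"
    and Wb: "\<And>\<kappa>. Im \<kappa> < 0 \<Longrightarrow> norm \<kappa> \<ge> 1 \<Longrightarrow> norm (W \<kappa>) \<le> A * exp (\<delta> * Im \<kappa>)"
    using expansion unfolding transform_expansion_def by blast+
  obtain m0 Z0 where Z0: "Z0 holomorphic_on - {0}"
      "\<And>k. k \<noteq> 0 \<Longrightarrow> osc x t k * (k\<^sup>2 * time_transform g0 (- omega k) t) = \<i> * \<gamma>0 * (osc x t k / k) - m0 * (exp (\<i> * k * of_real x) / k) + Z0 k"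
      "\<And>k. k \<noteq> 0 \<Longrightarrow> Im k \<ge> 0 \<Longrightarrow> t * Im (k ^ 3) \<le> 1 \<Longrightarrow> norm (Z0 k) \<le> A0 / norm k ^ 4"
    using g0 unfolding boundary_expansion_def power_one_right by blast
  obtain m1 Z1 where Z1: "Z1 holomorphic_on - {0}"
      "\<And>k. k \<noteq> 0 \<Longrightarrow> osc x t k * (k * time_transform g1 (- omega k) t) = \<i> * \<gamma>1 * (osc x t k / k\<^sup>2) - m1 * (exp (\<i> * k * of_real x) / k\<^sup>2) + Z1 k"
      "\<And>k. k \<noteq> 0 \<Longrightarrow> Im k \<ge> 0 \<Longrightarrow> t * Im (k ^ 3) \<le> 1 \<Longrightarrow> norm (Z1 k) \<le> A1 * sqrt t / (norm k)\<^sup>2"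
    using g1 unfolding boundary_expansion_def power_one_right by blast
  define C where "C = exp 1 * (2 * A + 216 * A / \<delta> ^ 3) + norm b0 * A0 + norm b1 * A1"
  have C: "C \<ge> 0" using A A0 A1 \<delta> by (simp add: C_def)
  have \<rho>0: "\<rho> > 0" using x \<rho> by simp
  note \<beta>1 = decaying_sectorD(1,2)[OF sec]
  define H where "H = {k. Im (\<beta> * k) < 0}"
  define Z where "Z k = osc x t k * (N (\<beta> * k) + W (\<beta> * k)) + b0 * Z0 k - \<i> * b1 * Z1 k" for k
  have holZ: "Z holomorphic_on H"
  proof -
    have "N \<circ> (\<lambda>k. \<beta> * k) holomorphic_on H" "W \<circ> (\<lambda>k. \<beta> * k) holomorphic_on H"
      by (rule holomorphic_on_compose_gen[OF _ N] holomorphic_on_compose_gen[OF _ W];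
          auto simp: H_def intro!: holomorphic_intros)+
    moreover have "Z0 holomorphic_on H" "Z1 holomorphic_on H"
      by (rule holomorphic_on_subset[OF Z0(1)] holomorphic_on_subset[OF Z1(1)]; force simp: H_def)+
    ultimately show ?thesis unfolding Z_def o_def
      by (intro holomorphic_intros osc_holomorphic)
  qed
  have Zb: "norm (Z k) \<le> C * sqrt \<rho> / r\<^sup>2"
    if r: "r \<ge> 1 / \<rho>" and \<phi>: "\<phi> \<in> {\<theta>2..\<theta>1}" and k: "k = of_real r * cis \<phi>" and i3: "t * Im (k ^ 3) \<le> 1" for k r \<phi>
  proof -
    have r0: "r > 0" "r \<ge> 1" using \<rho>0 \<rho> r by (auto intro: less_le_trans[of _ "1 / \<rho>"] order_trans[of _ "1 / \<rho>"])
    have nk: "norm k = r" "norm (\<beta> * k) = r" using r0 \<beta>1 by (simp_all add: k norm_mult)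
    have k0: "k \<noteq> 0" using nk r0 by auto
    have imk: "Im k \<ge> 0" using decaying_sectorD(5)[OF sec \<phi>] r0 by (simp add: k)
    have im: "Im (\<beta> * k) \<le> - r / 2" using decaying_sectorD(6)[OF sec \<phi> r0(1)] by (simp add: k)
    then have im0: "Im (\<beta> * k) < 0" using r0 by linarith
    have o: "norm (osc x t k) \<le> exp 1" using x t imk i3 by (intro norm_osc_le[of _ _ _ t]) auto
    have "norm (Z k) \<le> norm (osc x t k * (N (\<beta> * k) + W (\<beta> * k))) + norm (b0 * Z0 k) + norm (\<i> * b1 * Z1 k)"
      unfolding Z_def by (intro norm_triangle_le_diff norm_triangle_le add_mono order_refl)
    also have "\<dots> \<le> exp 1 * (A / (sqrt (- Im (\<beta> * k)) * r\<^sup>2) + A * exp (\<delta> * Im (\<beta> * k))) + norm b0 * (A0 / r ^ 4) + norm b1 * (A1 * sqrt t / r\<^sup>2)"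
    proof (intro add_mono)
      have "norm (N (\<beta> * k) + W (\<beta> * k)) \<le> A / (sqrt (- Im (\<beta> * k)) * r\<^sup>2) + A * exp (\<delta> * Im (\<beta> * k))"
        using Nb[OF im0] Wb[OF im0] nk r0 by (intro norm_triangle_le add_mono) auto
      then show "norm (osc x t k * (N (\<beta> * k) + W (\<beta> * k))) \<le> exp 1 * (A / (sqrt (- Im (\<beta> * k)) * r\<^sup>2) + A * exp (\<delta> * Im (\<beta> * k)))"
        unfolding norm_mult using o by (intro mult_mono) auto
      show "norm (b0 * Z0 k) \<le> norm b0 * (A0 / r ^ 4)"
        unfolding norm_mult using Z0(3)[OF k0 imk i3] nk by (intro mult_left_mono) auto
      show "norm (\<i> * b1 * Z1 k) \<le> norm b1 * (A1 * sqrt t / r\<^sup>2)"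
      proof -
        have "norm b1 * norm (Z1 k) \<le> norm b1 * (A1 * sqrt t / r\<^sup>2)"
          using Z1(3)[OF k0 imk i3] nk by (intro mult_left_mono) auto
        then show ?thesis by (simp add: norm_mult)
      qed
    qed
    also have "\<dots> \<le> C * sqrt \<rho> / r\<^sup>2"
      unfolding C_def using \<rho>0 \<rho> t r \<delta> A A0 A1 im by (intro sector_remainder_bound) auto
    finally show ?thesis .
  qed
  obtain e0 where e0: "has_improper_integral (sector_path \<theta>1 \<theta>2 R) Z e0" "norm e0 \<le> 4 * (C * sqrt \<rho>) / (1 / \<rho>)"
  proof (rule sector_integral_exists[OF sec holZ[unfolded H_def] R, of "1 / \<rho>" "C * sqrt \<rho>"])
    fix \<phi> assume \<phi>: "\<phi> \<in> {\<theta>2..\<theta>1}"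
    have "t * ((1 / \<rho>) ^ 3 * sin (3 * \<phi>)) \<le> t * ((1 / \<rho>) ^ 3 * 1)"
      using t \<rho>0 by (intro mult_left_mono) auto
    also have "\<dots> \<le> 1" using \<rho> \<rho>0 by (simp add: power_divide)
    finally have "t * Im ((of_real (1 / \<rho>) * cis \<phi>) ^ 3) \<le> 1" by (simp only: Im_cube_cis)
    then show "norm (Z (of_real (1 / \<rho>) * cis \<phi>)) \<le> C * sqrt \<rho> / (1 / \<rho>)\<^sup>2"
      by (rule Zb[OF order_refl \<phi> refl])
  next
    fix r \<phi> assume r: "r \<ge> 1 / \<rho>" and \<phi>: "\<phi> \<in> {\<theta>1, \<theta>2}"
    then have s3: "sin (3 * \<phi>) = 0" and \<phi>': "\<phi> \<in> {\<theta>2..\<theta>1}" using decaying_sectorD(3,7,8)[OF sec] by auto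
    have "t * Im ((of_real r * cis \<phi>) ^ 3) \<le> 1" unfolding Im_cube_cis s3 by simp
    then show "norm (Z (of_real r * cis \<phi>)) \<le> C * sqrt \<rho> / r\<^sup>2"
      by (rule Zb[OF r \<phi>' refl])
  qed (use \<rho>0 C in auto)
  have "has_improper_integral (sector_path \<theta>1 \<theta>2 R)
     (\<lambda>k. (c / (\<i> * \<beta>) + b0 * \<i> * \<gamma>0) * (osc x t k / k) + (- d / \<beta>\<^sup>2 + b1 * \<gamma>1) * (osc x t k / k\<^sup>2)
        + (- b0 * m0) * (exp (\<i> * k * of_real x) / k) + (\<i> * b1 * m1) * (exp (\<i> * k * of_real x) / k\<^sup>2) + Z k)
     ((c / (\<i> * \<beta>) + b0 * \<i> * \<gamma>0) * La + (- d / \<beta>\<^sup>2 + b1 * \<gamma>1) * Lb + (- b0 * m0) * 0 + (\<i> * b1 * m1) * 0 + e0)"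
    by (intro has_improper_integral_add has_improper_integral_cmult La Lb e0(1) sector_integral_exp_vanishes[OF sec R x])
  then have "has_improper_integral (sector_path \<theta>1 \<theta>2 R) (\<lambda>k. osc x t k * (hq (\<beta> * k) + b0 * k\<^sup>2 * time_transform g0 (- omega k) t - \<i> * b1 * k * time_transform g1 (- omega k) t))
     ((c / (\<i> * \<beta>) + b0 * \<i> * \<gamma>0) * La + (- d / \<beta>\<^sup>2 + b1 * \<gamma>1) * Lb + (- b0 * m0) * 0 + (\<i> * b1 * m1) * 0 + e0)"
  proof (rule has_improper_integral_cong, intro eventually_mono[OF eventually_gt_at_top[of 0]] ballI)
    fix r k assume "(r::real) > 0" "k \<in> path_image (sector_path \<theta>1 \<theta>2 R r)"
    then have "Im (\<beta> * k) < 0" using path_image_sector_path_half_plane[OF sec R] by blast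
    then have k0: "k \<noteq> 0" and h: "hq (\<beta> * k) = c / (\<i> * (\<beta> * k)) + d / (\<i> * (\<beta> * k))\<^sup>2 + N (\<beta> * k) + W (\<beta> * k)"
      using hq by auto
    have "osc x t k * (hq (\<beta> * k) + b0 * k\<^sup>2 * time_transform g0 (- omega k) t - \<i> * b1 * k * time_transform g1 (- omega k) t) =
       osc x t k * hq (\<beta> * k) + b0 * (osc x t k * (k\<^sup>2 * time_transform g0 (- omega k) t)) - \<i> * b1 * (osc x t k * (k * time_transform g1 (- omega k) t))"
      by (simp add: algebra_simps)
    also have "\<dots> = osc x t k * (c / (\<i> * (\<beta> * k)) + d / (\<i> * (\<beta> * k))\<^sup>2 + N (\<beta> * k) + W (\<beta> * k))
        + b0 * (\<i> * \<gamma>0 * (osc x t k / k) - m0 * (exp (\<i> * k * of_real x) / k) + Z0 k)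
        - \<i> * b1 * (\<i> * \<gamma>1 * (osc x t k / k\<^sup>2) - m1 * (exp (\<i> * k * of_real x) / k\<^sup>2) + Z1 k)"
      unfolding h Z0(2)[OF k0] Z1(2)[OF k0] ..
    also have "\<dots> = (c / (\<i> * \<beta>) + b0 * \<i> * \<gamma>0) * (osc x t k / k) + (- d / \<beta>\<^sup>2 + b1 * \<gamma>1) * (osc x t k / k\<^sup>2)
        + (- b0 * m0) * (exp (\<i> * k * of_real x) / k) + (\<i> * b1 * m1) * (exp (\<i> * k * of_real x) / k\<^sup>2) + Z k"
    proof -
      have "osc x t k * (c / (\<i> * (\<beta> * k))) = c / (\<i> * \<beta>) * (osc x t k / k)" by (simp add: mult_ac)
      moreover have "osc x t k * (d / (\<i> * (\<beta> * k))\<^sup>2) = (- d / \<beta>\<^sup>2) * (osc x t k / k\<^sup>2)"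
        by (simp add: power_mult_distrib mult_ac)
      moreover have "\<i> * b1 * (\<i> * \<gamma>1 * (osc x t k / k\<^sup>2)) = - (b1 * \<gamma>1 * (osc x t k / k\<^sup>2))"
        by (simp add: mult.assoc[symmetric]) (simp add: mult_ac)
      ultimately show ?thesis unfolding Z_def by (simp only: distrib_left distrib_right right_diff_distrib) (simp add: algebra_simps)
    qed
    finally show "(c / (\<i> * \<beta>) + b0 * \<i> * \<gamma>0) * (osc x t k / k) + (- d / \<beta>\<^sup>2 + b1 * \<gamma>1) * (osc x t k / k\<^sup>2)
        + (- b0 * m0) * (exp (\<i> * k * of_real x) / k) + (\<i> * b1 * m1) * (exp (\<i> * k * of_real x) / k\<^sup>2) + Z k
       = osc x t k * (hq (\<beta> * k) + b0 * k\<^sup>2 * time_transform g0 (- omega k) t - \<i> * b1 * k * time_transform g1 (- omega k) t)" by simp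
  qed
  moreover have "(c / (\<i> * \<beta>) + b0 * \<i> * \<gamma>0) * La + (- d / \<beta>\<^sup>2 + b1 * \<gamma>1) * Lb + (- b0 * m0) * 0 + (\<i> * b1 * m1) * 0 + e0
     = c / (\<i> * \<beta>) * La - d / \<beta>\<^sup>2 * Lb + b0 * \<i> * \<gamma>0 * La + b1 * \<gamma>1 * Lb + e0"
    by (simp add: algebra_simps)
  moreover have "norm e0 \<le> 4 * C * (\<rho> * sqrt \<rho>)" using e0(2) by (simp add: mult_ac)
  ultimately show ?thesis unfolding C_def by (intro exI[of _ e0] conjI) (simp only:)
qed

lemma le_sqrt_of_le_one: "0 \<le> \<rho> \<Longrightarrow> \<rho> \<le> 1 \<Longrightarrow> \<rho> \<le> sqrt \<rho>"
  using real_sqrt_le_mono[of "\<rho>\<^sup>2" \<rho>] by (simp add: power2_eq_square mult_left_le)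

text \<open>
  The two remainders need different lines.  On \<open>Im k = - 1 / \<rho>\<close> the factor \<open>exp (i k x)\<close> is bounded and \<open>N\<close> is
  absolutely integrable.  There \<open>W\<close> has no decay along the line, and the Gaussian decay of the time factor is too weak
  when \<open>t\<close> is much smaller than \<open>x\<^sup>3\<close>; on the lower line \<open>Im k = - t^(-1/3)\<close> that decay is strong enough, and the
  growth of \<open>exp (i k x)\<close> is outweighed by \<open>exp (\<delta> Im k)\<close>, since \<open>x \<le> \<delta> / 2\<close>.
\<close>

lemma line_solution_integral:
  fixes c d :: complex and hq :: "complex \<Rightarrow> complex"
  assumes x: "x > 0" and a: "a > 0" "t = a ^ 3" and \<rho>: "\<rho> \<le> 1" "x \<le> \<rho>" "a \<le> \<rho>" and \<delta>: "\<delta> > 0" "x \<le> \<delta> / 2"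
    and expansion: "transform_expansion hq c d \<delta> A N W"
    and hqc: "continuous_on {\<kappa>. Im \<kappa> \<le> 0} hq" and hqh: "hq holomorphic_on {\<kappa>. Im \<kappa> < 0}"
    and hqb: "\<And>\<kappa>. Im \<kappa> \<le> 0 \<Longrightarrow> norm (hq \<kappa>) \<le> M"
    and La: "has_improper_integral (line_path (1 / \<rho>)) (\<lambda>k. osc x t k / k) La"
    and Lb: "has_improper_integral (line_path (1 / \<rho>)) (\<lambda>k. osc x t k / k\<^sup>2) Lb"
  shows "\<exists>e. has_improper_integral real_line (\<lambda>k. osc x t k * hq k) (c / \<i> * La - d * Lb + e) \<and>
    norm e \<le> (exp 2 * A * pi + 216 * A * exp 1 * pi / \<delta> ^ 3) * (\<rho> * sqrt \<rho>)"
proof -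
  have N: "N holomorphic_on {\<kappa>. Im \<kappa> < 0}" and W: "W holomorphic_on {\<kappa>. Im \<kappa> < 0}" and A: "A \<ge> 0"
    and hq: "\<And>\<kappa>. Im \<kappa> < 0 \<Longrightarrow> hq \<kappa> = c / (\<i> * \<kappa>) + d / (\<i> * \<kappa>)\<^sup>2 + N \<kappa> + W \<kappa>"
    and Nb: "\<And>\<kappa>. Im \<kappa> < 0 \<Longrightarrow> norm (N \<kappa>) \<le> A / (sqrt (- Im \<kappa>) * (norm \<kappa>)\<^sup>2)"
    and Wb: "\<And>\<kappa>. Im \<kappa> < 0 \<Longrightarrow> norm \<kappa> \<ge> 1 \<Longrightarrow> norm (W \<kappa>) \<le> A * exp (\<delta> * Im \<kappa>)"
    using expansion unfolding transform_expansion_def by blast+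
  have \<rho>0: "\<rho> > 0" using x \<rho> by simp
  have t: "t > 0" using a by simp
  have \<eta>: "1 / \<rho> > 0" "1 / \<rho> \<ge> 1" "1 / \<rho> \<le> 1 / a" "1 / a > 0" using \<rho>0 \<rho> a by (auto simp: field_simps)
  obtain e1 where e1: "has_improper_integral (line_path (1 / \<rho>)) (\<lambda>k. osc x t k * N k) e1"
      "norm e1 \<le> exp 2 * (A * sqrt \<rho>) * pi / (1 / \<rho>)"
  proof (rule line_integral_exists[of "\<lambda>k. osc x t k * N k" "1 / \<rho>" "exp 2 * (A * sqrt \<rho>)"])
    show "(\<lambda>k. osc x t k * N k) holomorphic_on {k. Im k < 0}" by (intro holomorphic_intros osc_holomorphic N)
    fix k assume k: "Im k = - (1 / \<rho>)"
    have kc: "k = Complex (Re k) (- (1 / \<rho>))" using k by (simp add: complex_eq_iff)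
    have "norm (osc x t k) \<le> exp (x * (1 / \<rho>) + t * (1 / \<rho>) ^ 3) * exp (- 3 * t * (Re k)\<^sup>2 * (1 / \<rho>))"
      using norm_osc_vertical[of x t "1 / \<rho>" "1 / \<rho>" "Re k"] x t \<eta> kc[symmetric] by simp
    also have "\<dots> \<le> exp 2 * 1"
    proof (intro mult_mono)
      have "t \<le> \<rho> ^ 3" using a \<rho> by (auto intro: power_mono)
      then have "x * (1 / \<rho>) \<le> 1" "t * (1 / \<rho>) ^ 3 \<le> 1" using \<rho> \<rho>0 by (auto simp: power_divide)
      then have "x * (1 / \<rho>) + t * (1 / \<rho>) ^ 3 \<le> 2" by linarith
      then show "exp (x * (1 / \<rho>) + t * (1 / \<rho>) ^ 3) \<le> exp 2" by (simp only: exp_le_cancel_iff)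
      show "exp (- 3 * t * (Re k)\<^sup>2 * (1 / \<rho>)) \<le> 1" using t \<rho>0 by simp
    qed auto
    finally have o: "norm (osc x t k) \<le> exp 2" by simp
    have "Im k < 0" using k \<rho>0 by simp
    from Nb[OF this] have "norm (N k) \<le> A / (sqrt (1 / \<rho>) * (norm k)\<^sup>2)" using k by simp
    also have "\<dots> = A * sqrt \<rho> / (norm k)\<^sup>2" by (simp add: real_sqrt_divide)
    finally have n: "norm (N k) \<le> A * sqrt \<rho> / (norm k)\<^sup>2" .
    have "norm (osc x t k) * norm (N k) \<le> exp 2 * (A * sqrt \<rho> / (norm k)\<^sup>2)"
      by (intro mult_mono o n) auto
    then show "norm (osc x t k * N k) \<le> exp 2 * (A * sqrt \<rho>) / (norm k)\<^sup>2"
      by (simp add: norm_mult)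
  qed (use \<eta> A \<rho>0 in auto)
  obtain e2 where e2: "has_improper_integral (line_path (1 / a)) (\<lambda>k. osc x t k * W k) e2"
      "norm e2 \<le> (216 * A * exp 1 / \<delta> ^ 3 * a) * pi / (1 / a)"
  proof (rule line_integral_exists[of "\<lambda>k. osc x t k * W k" "1 / a" "216 * A * exp 1 / \<delta> ^ 3 * a"])
    show "(\<lambda>k. osc x t k * W k) holomorphic_on {k. Im k < 0}" by (intro holomorphic_intros osc_holomorphic W)
    fix k assume k: "Im k = - (1 / a)"
    have kc: "k = Complex (Re k) (- (1 / a))" using k by (simp add: complex_eq_iff)
    have t3: "t * (1 / a) ^ 3 = 1" using a by (simp add: power_divide)
    have a1: "1 / a \<ge> 1" using \<eta> by linarith
    have nk: "(norm k)\<^sup>2 = (Re k)\<^sup>2 + 1 / a\<^sup>2" using k by (simp add: cmod_power2 power_divide)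
    have "norm (osc x t k) \<le> exp (x * (1 / a) + 1) * exp (- 3 * t * (Re k)\<^sup>2 * (1 / a))"
      using norm_osc_vertical[of x t "1 / a" "1 / a" "Re k"] x t \<eta> kc[symmetric] t3 by simp
    also have "exp (- 3 * t * (Re k)\<^sup>2 * (1 / a)) \<le> 1 / a\<^sup>2 / (norm k)\<^sup>2"
    proof -
      \<comment> \<open>The Gaussian is weakened to a Lorentzian, so that the bound has the form \<open>B / |k|\<^sup>2\<close> as for \<open>N\<close>.\<close>
      define u where "u = a\<^sup>2 * (Re k)\<^sup>2"
      have u: "u \<ge> 0" by (simp add: u_def)
      have "3 * t * (Re k)\<^sup>2 * (1 / a) = 3 * u" using a by (simp add: u_def power2_eq_square power3_eq_cube)
      then have "exp (- 3 * t * (Re k)\<^sup>2 * (1 / a)) = exp (- (3 * u))" by simp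
      also have "\<dots> \<le> 1 / (1 + u)"
      proof -
        have "1 + u \<le> exp (3 * u)" using exp_ge_add_one_self[of "3 * u"] u by linarith
        then show ?thesis using u by (simp add: exp_minus field_simps)
      qed
      also have "\<dots> = 1 / a\<^sup>2 / (norm k)\<^sup>2" unfolding nk u_def using a by (simp add: field_simps)
      finally show ?thesis .
    qed
    finally have o: "norm (osc x t k) \<le> exp (x * (1 / a) + 1) * (1 / a\<^sup>2 / (norm k)\<^sup>2)" by simp
    have "Im k < 0" using k a by simp
    moreover have "norm k \<ge> 1"
    proof -
      have "1 / a \<le> norm k" using abs_Im_le_cmod[of k] k a by simp
      then show ?thesis using a1 by linarith
    qed
    ultimately have w: "norm (W k) \<le> A * exp (- (\<delta> / a))" using Wb[of k] k by simp
    have ex: "exp (x * (1 / a) + 1) * exp (- (\<delta> / a)) \<le> exp 1 * (216 * a ^ 3 / \<delta> ^ 3)"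
    proof -
      have "x / a \<le> \<delta> / 2 / a" using \<delta> a by (intro divide_right_mono) auto
      then have "x * (1 / a) + 1 + - (\<delta> / a) \<le> 1 + - (\<delta> / (2 * a))" by (simp add: field_simps)
      then have "exp (x * (1 / a) + 1) * exp (- (\<delta> / a)) \<le> exp 1 * exp (- (\<delta> / (2 * a)))"
        by (simp only: exp_add[symmetric] exp_le_cancel_iff)
      also have "\<dots> \<le> exp 1 * (27 / (\<delta> / (2 * a)) ^ 3)"
        using \<delta> a by (intro mult_left_mono exp_neg_le_cubic) auto
      also have "\<dots> = exp 1 * (216 * a ^ 3 / \<delta> ^ 3)" by (simp add: power_divide power_mult_distrib)
      finally show ?thesis .
    qed
    have "norm (osc x t k) * norm (W k) \<le> exp (x * (1 / a) + 1) * (1 / a\<^sup>2 / (norm k)\<^sup>2) * (A * exp (- (\<delta> / a)))"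
      by (intro mult_mono o w) auto
    also have "\<dots> = (A / a\<^sup>2 / (norm k)\<^sup>2) * (exp (x * (1 / a) + 1) * exp (- (\<delta> / a)))" by (simp add: mult_ac)
    also have "\<dots> \<le> (A / a\<^sup>2 / (norm k)\<^sup>2) * (exp 1 * (216 * a ^ 3 / \<delta> ^ 3))" using A by (intro mult_left_mono ex) auto
    also have "\<dots> = 216 * A * exp 1 / \<delta> ^ 3 * a / (norm k)\<^sup>2" using a by (simp add: power2_eq_square power3_eq_cube mult_ac)
    finally show "norm (osc x t k * W k) \<le> 216 * A * exp 1 / \<delta> ^ 3 * a / (norm k)\<^sup>2" by (simp only: norm_mult)
  qed (use \<eta> A a \<delta> in auto)
  have e2': "has_improper_integral (line_path (1 / \<rho>)) (\<lambda>k. osc x t k * W k) e2"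
  proof (rule line_integral_shift[where M=A])
    have sub: "{k. - (1 / a) \<le> Im k \<and> Im k \<le> - (1 / \<rho>)} \<subseteq> {k. Im k < 0}"
    proof
      fix k assume "k \<in> {k. - (1 / a) \<le> Im k \<and> Im k \<le> - (1 / \<rho>)}"
      then have "Im k \<le> - (1 / \<rho>)" by blast
      then have "Im k < 0" using \<eta>(1) by linarith
      then show "k \<in> {k. Im k < 0}" by blast
    qed
    show "continuous_on {k. - (1 / a) \<le> Im k \<and> Im k \<le> - (1 / \<rho>)} W"
      by (rule continuous_on_subset[OF holomorphic_on_imp_continuous_on[OF W] sub])
    show "W holomorphic_on {k. - (1 / a) < Im k \<and> Im k < - (1 / \<rho>)}"
      by (rule holomorphic_on_subset[OF W subset_trans[OF _ sub]]) auto
    fix k assume k: "- (1 / a) \<le> Im k" "Im k \<le> - (1 / \<rho>)"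
    then have "Im k < 0" "norm k \<ge> 1" using \<eta> abs_Im_le_cmod[of k] by linarith+
    from Wb[OF this] have "norm (W k) \<le> A * exp (\<delta> * Im k)" .
    also have "\<dots> \<le> A * 1" using A \<delta> \<open>Im k < 0\<close> by (intro mult_left_mono) (auto simp: mult_nonneg_nonpos)
    finally show "norm (W k) \<le> A" by simp
  qed (use \<eta> x t e2 in auto)
  have "has_improper_integral (line_path (1 / \<rho>)) (\<lambda>k. c / \<i> * (osc x t k / k) + (- d) * (osc x t k / k\<^sup>2) + osc x t k * N k + osc x t k * W k)
     (c / \<i> * La + (- d) * Lb + e1 + e2)"
    by (intro has_improper_integral_add has_improper_integral_cmult La Lb e1 e2')
  then have "has_improper_integral (line_path (1 / \<rho>)) (\<lambda>k. osc x t k * hq k) (c / \<i> * La + (- d) * Lb + e1 + e2)"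
  proof (rule has_improper_integral_cong, intro always_eventually allI ballI)
    fix r k assume "k \<in> path_image (line_path (1 / \<rho>) r)"
    then have "Im k < 0" using path_image_line_path \<rho>0 by fastforce
    from hq[OF this] have "hq k = c / \<i> * inverse k + - d * inverse (k\<^sup>2) + N k + W k"
      by (simp add: power_mult_distrib divide_inverse mult_ac)
    then show "c / \<i> * (osc x t k / k) + (- d) * (osc x t k / k\<^sup>2) + osc x t k * N k + osc x t k * W k = osc x t k * hq k"
      by (simp only: distrib_left divide_inverse mult_ac)
  qed
  then have "has_improper_integral real_line (\<lambda>k. osc x t k * hq k) (c / \<i> * La + (- d) * Lb + e1 + e2)"
    unfolding real_line_eq
  proof (rule line_integral_shift[rotated -1, where M=M])
    show "continuous_on {k. - (1 / \<rho>) \<le> Im k \<and> Im k \<le> - 0} hq" by (rule continuous_on_subset[OF hqc]) auto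
    show "hq holomorphic_on {k. - (1 / \<rho>) < Im k \<and> Im k < - 0}" by (rule holomorphic_on_subset[OF hqh]) auto
  qed (use \<eta> x t hqb in auto)
  moreover have "norm (e1 + e2) \<le> (exp 2 * A * pi + 216 * A * exp 1 * pi / \<delta> ^ 3) * (\<rho> * sqrt \<rho>)"
  proof -
    have "norm e1 \<le> exp 2 * A * pi * (\<rho> * sqrt \<rho>)" using e1(2) by (simp add: mult_ac)
    moreover have "norm e2 \<le> 216 * A * exp 1 * pi / \<delta> ^ 3 * (\<rho> * sqrt \<rho>)"
    proof -
      have "norm e2 \<le> 216 * A * exp 1 * pi / \<delta> ^ 3 * (a * a)" using e2(2) by (simp add: mult_ac)
      also have "\<dots> \<le> 216 * A * exp 1 * pi / \<delta> ^ 3 * (\<rho> * sqrt \<rho>)"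
        using A \<delta> a \<rho> \<rho>0 le_sqrt_of_le_one[of \<rho>] by (intro mult_left_mono mult_mono) auto
      finally show ?thesis .
    qed
    ultimately show ?thesis using norm_triangle_ineq[of e1 e2] by (simp add: distrib_right)
  qed
  ultimately show ?thesis by (intro exI[of _ "e1 + e2"]) (simp add: algebra_simps)
qed

lemma half_line_fourier_props:
  assumes f: "set_integrable lebesgue {0<..} f"
  shows "continuous_on {\<kappa>. Im \<kappa> \<le> 0} (half_line_fourier f)" "half_line_fourier f holomorphic_on {\<kappa>. Im \<kappa> < 0}"
    "Im \<kappa> \<le> 0 \<Longrightarrow> norm (half_line_fourier f \<kappa>) \<le> (LINT y:{0<..}|lebesgue. norm (f y))"
proof -
  show "continuous_on {\<kappa>. Im \<kappa> \<le> 0} (half_line_fourier f)"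
    unfolding half_line_fourier_def[abs_def] by (rule transform_continuous[OF f]) auto
  show "half_line_fourier f holomorphic_on {\<kappa>. Im \<kappa> < 0}"
    unfolding half_line_fourier_def[abs_def] by (rule transform_holomorphic[OF f]) auto
  assume "Im \<kappa> \<le> 0"
  then show "norm (half_line_fourier f \<kappa>) \<le> (LINT y:{0<..}|lebesgue. norm (f y))"
    using norm_transform_le[OF f, of 0 \<kappa>] by (force simp: half_line_fourier_def)
qed

lemma weighted_integrable_imp_integrable:
  assumes L2: "square_integrable_on f {0<..}" and l: "l \<ge> 0"
    and L1: "set_integrable lebesgue {0<..} (\<lambda>x. of_real ((1 + \<bar>x\<bar>) powr l) * f x)"
  shows "set_integrable lebesgue {0<..} f"
proof (rule set_integrable_bound[OF L1])
  show "set_borel_measurable lebesgue {0<..} f" using L2 by (simp add: square_integrable_on_def)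
  show "AE x in lebesgue. x \<in> {0<..} \<longrightarrow> norm (f x) \<le> norm (of_real ((1 + \<bar>x\<bar>) powr l) * f x)"
  proof (intro AE_I2 impI)
    fix x :: real
    have "1 \<le> (1 + \<bar>x\<bar>) powr l" using l by (intro ge_one_powr_ge_zero) auto
    then have "1 * norm (f x) \<le> (1 + \<bar>x\<bar>) powr l * norm (f x)" by (intro mult_right_mono) auto
    then show "norm (f x) \<le> norm (of_real ((1 + \<bar>x\<bar>) powr l) * f x)" by (simp add: norm_mult)
  qed
qed

lemma sobolev_H_imp_square_integrable: "sobolev_H m S f \<Longrightarrow> square_integrable_on f S"
  unfolding sobolev_H_def by (metis zero_le)

lemma divide_i: "z / (w * \<i>) = - (\<i> * z / w)" for z w :: complex
  by (simp only: divide_divide_eq_left[symmetric]) simp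

lemma I_omega_eq:
  fixes La Lb :: complex
  assumes "has_improper_integral (bdry_D R j) (\<lambda>k. osc x t k / k) La"
    "has_improper_integral (bdry_D R j) (\<lambda>k. osc x t k / k\<^sup>2) Lb"
  shows "I_omega R 0 j x t = La / (2 * pi * \<i>)" "I_omega R 1 j x t = - Lb / (2 * pi)"
proof -
  have "has_improper_integral (bdry_D R j) (\<lambda>k. osc x t k * (1 / (\<i> * k) ^ (0 + 1))) (1 / \<i> * La)"
    using has_improper_integral_cmult[OF assms(1), of "1 / \<i>"] by (simp add: divide_inverse mult_ac)
  from has_improper_integral_imp_eq[OF this] show "I_omega R 0 j x t = La / (2 * pi * \<i>)"
    by (simp add: I_omega_def divide_i)
  have "(\<i> * k) ^ (1 + 1) = - k\<^sup>2" for k by (simp add: power2_eq_square mult_ac)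
  then have "(\<lambda>k. osc x t k * (1 / (\<i> * k) ^ (1 + 1))) = (\<lambda>k. - 1 * (osc x t k / k\<^sup>2))"
    by (simp only:) simp
  then have "has_improper_integral (bdry_D R j) (\<lambda>k. osc x t k * (1 / (\<i> * k) ^ (1 + 1))) (- 1 * Lb)"
    using has_improper_integral_cmult[OF assms(2), of "- 1"] by (simp only:)
  from has_improper_integral_imp_eq[OF this] show "I_omega R 1 j x t = - Lb / (2 * pi)"
    by (simp add: I_omega_def)
qed

text \<open>
  The error is found in terms of \<open>\<rho> = x + t^(1/3)\<close>, and \<open>(t^(1/3))^(3/2) = t^(1/2)\<close>.
\<close>

lemma rho_three_halves_le:
  fixes x t a :: real
  assumes "x > 0" "t > 0" "a > 0" "a ^ 3 = t"
  shows "(x + a) * sqrt (x + a) \<le> 4 * (\<bar>x\<bar> powr (3/2) + \<bar>t\<bar> powr (1/2))"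
proof -
  have p: "y powr (3/2) = y * sqrt y" if "y > 0" for y :: real
  proof -
    have "y powr (3/2) = y powr (1 + 1/2)" by simp
    also have "\<dots> = y * sqrt y" using that by (simp only: powr_add powr_one powr_half_sqrt less_imp_le)
    finally show ?thesis .
  qed
  have at: "a * sqrt a = t powr (1/2)"
  proof -
    have "(a * sqrt a)\<^sup>2 = a\<^sup>2 * a" using assms by (simp add: power_mult_distrib)
    also have "\<dots> = t" using assms(4) by (simp add: power2_eq_square power3_eq_cube)
    finally have "(a * sqrt a)\<^sup>2 = t" .
    then have "sqrt t = a * sqrt a" using assms by (intro real_sqrt_unique) auto
    then show ?thesis using assms by (simp add: powr_half_sqrt)
  qed
  define m where "m = max x a"
  have m: "m > 0" "x + a \<le> 2 * m" using assms by (auto simp: m_def)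
  have "sqrt (2 * m) \<le> sqrt (4 * m)" using m by (intro real_sqrt_le_mono) auto
  then have s: "sqrt (2 * m) \<le> 2 * sqrt m" by (simp add: real_sqrt_mult)
  have "(x + a) * sqrt (x + a) \<le> (2 * m) * (2 * sqrt m)"
    using m assms by (intro mult_mono order_trans[OF real_sqrt_le_mono s]) auto
  also have "\<dots> = 4 * (m * sqrt m)" by simp
  also have "m * sqrt m \<le> x * sqrt x + a * sqrt a"
    using assms by (auto simp: m_def max_def intro!: add_increasing add_increasing2)
  finally show ?thesis using assms by (simp add: p at)
qed

text \<open>
  The explicit terms add up to the local solution by \<open>\<alpha>\<^sup>3 = 1\<close>: on the boundary of \<open>D\<^sub>j\<^sup>+\<close> the coefficients of
  the initial datum are \<open>1 / \<beta>\<close> and \<open>1 / \<beta>\<^sup>2\<close>, those of the boundary data are \<open>1 / \<beta> - 1\<close> and \<open>1 / \<beta>\<^sup>2 - 1\<close>.  The constant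
  in front of the error does not depend on \<open>x\<close> and \<open>t\<close>.
\<close>

lemma solution_minus_local_bound:
  fixes c d \<gamma>0 \<gamma>1 :: complex
  assumes R: "R > 0" and x: "x > 0" and t: "t > 0" and \<rho>: "\<rho> \<le> 1" "x \<le> \<rho>" "root 3 t \<le> \<rho>" and \<delta>: "\<delta> > 0" "x \<le> \<delta> / 2"
    and qo: "set_integrable lebesgue {0<..} qo"
    and expansion: "transform_expansion (half_line_fourier qo) c d \<delta> A N W"
    and g0: "boundary_expansion g0 2 1 \<gamma>0 (\<lambda>r. A0 / r ^ 4) x t" and A0: "A0 \<ge> 0"
    and g1: "boundary_expansion g1 1 2 \<gamma>1 (\<lambda>r. A1 * sqrt t / r\<^sup>2) x t" and A1: "A1 \<ge> 0"
  shows "norm (solution_formula R qo g0 g1 x t - q_loc R c d \<gamma>0 \<gamma>1 x t) \<le>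
    ((exp 2 * A * pi + 216 * A * exp 1 * pi / \<delta> ^ 3)
     + 4 * (exp 1 * (2 * A + 216 * A / \<delta> ^ 3) + norm (alpha - 1) * A0 + norm (alpha\<^sup>2 - 1) * A1)
     + 4 * (exp 1 * (2 * A + 216 * A / \<delta> ^ 3) + norm (alpha\<^sup>2 - 1) * A0 + norm (alpha - 1) * A1)) * (\<rho> * sqrt \<rho>)"
proof -
  define a where "a = root 3 t"
  have a: "a > 0" "a ^ 3 = t" using t by (auto simp: a_def)
  have ta: "t \<le> \<rho> ^ 3" using \<rho>(3) a by (auto simp: a_def[symmetric] intro: power_mono)
  have \<rho>0: "\<rho> > 0" using x \<rho> by simp
  note D1 = decaying_sector_D1 and D2 = decaying_sector_D2
  have eqD: "bdry_D1 R = sector_path (pi / 3) 0 R" "bdry_D2 R = sector_path pi (2 * pi / 3) R"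
    by (simp_all add: fun_eq_iff bdry_D1_eq bdry_D2_eq)
  obtain a1 b1 a2 b2 where
    ab1: "has_improper_integral (bdry_D1 R) (\<lambda>k. osc x t k / k) a1" "has_improper_integral (bdry_D1 R) (\<lambda>k. osc x t k / k\<^sup>2) b1"
    and ab2: "has_improper_integral (bdry_D2 R) (\<lambda>k. osc x t k / k) a2" "has_improper_integral (bdry_D2 R) (\<lambda>k. osc x t k / k\<^sup>2) b2"
    using sector_integral_osc_exists[OF D1 R x t] sector_integral_osc_exists[OF D2 R x t] unfolding eqD by blast
  have "1 / \<rho> > 0" using \<rho>0 by simp
  note La = line_integral_osc(1)[OF x t this R ab1(1) ab2(1)] and Lb = line_integral_osc(2)[OF x t this R ab1(2) ab2(2)]
  obtain e where e: "has_improper_integral real_line (\<lambda>k. osc x t k * half_line_fourier qo k)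
      (c / \<i> * (a1 + a2 + 2 * pi * \<i>) - d * (b1 + b2 - 2 * pi * x) + e)"
    "norm e \<le> (exp 2 * A * pi + 216 * A * exp 1 * pi / \<delta> ^ 3) * (\<rho> * sqrt \<rho>)"
  proof -
    have a\<rho>: "a \<le> \<rho>" using \<rho>(3) by (simp add: a_def)
    have "\<exists>e. has_improper_integral real_line (\<lambda>k. osc x t k * half_line_fourier qo k)
        (c / \<i> * (a1 + a2 + 2 * pi * \<i>) - d * (b1 + b2 - 2 * pi * x) + e) \<and>
      norm e \<le> (exp 2 * A * pi + 216 * A * exp 1 * pi / \<delta> ^ 3) * (\<rho> * sqrt \<rho>)"
      by (rule line_solution_integral[OF x a(1) a(2)[symmetric] \<rho>(1,2) a\<rho> \<delta> expansion
          half_line_fourier_props(1,2)[OF qo] half_line_fourier_props(3)[OF qo] La Lb])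
    then show ?thesis using that by blast
  qed
  have sec: "\<exists>e. has_improper_integral (sector_path \<theta>1 \<theta>2 R) (\<lambda>k. osc x t k * (half_line_fourier qo (\<beta> * k)
        + b0 * k\<^sup>2 * time_transform g0 (- omega k) t - \<i> * b1 * k * time_transform g1 (- omega k) t))
      (c / (\<i> * \<beta>) * La - d / \<beta>\<^sup>2 * Lb + b0 * \<i> * \<gamma>0 * La + b1 * \<gamma>1 * Lb + e) \<and>
    norm e \<le> 4 * (exp 1 * (2 * A + 216 * A / \<delta> ^ 3) + norm b0 * A0 + norm b1 * A1) * (\<rho> * sqrt \<rho>)"
    if "decaying_sector \<beta> \<theta>1 \<theta>2" "has_improper_integral (sector_path \<theta>1 \<theta>2 R) (\<lambda>k. osc x t k / k) La"
      "has_improper_integral (sector_path \<theta>1 \<theta>2 R) (\<lambda>k. osc x t k / k\<^sup>2) Lb" for \<beta> \<theta>1 \<theta>2 b0 b1 La Lb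
    by (rule sector_solution_integral[OF that(1) R x t \<rho>(1,2) ta \<delta>(1) expansion g0 A0 g1 A1 that(2,3)])
  obtain e1 where e1: "has_improper_integral (bdry_D1 R) (\<lambda>k. osc x t k * g_tilde_D1 qo g0 g1 k t)
      (c / (\<i> * alpha\<^sup>2) * a1 - d / (alpha\<^sup>2)\<^sup>2 * b1 + (alpha - 1) * \<i> * \<gamma>0 * a1 + (alpha\<^sup>2 - 1) * \<gamma>1 * b1 + e1)"
    "norm e1 \<le> 4 * (exp 1 * (2 * A + 216 * A / \<delta> ^ 3) + norm (alpha - 1) * A0 + norm (alpha\<^sup>2 - 1) * A1) * (\<rho> * sqrt \<rho>)"
    using sec[OF D1 ab1[unfolded eqD], of "alpha - 1" "alpha\<^sup>2 - 1"] unfolding g_tilde_D1_def eqD by blast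
  obtain e2 where e2: "has_improper_integral (bdry_D2 R) (\<lambda>k. osc x t k * g_tilde_D2 qo g0 g1 k t)
      (c / (\<i> * alpha) * a2 - d / alpha\<^sup>2 * b2 + (alpha\<^sup>2 - 1) * \<i> * \<gamma>0 * a2 + (alpha - 1) * \<gamma>1 * b2 + e2)"
    "norm e2 \<le> 4 * (exp 1 * (2 * A + 216 * A / \<delta> ^ 3) + norm (alpha\<^sup>2 - 1) * A0 + norm (alpha - 1) * A1) * (\<rho> * sqrt \<rho>)"
    using sec[OF D2 ab2[unfolded eqD], of "alpha\<^sup>2 - 1" "alpha - 1"] unfolding g_tilde_D2_def eqD by blast
  have I: "I_omega R 0 1 x t = a1 / (2 * pi * \<i>)" "I_omega R 1 1 x t = - b1 / (2 * pi)"
    "I_omega R 0 2 x t = a2 / (2 * pi * \<i>)" "I_omega R 1 2 x t = - b2 / (2 * pi)"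
  proof -
    have D: "bdry_D R 1 = bdry_D1 R" "bdry_D R 2 = bdry_D2 R" by (simp_all add: bdry_D_def)
    show "I_omega R 0 1 x t = a1 / (2 * pi * \<i>)" "I_omega R 1 1 x t = - b1 / (2 * pi)"
      by (rule I_omega_eq[OF ab1[folded D(1)]])+
    show "I_omega R 0 2 x t = a2 / (2 * pi * \<i>)" "I_omega R 1 2 x t = - b2 / (2 * pi)"
      by (rule I_omega_eq[OF ab2[folded D(2)]])+
  qed
  have al: "alpha \<noteq> 0" "1 / alpha = alpha\<^sup>2" "1 / alpha\<^sup>2 = alpha" "1 / (alpha\<^sup>2)\<^sup>2 = alpha\<^sup>2"
  proof -
    show 0: "alpha \<noteq> 0" by (simp add: alpha_eq_cis)
    show "1 / alpha = alpha\<^sup>2" "1 / alpha\<^sup>2 = alpha"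
      using alpha_cubed 0 by (simp_all add: field_simps eval_nat_numeral)
    have "alpha\<^sup>2 * (alpha\<^sup>2)\<^sup>2 = (alpha ^ 3)\<^sup>2" by (simp add: eval_nat_numeral)
    then show "1 / (alpha\<^sup>2)\<^sup>2 = alpha\<^sup>2" using alpha_cubed 0 by (simp add: field_simps)
  qed
  define p where "p = 2 * complex_of_real pi"
  have p: "p \<noteq> 0" by (simp add: p_def)
  have "solution_formula R qo g0 g1 x t = 1 / p * (c / \<i> * (a1 + a2 + p * \<i>) - d * (b1 + b2 - p * x) + e)
     - 1 / p * (c / (\<i> * alpha\<^sup>2) * a1 - d / (alpha\<^sup>2)\<^sup>2 * b1 + (alpha - 1) * \<i> * \<gamma>0 * a1 + (alpha\<^sup>2 - 1) * \<gamma>1 * b1 + e1)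
     - 1 / p * (c / (\<i> * alpha) * a2 - d / alpha\<^sup>2 * b2 + (alpha\<^sup>2 - 1) * \<i> * \<gamma>0 * a2 + (alpha - 1) * \<gamma>1 * b2 + e2)"
    unfolding solution_formula_def has_improper_integral_imp_eq[OF e(1)] has_improper_integral_imp_eq[OF e1(1)]
      has_improper_integral_imp_eq[OF e2(1)] by (simp add: p_def)
  also have "\<dots> = q_loc R c d \<gamma>0 \<gamma>1 x t + (e - e1 - e2) / p"
  proof -
    have i: "z / \<i> = - \<i> * z" for z by simp
    have inv: "inverse alpha = alpha\<^sup>2" "inverse (alpha\<^sup>2) = alpha" "inverse ((alpha\<^sup>2)\<^sup>2) = alpha\<^sup>2"
      using al(2-4) by (simp_all only: inverse_eq_divide)
    have ci: "c * (inverse \<i> * w) = - \<i> * c * w" for w by simp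
    have c1: "c / (\<i> * alpha\<^sup>2) = - \<i> * c * alpha" "c / (\<i> * alpha) = - \<i> * c * alpha\<^sup>2"
      "d / (alpha\<^sup>2)\<^sup>2 = d * alpha\<^sup>2" "d / alpha\<^sup>2 = d * alpha"
      by (simp_all only: divide_inverse inverse_mult_distrib inv ci)
    have I': "I_omega R 0 1 x t = - \<i> * a1 / p" "I_omega R 1 1 x t = - b1 / p"
      "I_omega R 0 2 x t = - \<i> * a2 / p" "I_omega R 1 2 x t = - b2 / p"
      unfolding I p_def by (simp_all add: field_simps)
    define P where "P = inverse p"
    have dP: "z / p = z * P" for z by (simp add: P_def divide_inverse)
    have pP: "p * P = 1" using p by (simp add: P_def)
    have h: "1 * P * (- \<i> * c * (a1 + a2 + p * \<i>) - d * (b1 + b2 - p * x) + e) =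
        c * (p * P) + d * x * (p * P) + P * (- \<i> * c * (a1 + a2) - d * (b1 + b2) + e)"
      by (simp add: algebra_simps)
    show ?thesis
      unfolding q_loc_def I' c1 i dP h pP by (simp add: algebra_simps)
  qed
  finally have "solution_formula R qo g0 g1 x t - q_loc R c d \<gamma>0 \<gamma>1 x t = (e - e1 - e2) / p" by simp
  also have "norm \<dots> \<le> norm (e - e1 - e2) / 1"
    unfolding norm_divide using pi_gt3 by (intro divide_left_mono) (auto simp: p_def norm_mult)
  also have "\<dots> \<le> norm e + norm e1 + norm e2"
    using norm_triangle_ineq4[of "e - e1" e2] norm_triangle_ineq4[of e e1] by simp
  also have "\<dots> \<le> (exp 2 * A * pi + 216 * A * exp 1 * pi / \<delta> ^ 3) * (\<rho> * sqrt \<rho>)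
     + 4 * (exp 1 * (2 * A + 216 * A / \<delta> ^ 3) + norm (alpha - 1) * A0 + norm (alpha\<^sup>2 - 1) * A1) * (\<rho> * sqrt \<rho>)
     + 4 * (exp 1 * (2 * A + 216 * A / \<delta> ^ 3) + norm (alpha\<^sup>2 - 1) * A0 + norm (alpha - 1) * A1) * (\<rho> * sqrt \<rho>)"
    by (intro add_mono e(2) e1(2) e2(2))
  finally show ?thesis by (simp only: distrib_right)
qed

theorem mainTheorem3:
  fixes qo g0 g1 :: "real \<Rightarrow> complex"
    and q :: "real \<Rightarrow> real \<Rightarrow> complex"
    and xs :: "nat \<Rightarrow> ereal" and ts :: "nat \<Rightarrow> real"
    and M K :: nat
    and T R l :: real
  assumes "R > 0" and "l \<ge> 0"
    and qo_L2: "square_integrable_on qo {0<..}"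
    and qo_L1: "set_integrable lebesgue {0<..} (\<lambda>x. of_real ((1 + \<bar>x\<bar>) powr l) * qo x)"
    and xs: "xs 0 = 0" "xs (M + 1) = \<infinity>" "strict_mono_on {..M + 1} xs"
    and qo_H2: "\<forall>i\<le>M. sobolev_H 2 (einterval (xs i) (xs (i + 1))) qo"
    and qo_jump: "\<forall>i\<in>{1..M}.
      right_lim qo (real_of_ereal (xs i)) \<noteq> left_lim qo (real_of_ereal (xs i))"
    and ts: "ts 0 = 0" "ts (K + 1) = T" "strict_mono_on {..K + 1} ts"
    and g0_H2: "\<forall>i\<le>K. sobolev_H 2 {ts i<..<ts (i + 1)} g0"
    and g1_H1: "\<forall>i\<le>K. sobolev_H 1 {ts i<..<ts (i + 1)} g1"
    and q_solution: "L2_solution T qo g0 g1 q"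
    and q_formula: "\<forall>x>0. \<forall>t\<in>{0<..T}. q x t = solution_formula R qo g0 g1 x t"
  shows "(\<lambda>(x, t). q x t -
            q_loc R (right_lim qo 0) (right_lim (weak_deriv (einterval (xs 0) (xs 1)) qo) 0)
              (right_lim g0 0) (right_lim g1 0) x t)
         \<in> O[at (0, 0) within {0<..} \<times> {0<..}](\<lambda>(x, t). of_real (\<bar>x\<bar> powr (3/2) + \<bar>t\<bar> powr (1/2)))"
proof -
  define c where "c = right_lim qo 0"
  define d where "d = right_lim (weak_deriv (einterval (xs 0) (xs 1)) qo) 0"
  define \<gamma>0 where "\<gamma>0 = right_lim g0 0"
  define \<gamma>1 where "\<gamma>1 = right_lim g1 0"
  have qoi: "set_integrable lebesgue {0<..} qo"
    by (rule weighted_integrable_imp_integrable[OF qo_L2 \<open>l \<ge> 0\<close> qo_L1])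
  have "xs 0 < xs 1" by (rule strict_mono_onD[OF xs(3)]) auto
  then obtain \<delta>' where "ereal 0 < ereal \<delta>'" "ereal \<delta>' < xs 1" using xs(1) ereal_dense2[of "xs 0" "xs 1"] by auto
  then have \<delta>: "\<delta>' > 0" "{0<..<\<delta>'} \<subseteq> einterval (xs 0) (xs 1)"
    using xs(1) by (auto simp: einterval_def intro: less_trans[of _ "ereal \<delta>'"])
  define b where "b = ts 1"
  have "ts 0 < ts 1" by (rule strict_mono_onD[OF ts(3)]) auto
  then have b: "b > 0" using ts(1) by (simp add: b_def)
  have bT: "b \<le> T"
  proof (cases "K = 0")
    case False
    then have "ts 1 < ts (K + 1)" by (intro strict_mono_onD[OF ts(3)]) auto
    then show ?thesis using ts(2) by (simp add: b_def)
  qed (use ts(2) in \<open>simp add: b_def\<close>)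
  have H2: "sobolev_H 2 (einterval (xs 0) (xs 1)) qo" using qo_H2 by (metis One_nat_def add_0 zero_le)
  have G0: "sobolev_H 2 {0<..<b} g0" using g0_H2 ts(1) unfolding b_def by (metis add_0 zero_le)
  have G1: "sobolev_H 1 {0<..<b} g1" using g1_H1 ts(1) unfolding b_def by (metis add_0 zero_le)
  have m0: "set_borel_measurable lebesgue {0<..<b} g0" "set_borel_measurable lebesgue {0<..<b} g1"
    using sobolev_H_imp_square_integrable[OF G0] sobolev_H_imp_square_integrable[OF G1]
    by (auto simp: square_integrable_on_def)
  obtain cq dq g where g: "set_integrable lebesgue {0..\<delta>'} g" "set_integrable lebesgue {0..\<delta>'} (\<lambda>x. (norm (g x))\<^sup>2)"
    "AE x in lebesgue. x \<in> {0<..<\<delta>'} \<longrightarrow> qo x = cq + integral {0..x} (\<lambda>s. dq + integral {0..s} g)"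
    and cd: "c = cq" "d = dq"
    unfolding c_def d_def by (rule sobolev_H2_right_expansion[OF H2 \<delta>(2,1)])
  obtain N W A where NW: "transform_expansion (half_line_fourier qo) c d \<delta>' A N W"
    by (rule half_line_fourier_expansion[OF qoi \<delta>(1) g[folded cd]])
  then have A: "A \<ge> 0" by (simp add: transform_expansion_def)
  obtain c0 d0 h0 where h0: "set_integrable lebesgue {0..b} h0" "set_integrable lebesgue {0..b} (\<lambda>x. (norm (h0 x))\<^sup>2)"
    "AE x in lebesgue. x \<in> {0<..<b} \<longrightarrow> g0 x = c0 + integral {0..x} (\<lambda>s. d0 + integral {0..s} h0)" "\<gamma>0 = c0"
    unfolding \<gamma>0_def by (rule sobolev_H2_right_expansion[OF G0 order_refl b])
  obtain A0 where A0: "A0 \<ge> 0" "\<And>x t. 0 < x \<Longrightarrow> 0 < t \<Longrightarrow> t < b \<Longrightarrow> boundary_expansion g0 2 1 \<gamma>0 (\<lambda>r. A0 / r ^ 4) x t"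
    by (rule osc_time_transform_H2[OF b h0(1) h0(3)[folded h0(4)] m0(1)]) (rule that; assumption)
  obtain c1 h1 where h1: "set_integrable lebesgue {0..b} h1" "set_integrable lebesgue {0..b} (\<lambda>x. (norm (h1 x))\<^sup>2)"
    "AE x in lebesgue. x \<in> {0<..<b} \<longrightarrow> g1 x = c1 + integral {0..x} h1" "\<gamma>1 = c1"
    unfolding \<gamma>1_def by (rule sobolev_H1_right_expansion[OF G1 order_refl b])
  obtain A1 where A1: "A1 \<ge> 0" "\<And>x t. 0 < x \<Longrightarrow> 0 < t \<Longrightarrow> t < b \<Longrightarrow> boundary_expansion g1 1 2 \<gamma>1 (\<lambda>r. A1 * sqrt t / r\<^sup>2) x t"
    by (rule osc_time_transform_H1[OF b h1(1,2) h1(3)[folded h1(4)] m0(2)]) (rule that; assumption)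
  define C where "C = (exp 2 * A * pi + 216 * A * exp 1 * pi / \<delta>' ^ 3)
     + 4 * (exp 1 * (2 * A + 216 * A / \<delta>' ^ 3) + norm (alpha - 1) * A0 + norm (alpha\<^sup>2 - 1) * A1)
     + 4 * (exp 1 * (2 * A + 216 * A / \<delta>' ^ 3) + norm (alpha\<^sup>2 - 1) * A0 + norm (alpha - 1) * A1)"
  have C0: "C \<ge> 0" unfolding C_def
    using \<delta>(1) A A0(1) A1(1) by (intro add_nonneg_nonneg mult_nonneg_nonneg divide_nonneg_nonneg) auto
  define \<epsilon> where "\<epsilon> = min (min (1/8) (\<delta>' / 2)) b"
  have \<epsilon>: "\<epsilon> > 0" using \<delta>(1) b by (simp add: \<epsilon>_def)
  have bound: "norm (q x t - q_loc R c d \<gamma>0 \<gamma>1 x t) \<le> (C * 4) * norm (complex_of_real (\<bar>x\<bar> powr (3/2) + \<bar>t\<bar> powr (1/2)))"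
    if x: "0 < x" "x < \<epsilon>" and t: "0 < t" "t < \<epsilon>" for x t
  proof -
    have tb: "t < b" using t by (simp add: \<epsilon>_def)
    define a where "a = root 3 t"
    have a: "a > 0" "a ^ 3 = t" using t by (auto simp: a_def)
    have "a \<le> 1 / 2"
    proof -
      have "root 3 t \<le> root 3 ((1/2) ^ 3)" using t by (intro real_root_le_mono) (auto simp: \<epsilon>_def power3_eq_cube)
      also have "root 3 ((1/2::real) ^ 3) = 1 / 2" by (rule real_root_power_cancel) auto
      finally show ?thesis by (simp add: a_def)
    qed
    then have \<rho>: "x + a \<le> 1" using x by (simp add: \<epsilon>_def)
    have "q x t = solution_formula R qo g0 g1 x t" using q_formula x t bT by (auto simp: \<epsilon>_def)
    moreover have "norm (solution_formula R qo g0 g1 x t - q_loc R c d \<gamma>0 \<gamma>1 x t) \<le> C * ((x + a) * sqrt (x + a))"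
      unfolding C_def
    proof (rule solution_minus_local_bound[OF \<open>R > 0\<close> x(1) t(1) \<rho> _ _ \<delta>(1) _ qoi NW A0(2)[OF x(1) t(1) tb] A0(1) A1(2)[OF x(1) t(1) tb] A1(1)])
      show "x \<le> x + a" "root 3 t \<le> x + a" using a x by (auto simp: a_def)
      show "x \<le> \<delta>' / 2" using x by (simp add: \<epsilon>_def)
    qed
    ultimately have "norm (q x t - q_loc R c d \<gamma>0 \<gamma>1 x t) \<le> C * ((x + a) * sqrt (x + a))" by simp
    also have "\<dots> \<le> C * (4 * (\<bar>x\<bar> powr (3/2) + \<bar>t\<bar> powr (1/2)))"
      by (intro mult_left_mono C0 rho_three_halves_le x t a)
    also have "\<dots> = (C * 4) * norm (complex_of_real (\<bar>x\<bar> powr (3/2) + \<bar>t\<bar> powr (1/2)))"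
      by (simp only: norm_of_real) simp
    finally show ?thesis .
  qed
  show ?thesis unfolding c_def[symmetric] d_def[symmetric] \<gamma>0_def[symmetric] \<gamma>1_def[symmetric]
  proof (rule bigoI[where c="C * 4"])
    show "\<forall>\<^sub>F p in at (0, 0) within {0<..} \<times> {0<..}.
      norm (case p of (x, t) \<Rightarrow> q x t - q_loc R c d \<gamma>0 \<gamma>1 x t) \<le> (C * 4) * norm (case p of (x, t) \<Rightarrow> complex_of_real (\<bar>x\<bar> powr (3/2) + \<bar>t\<bar> powr (1/2)))"
      unfolding eventually_at
    proof (intro exI[of _ \<epsilon>] conjI \<epsilon> ballI impI)
      fix p :: "real \<times> real" assume p: "p \<in> {0<..} \<times> {0<..}" "p \<noteq> (0, 0) \<and> dist p (0, 0) < \<epsilon>"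
      obtain x t where xt: "p = (x, t)" by (cases p)
      have "dist x 0 \<le> dist p (0, 0)" "dist t 0 \<le> dist p (0, 0)"
        using dist_fst_le[of p "(0, 0)"] dist_snd_le[of p "(0, 0)"] by (simp_all add: xt)
      then show "norm (case p of (x, t) \<Rightarrow> q x t - q_loc R c d \<gamma>0 \<gamma>1 x t) \<le> (C * 4) * norm (case p of (x, t) \<Rightarrow> complex_of_real (\<bar>x\<bar> powr (3/2) + \<bar>t\<bar> powr (1/2)))"
        using p xt by (simp only: prod.case) (intro bound; auto)
    qed
  qed
qed

end
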